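(* Let $G$ be a finite transitive permutation group on a set $\Omega$, let $\alpha\in\Omega$ and let $G_\alpha$ be the stabilizer in $G$ of the point $\alpha$. If $\mathbf{I}_\Omega(G)=\frac{5}{6}$, then there exists an elementary abelian normal $2$-subgroup $V$ of $G$ containing $G_\alpha$ with $|V:G_\alpha|=|G_\alpha|=4$. Moreover, let $e_1,e_2,e_3,e_4$ be a basis of $V$, regarded as a $4$-dimensional vector space over the field with $2$ elements, with $W:=G_\alpha=\langle e_1,e_2\rangle$; let $H:=G/\mathbf{C}_G(V)$, where $\mathbf{C}_G(V)$ is the centralizer of $V$ in $G$ (so that $H$ is regarded as a subgroup of $\mathrm{GL}(V)$ via the conjugation action of $G$ on $V$); and let $K$ be the stabilizer of the subspace $W$ in $\mathrm{GL}(V)$. Then $H$ is $K$-conjugate to one of the following two groups of matrices (written with respect to the basis $e_1,e_2,e_3,e_4$): $$ H_1=\left\langle \begin{pmatrix} 0& 0& 0& 1\\ 1& 1& 0& 0\\ 0& 0& 1& 0\\ 1& 0& 0& 1 \end{pmatrix}, \begin{pmatrix} 1& 1& 1& 1\\ 0& 0& 1& 0\\ 0& 1& 0& 0\\ 0& 0& 0& 1 \end{pmatrix} \right\rangle, $$ $$ H_2=\left\langle \begin{pmatrix} 0& 0& 0& 1\\ 1& 1& 0& 0\\ 0& 0& 1& 0\\ 1& 0& 0& 1 \end{pmatrix}, \begin{pmatrix} 1& 1& 1& 1\\ 0& 0& 1& 0\\ 0& 1& 0& 0\\ 0& 0& 0& 1 \end{pmatrix}, \begin{pmatrix} 1& 0&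 0& 0\\ 0& 1& 0& 0\\ 1& 1& 0& 1\\ 1& 1& 1& 0 \end{pmatrix} \right\rangle. $$ The group $H_1$ has order $12$ and is isomorphic to the alternating group of degree $4$, and the group $H_2$ has order $24$ and is isomorphic to the symmetric group of degree $4$. Conversely, if $G$ is a finite group containing an elementary abelian normal $2$-subgroup $V=\langle e_1,e_2,e_3,e_4\rangle$ of order $16$ and, with $W:=\langle e_1,e_2\rangle$ and $K$ the stabilizer of $W$ in $\mathrm{GL}(V)$, the group $H:=G/\mathbf{C}_G(V)\le\mathrm{GL}(V)$ is $K$-conjugate to $H_1$ or $H_2$ (matrices with respect to the basis $e_1,e_2,e_3,e_4$), then the action of $G$ on the set $\Omega$ of the right cosets of $\langle e_1,e_2\rangle$ gives rise to a finite permutation group of degree $4|G:V|$ with $\mathbf{I}_\Omega(G)=5/6$.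
   Context: For a finite transitive permutation group $G$ on $\Omega$ and $\alpha\in\Omega$, $$\mathbf{I}_\Omega(G):=\frac{|\{\omega\in\Omega\mid \omega\text{ lies in a }G_\alpha\text{-orbit of cardinality at most two}\}|}{|\Omega|},$$ where $G_\alpha$ is the stabilizer of $\alpha$ in $G$; as $G$ is transitive, this does not depend on $\alpha$. Groups act on the right; matrices over the field with $2$ elements act on row vectors by right multiplication, so the $i$-th row of a matrix gives the coordinates of the image of $e_i$ with respect to $e_1,e_2,e_3,e_4$. Two subgroups of $\mathrm{GL}(V)$ are $K$-conjugate if some element of $K\le\mathrm{GL}(V)$ conjugates one to the other. *)

theory Defs
  imports
    "HOL-Algebra.Group_Action"
    "HOL-Algebra.Generated_Groups"
    "HOL-Algebra.Sym_Groups"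
    "HOL-Analysis.Cartesian_Space"
    "HOL-Library.Z2"
    "HOL-Library.Numeral_Type"
begin

section \<open>Permutation groups\<close>

text \<open>
  The actions of \<open>Group_Action\<close> are left actions. A right action is encoded by letting \<open>\<phi> g\<close> be the
  permutation \<open>\<omega> \<mapsto> \<omega>\<^sup>h\<close> with \<open>h = g\<^sup>-\<^sup>1\<close>. This keeps the multiplication of the group, the
  point stabilizers and the orbits of every subgroup.
\<close>

definition finite_transitive_permutation_group ::
    "('a, 'm) monoid_scheme \<Rightarrow> 'b set \<Rightarrow> ('a \<Rightarrow> 'b \<Rightarrow> 'b) \<Rightarrow> bool" where
  "finite_transitive_permutation_group G \<Omega> \<phi> \<longleftrightarrow>
     finite \<Omega> \<and> faithful_action G \<Omega> \<phi> \<and> transitive_action G \<Omega> \<phi>"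

text \<open>For a transitive group the following does not depend on the point \<open>\<alpha>\<close> of \<open>\<Omega>\<close>.\<close>

definition I_ratio ::
    "('a, 'm) monoid_scheme \<Rightarrow> 'b set \<Rightarrow> ('a \<Rightarrow> 'b \<Rightarrow> 'b) \<Rightarrow> 'b \<Rightarrow> real" where
  "I_ratio G \<Omega> \<phi> \<alpha> =
     real (card {\<omega> \<in> \<Omega>. \<exists>\<Delta> \<in> orbits (G\<lparr>carrier := stabilizer G \<phi> \<alpha>\<rparr>) \<Omega> \<phi>. \<omega> \<in> \<Delta> \<and> card \<Delta> \<le> 2})
       / real (card \<Omega>)"

text \<open>Right multiplication on the right cosets of \<open>W\<close>; the inverse is due to the encoding above.\<close>

definition coset_action :: "('a, 'm) monoid_scheme \<Rightarrow> 'a set \<Rightarrow> 'a \<Rightarrow> 'a set \<Rightarrow> 'a set" where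
  "coset_action G W g = (\<lambda>C \<in> rcosets\<^bsub>G\<^esub> W. C #>\<^bsub>G\<^esub> (inv\<^bsub>G\<^esub> g))"

definition induced_permutation_group ::
    "('a, 'm) monoid_scheme \<Rightarrow> 'b set \<Rightarrow> ('a \<Rightarrow> 'b \<Rightarrow> 'b) \<Rightarrow> ('b \<Rightarrow> 'b) monoid" where
  "induced_permutation_group G \<Omega> \<phi> = (BijGroup \<Omega>)\<lparr>carrier := \<phi> ` carrier G\<rparr>"


section \<open>Elementary abelian 2-groups as vector spaces over the field with two elements\<close>

definition subgroup_index :: "('a, 'm) monoid_scheme \<Rightarrow> 'a set \<Rightarrow> 'a set \<Rightarrow> nat" where
  "subgroup_index G A B = card (rcosets\<^bsub>G\<lparr>carrier := A\<rparr>\<^esub> B)"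

definition elementary_abelian_2_group :: "('a, 'm) monoid_scheme \<Rightarrow> bool" where
  "elementary_abelian_2_group A \<longleftrightarrow>
     comm_group A \<and> (\<forall>x \<in> carrier A. x [^]\<^bsub>A\<^esub> (2::nat) = \<one>\<^bsub>A\<^esub>)"

definition F2_smult :: "('a, 'm) monoid_scheme \<Rightarrow> bit \<Rightarrow> 'a \<Rightarrow> 'a" where
  "F2_smult G c v = (if c = 1 then v else \<one>\<^bsub>G\<^esub>)"

text \<open>
  The linear combination with row of coefficients \<open>x\<close>, written multiplicatively. The index type \<open>4\<close>
  consists of \<open>1, 2, 3, 4\<close> (where \<open>4 = 0\<close>), and \<open>vector\<close> lists entries in this order.
\<close>

definition F2_comb :: "('a, 'm) monoid_scheme \<Rightarrow> (4 \<Rightarrow> 'a) \<Rightarrow> bit^4 \<Rightarrow> 'a" where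
  "F2_comb G e x =
     F2_smult G (x $ 1) (e 1) \<otimes>\<^bsub>G\<^esub> F2_smult G (x $ 2) (e 2) \<otimes>\<^bsub>G\<^esub>
     F2_smult G (x $ 3) (e 3) \<otimes>\<^bsub>G\<^esub> F2_smult G (x $ 4) (e 4)"

definition F2_basis :: "('a, 'm) monoid_scheme \<Rightarrow> 'a set \<Rightarrow> (4 \<Rightarrow> 'a) \<Rightarrow> bool" where
  "F2_basis G V e \<longleftrightarrow> range e \<subseteq> V \<and> (\<forall>v \<in> V. \<exists>!x. v = F2_comb G e x)"

text \<open>\<open>GL(V)\<close> acts on the right, so \<open>f \<otimes> g\<close> is \<open>f\<close> followed by \<open>g\<close>.\<close>

definition GL_group :: "('a, 'm) monoid_scheme \<Rightarrow> 'a set \<Rightarrow> ('a \<Rightarrow> 'a) monoid" where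
  "GL_group G V =
     \<lparr>carrier = {f \<in> Bij V.
        (\<forall>u \<in> V. \<forall>v \<in> V. f (u \<otimes>\<^bsub>G\<^esub> v) = f u \<otimes>\<^bsub>G\<^esub> f v) \<and>
        (\<forall>c. \<forall>v \<in> V. f (F2_smult G c v) = F2_smult G c (f v))},
      monoid.mult = (\<lambda>f g. compose V g f),
      one = (\<lambda>v \<in> V. v)\<rparr>"

definition subspace_stabilizer ::
    "('a, 'm) monoid_scheme \<Rightarrow> 'a set \<Rightarrow> 'a set \<Rightarrow> ('a \<Rightarrow> 'a) set" where
  "subspace_stabilizer G V W = {k \<in> carrier (GL_group G V). k ` W = W}"

definition conjugate_under :: "('a, 'm) monoid_scheme \<Rightarrow> 'a set \<Rightarrow> 'a set \<Rightarrow> 'a set \<Rightarrow> bool" where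
  "conjugate_under L K A B \<longleftrightarrow> (\<exists>k \<in> K. (\<lambda>h. inv\<^bsub>L\<^esub> k \<otimes>\<^bsub>L\<^esub> h \<otimes>\<^bsub>L\<^esub> k) ` A = B)"

definition centralizer :: "('a, 'm) monoid_scheme \<Rightarrow> 'a set \<Rightarrow> 'a set" where
  "centralizer G S = {g \<in> carrier G. \<forall>s \<in> S. g \<otimes>\<^bsub>G\<^esub> s = s \<otimes>\<^bsub>G\<^esub> g}"

definition conj_map :: "('a, 'm) monoid_scheme \<Rightarrow> 'a set \<Rightarrow> 'a \<Rightarrow> 'a \<Rightarrow> 'a" where
  "conj_map G V g = (\<lambda>v \<in> V. inv\<^bsub>G\<^esub> g \<otimes>\<^bsub>G\<^esub> v \<otimes>\<^bsub>G\<^esub> g)"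

text \<open>
  The quotient of \<open>G\<close> by the centralizer of \<open>V\<close>, embedded in \<open>GL(V)\<close>: all elements of a coset
  \<open>C\<close> of the centralizer induce the same map on \<open>V\<close>, and \<open>C\<close> is sent to this map.
\<close>

definition conj_quotient :: "('a, 'm) monoid_scheme \<Rightarrow> 'a set \<Rightarrow> ('a \<Rightarrow> 'a) set" where
  "conj_quotient G V = (\<lambda>C. the_elem (conj_map G V ` C)) ` carrier (G Mod centralizer G V)"


section \<open>The two matrix groups\<close>

definition GL4 :: "(bit^4^4) monoid" where
  "GL4 = \<lparr>carrier = {A. invertible A}, monoid.mult = (**), one = mat 1\<rparr>"

definition mat_a :: "bit^4^4" where
  "mat_a = vector [vector [0, 0, 0, 1],
                   vector [1, 1, 0, 0],
                   vector [0, 0, 1, 0],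
                   vector [1, 0, 0, 1]]"

definition mat_b :: "bit^4^4" where
  "mat_b = vector [vector [1, 1, 1, 1],
                   vector [0, 0, 1, 0],
                   vector [0, 1, 0, 0],
                   vector [0, 0, 0, 1]]"

definition mat_c :: "bit^4^4" where
  "mat_c = vector [vector [1, 0, 0, 0],
                   vector [0, 1, 0, 0],
                   vector [1, 1, 0, 1],
                   vector [1, 1, 1, 0]]"

definition H1 :: "(bit^4^4) set" where
  "H1 = generate GL4 {mat_a, mat_b}"

definition H2 :: "(bit^4^4) set" where
  "H2 = generate GL4 {mat_a, mat_b, mat_c}"

text \<open>
  The linear maps whose matrix with respect to the basis \<open>e\<close> lies in \<open>M\<close>; matrices act on
  coordinate rows by right multiplication.
\<close>

definition maps_of_matrices ::
    "('a, 'm) monoid_scheme \<Rightarrow> 'a set \<Rightarrow> (4 \<Rightarrow> 'a) \<Rightarrow> (bit^4^4) set \<Rightarrow> ('a \<Rightarrow> 'a) set" where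
  "maps_of_matrices G V e M =
     {f \<in> carrier (GL_group G V). \<exists>A \<in> M. \<forall>x. f (F2_comb G e x) = F2_comb G e (x v* A)}"

definition K_conjugate_to_matrices ::
    "('a, 'm) monoid_scheme \<Rightarrow> 'a set \<Rightarrow> (4 \<Rightarrow> 'a) \<Rightarrow> (bit^4^4) set \<Rightarrow> bool" where
  "K_conjugate_to_matrices G V e M \<longleftrightarrow>
     conjugate_under (GL_group G V) (subspace_stabilizer G V (generate G {e 1, e 2}))
       (conj_quotient G V) (maps_of_matrices G V e M)"

end

theory Submission
  imports Defs
begin

text \<open>
  Write \<open>W\<close> for a point stabilizer and \<open>C\<close> for the set of all point stabilizers, a class of
  conjugate subgroups with trivial intersection. The suborbit of \<open>\<omega>\<close> has length
  \<open>|W : W \<inter> G\<^sub>\<omega>|\<close>, so the ratio depends on \<open>C\<close> only: call \<open>X\<close> and \<open>Y\<close> in \<open>C\<close> near if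
  \<open>X \<inter> Y\<close> has index at most two in \<open>X\<close>; then the ratio is the proportion of members of \<open>C\<close>
  that are near to \<open>W\<close> (\<open>I_ratio_eq\<close>). If it is \<open>5 / 6\<close>, then \<open>|C| = 6 m\<close>, and every
  member of \<open>C\<close> fails to be near to exactly \<open>m\<close> members.

  The \<open>5 m - 1\<close> neighbours of \<open>W\<close> are arranged in a grid. The row of \<open>X\<close> is the maximal subgroup
  \<open>W \<inter> X\<close> of \<open>W\<close>; the column of \<open>X\<close> is the subgroup generated by \<open>W\<close> and \<open>X\<close>, if \<open>W\<close> has
  index two in it. Two neighbours of \<open>W\<close> that are near to each other share a row or a column
  (\<open>near_triple\<close>). A subgroup that is contained in more than half of the members of \<open>C\<close>, or that
  contains more than half of them, with index two in both cases, would be normal in \<open>G\<close>: it shares two of these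
  members with each of its conjugates, and two members determine it. Then all members of \<open>C\<close> would be near to each other (\<open>few_above\<close>,
  \<open>few_below\<close>). Hence every row and every column has at most \<open>3 m - 1\<close> entries, while the number
  of entries that share neither row nor column with a given one is at most \<open>m\<close>. A count of the
  entries (\<open>rook_grid\<close>) leaves only \<open>m = 1\<close> and a two by two grid.

  So \<open>C\<close> consists of six subgroups that form an octahedron. The intersections of adjacent members
  are four subgroups of order two, whose generators \<open>f\<^sub>1, ..., f\<^sub>4\<close> commute and are a basis
  of a normal subgroup \<open>V\<close> of order \<open>16\<close>, and \<open>C\<close> consists of the six planes
  \<open>\<langle>f\<^sub>i, f\<^sub>j\<rangle>\<close> (\<open>klein_cover\<close>, \<open>octahedron_frame\<close>). Conjugation permutes the six planes,
  hence the four basis vectors, and it is transitive on the planes. A subgroup of the symmetric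
  group of degree four that is transitive on pairs is the alternating or the symmetric group
  (\<open>pair_transitive_subgroup\<close>).

  The groups \<open>H1\<close> and \<open>H2\<close> are the alternating and the symmetric group on the basis
  \<open>e\<^sub>2, e\<^sub>1 + e\<^sub>2, e\<^sub>1 + e\<^sub>2 + e\<^sub>4, e\<^sub>3\<close>, whose first two vectors span
  \<open>\<langle>e\<^sub>1, e\<^sub>2\<rangle>\<close>. The linear map that sends \<open>f\<^sub>1, ..., f\<^sub>4\<close> to this basis is therefore in
  \<open>K\<close> and conjugates \<open>H\<close> to \<open>H1\<close> or \<open>H2\<close>. Conversely, if \<open>H\<close> is conjugate to one of them, then the
  conjugates of \<open>W\<close> are the six coordinate planes of a basis, and \<open>W\<close> meets all of them
  non-trivially except the complementary one.
\<close>

section \<open>Counting in a grid\<close>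

text \<open>
  Rows and columns are the fibres of the labels \<open>r\<close> and \<open>c\<close>. The cross of an entry, that is, its
  row and its column together, has at least \<open>4 m - 1\<close> entries. As a column alone is too small to be a
  cross, the row contains two entries in different columns. Their crosses meet exactly in the row, and
  inclusion and exclusion gives \<open>2 (4 m - 1) \<le> (5 m - 1) + |row|\<close>.
\<close>

lemma row_is_full:
  fixes r :: "'x \<Rightarrow> 'p" and c :: "'x \<Rightarrow> 'q"
  assumes fin: "finite N" and card_N: "card N + 1 = 5 * m"
    and row: "\<And>x. x \<in> N \<Longrightarrow> card {y \<in> N. r y = r x} + 1 \<le> 3 * m"
    and col: "\<And>x. x \<in> N \<Longrightarrow> card {y \<in> N. c y = c x} + 1 \<le> 3 * m"
    and off: "\<And>x. x \<in> N \<Longrightarrow> card {y \<in> N. r y \<noteq> r x \<and> c y \<noteq> c x} \<le> m"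
    and x: "x \<in> N"
  shows "card {y \<in> N. r y = r x} + 1 = 3 * m"
proof -
  define R where "R = {y \<in> N. r y = r x}"
  define K where "K z = {y \<in> N. c y = c z}" for z
  have finR: "finite R" "finite (K z)" for z using fin by (auto simp: R_def K_def)
  have m: "m > 0" using card_N by (cases m) auto
  have cross: "4 * m \<le> card (R \<union> K z) + 1" if "z \<in> R" for z
  proof -
    have "N = (R \<union> K z) \<union> {y \<in> N. r y \<noteq> r z \<and> c y \<noteq> c z}"
      using that by (auto simp: R_def K_def)
    then have "card N \<le> card (R \<union> K z) + card {y \<in> N. r y \<noteq> r z \<and> c y \<noteq> c z}"
      by (metis card_Un_le)
    moreover have "card {y \<in> N. r y \<noteq> r z \<and> c y \<noteq> c z} \<le> m"
      using off[of z] that by (simp add: R_def)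
    ultimately show ?thesis using card_N by linarith
  qed
  have xR: "x \<in> R" using x by (simp add: R_def)
  obtain y where y: "y \<in> R" "c y \<noteq> c x"
  proof (rule ccontr)
    assume "\<not> thesis"
    then have "\<forall>y\<in>R. c y = c x" using that by blast
    then have "R \<union> K x = K x" by (auto simp: R_def K_def)
    with cross[OF xR] col[OF x] m show False by (simp add: K_def)
  qed
  have "(R \<union> K x) \<inter> (R \<union> K y) = R" using y by (auto simp: K_def)
  then have "card (R \<union> K x) + card (R \<union> K y) = card ((R \<union> K x) \<union> (R \<union> K y)) + card R"
    using card_Un_Int[of "R \<union> K x" "R \<union> K y"] finR by simp
  moreover have "card ((R \<union> K x) \<union> (R \<union> K y)) \<le> card N"
    by (rule card_mono[OF fin]) (auto simp: R_def K_def)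
  ultimately have "3 * m \<le> card R + 1"
    using cross[OF xR] cross[OF y(1)] card_N by linarith
  with row[OF x] show ?thesis by (simp add: R_def)
qed

text \<open>
  Rows are disjoint and there is more than one, so \<open>2 (3 m - 1) \<le> 5 m - 1\<close> once they are full.
\<close>

lemma rook_grid:
  fixes r :: "'x \<Rightarrow> 'p" and c :: "'x \<Rightarrow> 'q"
  assumes fin: "finite N" and card_N: "card N + 1 = 5 * m"
    and row: "\<And>x. x \<in> N \<Longrightarrow> card {y \<in> N. r y = r x} + 1 \<le> 3 * m"
    and col: "\<And>x. x \<in> N \<Longrightarrow> card {y \<in> N. c y = c x} + 1 \<le> 3 * m"
    and off: "\<And>x. x \<in> N \<Longrightarrow> card {y \<in> N. r y \<noteq> r x \<and> c y \<noteq> c x} \<le> m"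
  shows "m = 1"
    and "x \<in> N \<Longrightarrow> card {y \<in> N. r y = r x} = 2"
    and "x \<in> N \<Longrightarrow> card {y \<in> N. c y = c x} = 2"
proof -
  have R: "card {y \<in> N. r y = r x} + 1 = 3 * m" if "x \<in> N" for x
    by (rule row_is_full[OF fin card_N row col off that])
  have C: "card {y \<in> N. c y = c x} + 1 = 3 * m" if "x \<in> N" for x
    by (rule row_is_full[OF fin card_N col row _ that]) (use off in \<open>simp_all add: conj_commute\<close>)
  have m: "m > 0" using card_N by (cases m) auto
  show "m = 1"
  proof (rule ccontr)
    assume "m \<noteq> 1"
    then have m2: "m \<ge> 2" using m by simp
    then have "N \<noteq> {}" using card_N by auto
    then obtain x where x: "x \<in> N" by auto
    have "{y \<in> N. r y = r x} \<noteq> N" using R[OF x] card_N m by auto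
    then obtain z where z: "z \<in> N" "r z \<noteq> r x" by auto
    have "card ({y \<in> N. r y = r x} \<union> {y \<in> N. r y = r z}) \<le> card N"
      by (rule card_mono[OF fin]) auto
    moreover have "card ({y \<in> N. r y = r x} \<union> {y \<in> N. r y = r z})
        = card {y \<in> N. r y = r x} + card {y \<in> N. r y = r z}"
      by (rule card_Un_disjoint) (use fin z in auto)
    ultimately show False using R[OF x] R[OF z(1)] card_N m2 by linarith
  qed
  then show "x \<in> N \<Longrightarrow> card {y \<in> N. r y = r x} = 2" "x \<in> N \<Longrightarrow> card {y \<in> N. c y = c x} = 2"
    using R C by fastforce+
qed

section \<open>Subgroups of index at most two\<close>

text \<open>
  For a finite subgroup \<open>X\<close> this says that \<open>X \<inter> Y\<close> has index at most two in \<open>X\<close>.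
\<close>

definition near :: "'a set \<Rightarrow> 'a set \<Rightarrow> bool" where
  "near X Y \<longleftrightarrow> card X \<le> 2 * card (X \<inter> Y)"

context group
begin

lemma inv_cancel_left [simp]:
  assumes "x \<in> carrier G" "y \<in> carrier G"
  shows "inv x \<otimes> (x \<otimes> y) = y" "x \<otimes> (inv x \<otimes> y) = y"
  using assms by (simp_all add: m_assoc[symmetric])

text \<open>
  The description by elements: outside a subgroup of index two, the product of two elements falls
  back into it. It replaces cosets in all later arguments.
\<close>

lemma near_iff:
  assumes X: "subgroup X G" "finite X" and Y: "subgroup Y G"
  shows "near X Y \<longleftrightarrow> (\<forall>a\<in>X - Y. \<forall>b\<in>X - Y. a \<otimes> b \<in> Y)"
proof
  assume n: "near X Y"
  show "\<forall>a\<in>X - Y. \<forall>b\<in>X - Y. a \<otimes> b \<in> Y"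
  proof (intro ballI)
    fix a b assume a: "a \<in> X - Y" and b: "b \<in> X - Y"
    note XG = subgroup.mem_carrier[OF X(1)] and YG = subgroup.mem_carrier[OF Y]
    define M where "M = X \<inter> Y"
    have M: "M \<subseteq> X" "M \<subseteq> Y" "finite M" using X by (auto simp: M_def)
    let ?L = "(\<lambda>y. inv a \<otimes> y) ` M"
    have L: "?L \<subseteq> X" using a X M by (auto intro!: subgroup.m_closed subgroup.m_inv_closed)
    have MG: "M \<subseteq> carrier G" "a \<in> carrier G" using M XG a by auto
    then have inj: "inj_on (\<lambda>y. inv a \<otimes> y) M"
      by (auto intro!: inj_onI simp: subset_iff)
    have disj: "?L \<inter> M = {}"
    proof (rule ccontr)
      assume "?L \<inter> M \<noteq> {}"
      then obtain y z where yz: "y \<in> M" "z \<in> M" "z = inv a \<otimes> y" by auto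
      have "y \<in> carrier G" "z \<in> carrier G" "a \<in> carrier G" using yz M a XG by auto
      then have "a = y \<otimes> inv z" using yz(3) by (simp add: inv_mult_group m_assoc[symmetric])
      moreover have "y \<otimes> inv z \<in> Y"
        using yz(1,2) M Y by (blast intro: subgroup.m_closed subgroup.m_inv_closed)
      ultimately show False using a by simp
    qed
    have "card (?L \<union> M) = 2 * card M"
      using disj M inj by (subst card_Un_disjoint) (auto simp: card_image)
    then have "?L \<union> M = X" using n L M X
      by (intro card_seteq) (auto simp: near_def M_def)
    then have "b \<in> ?L" using b by (auto simp: M_def)
    then obtain y where y: "y \<in> M" "b = inv a \<otimes> y" by auto
    then have "a \<otimes> b = y" using a M XG by (auto simp: m_assoc[symmetric])
    then show "a \<otimes> b \<in> Y" using y M by auto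
  qed
next
  assume *: "\<forall>a\<in>X - Y. \<forall>b\<in>X - Y. a \<otimes> b \<in> Y"
  show "near X Y"
  proof (cases "X \<subseteq> Y")
    case True
    then show ?thesis by (simp add: near_def Int_absorb2)
  next
    case False
    then obtain a where a: "a \<in> X - Y" by auto
    have "card (X - Y) \<le> card (X \<inter> Y)"
    proof (rule card_inj_on_le[of "\<lambda>b. a \<otimes> b"])
      show "inj_on (\<lambda>b. a \<otimes> b) (X - Y)"
        using a subgroup.mem_carrier[OF X(1)] by (auto intro!: inj_onI)
      show "(\<lambda>b. a \<otimes> b) ` (X - Y) \<subseteq> X \<inter> Y"
        using * a X by (auto intro: subgroup.m_closed)
    qed (use X in auto)
    moreover have "card X = card (X - Y) + card (X \<inter> Y)"
      using X(2) by (metis Int_Diff_Un Int_Diff_disjoint add.commute card_Un_disjoint finite_Diff finite_Int)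
    ultimately show ?thesis by (simp add: near_def)
  qed
qed

lemma nearD:
  assumes "near X Y" "subgroup X G" "finite X" "subgroup Y G" "a \<in> X" "b \<in> X" "a \<notin> Y" "b \<notin> Y"
  shows "a \<otimes> b \<in> Y"
  using near_iff[OF assms(2,3,4)] assms by auto

lemma near_conjugate:
  assumes n: "near X Y" and X: "subgroup X G" "finite X" and Y: "subgroup Y G"
    and z: "z \<in> X" and a: "a \<in> X \<inter> Y"
  shows "z \<otimes> a \<otimes> inv z \<in> Y"
proof (cases "z \<in> Y")
  case True
  then show ?thesis using a Y by (auto intro!: subgroup.m_closed subgroup.m_inv_closed)
next
  case False
  have car: "z \<in> carrier G" "a \<in> carrier G" using z a subgroup.mem_carrier[OF X(1)] by auto
  have "z \<otimes> a \<notin> Y"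
  proof
    assume "z \<otimes> a \<in> Y"
    then have "z \<otimes> a \<otimes> inv a \<in> Y" using a Y by (auto intro!: subgroup.m_closed subgroup.m_inv_closed)
    then show False using False car by (simp add: m_assoc)
  qed
  moreover have "inv z \<notin> Y" using False Y car by (metis inv_inv subgroup.m_inv_closed)
  ultimately show ?thesis
    using nearD[OF n X Y, of "z \<otimes> a" "inv z"] z a
      subgroup.m_closed[OF X(1), of z a] subgroup.m_inv_closed[OF X(1), of z] by blast
qed

lemma subgroup_finiteI:
  assumes "finite U" "U \<subseteq> carrier G" "\<one> \<in> U" "\<And>x y. x \<in> U \<Longrightarrow> y \<in> U \<Longrightarrow> x \<otimes> y \<in> U"
  shows "subgroup U G"
proof (rule subgroup.intro[OF assms(2,4,3)])
  fix x assume x: "x \<in> U"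
  then have "(\<lambda>y. x \<otimes> y) ` U = U"
    using assms(1,2,4) by (intro card_seteq) (auto simp: card_image inj_on_def subset_iff)
  then obtain y where y: "y \<in> U" "x \<otimes> y = \<one>" using assms(3) by (metis imageE)
  then have "inv x = y" using assms(2) x by (metis inv_equality subsetD inv_comm)
  then show "inv x \<in> U" using y by simp
qed

lemma near_card_half:
  assumes "near A B" "subgroup A G" "finite A" "subgroup B G" "finite B" "card A = card B" "A \<noteq> B"
  shows "card (A \<inter> B) * 2 = card A"
proof -
  have lt: "card (A \<inter> B) < card A"
    using assms by (metis Int_lower1 Int_lower2 card_subset_eq psubsetI psubset_card_mono)
  have "subgroup (A \<inter> B) (G\<lparr>carrier := A\<rparr>)"
    by (intro subgroup_incl subgroups_Inter_pair assms) auto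
  from group.lagrange[OF subgroup_imp_group[OF assms(2)] this]
  obtain k where k: "k * card (A \<inter> B) = card A" by (auto simp: order_def)
  have "card A > 0" using assms(2,3) subgroup.one_closed card_gt_0_iff by blast
  then have "k \<noteq> 0" "k \<noteq> 1" using k lt by (intro notI; simp)+
  then have "2 * card (A \<inter> B) \<le> card A" using k by (metis One_nat_def Suc_leI less_2_cases mult_le_mono1 not_less numeral_2_eq_2)
  then show ?thesis using assms(1) by (simp add: near_def)
qed

text \<open>
  Take \<open>z\<close> in \<open>X \<inter> Y\<close> outside \<open>W\<close>. It normalises \<open>W \<inter> X\<close>, which has index two in \<open>X\<close>, and
  \<open>W \<inter> Y\<close>, which has index two in \<open>Y\<close>. These two distinct maximal subgroups generate \<open>W\<close>, so \<open>z\<close>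
  normalises \<open>W\<close>, and \<open>W \<union> z W\<close> is the required group.
\<close>

lemma near_triple:
  assumes W: "subgroup W G" "finite W" and X: "subgroup X G" "finite X" and Y: "subgroup Y G" "finite Y"
    and WX: "near W X" "near X W" and WY: "near W Y" "near Y W" and XY: "near X Y"
    and cXY: "card X = card W" "card Y = card W"
    and ne: "W \<inter> X \<noteq> W \<inter> Y" "Y \<noteq> W" "X \<noteq> W" "X \<noteq> Y"
  obtains U where "subgroup U G" "card U = 2 * card W" "W \<union> X \<union> Y \<subseteq> U"
proof -
  note WG = subgroup.mem_carrier[OF W(1)] and XG = subgroup.mem_carrier[OF X(1)]
    and YG = subgroup.mem_carrier[OF Y(1)]
  note cl = subgroup.m_closed[OF W(1)] subgroup.m_inv_closed[OF W(1)]
  note MWX = subgroups_Inter_pair[OF W(1) X(1)] and MWY = subgroups_Inter_pair[OF W(1) Y(1)]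
  have proper: "\<not> A \<subseteq> B" if "card A = card B" "A \<noteq> B" "finite B" for A B :: "'a set"
    using that card_subset_eq by metis
  have halves: "card (W \<inter> X) * 2 = card W" "card (W \<inter> Y) * 2 = card W"  "card (X \<inter> Y) * 2 = card W"
    using near_card_half WX(1) WY(1) XY W X Y cXY ne by metis+
  have "\<not> X \<inter> Y \<subseteq> W"
  proof
    assume "X \<inter> Y \<subseteq> W"
    then have "X \<inter> Y \<subseteq> W \<inter> X" "X \<inter> Y \<subseteq> W \<inter> Y" by auto
    then have "X \<inter> Y = W \<inter> X" "X \<inter> Y = W \<inter> Y"
      using halves W(2) by (intro card_subset_eq; simp)+
    then show False using ne(1) by simp
  qed
  then obtain z where z: "z \<in> X" "z \<in> Y" "z \<notin> W" by auto
  have "\<not> W \<inter> X \<subseteq> W \<inter> Y"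
    using proper[of "W \<inter> X" "W \<inter> Y"] halves ne W by simp
  then obtain p where p: "p \<in> W" "p \<in> X" "p \<notin> Y" by auto
  have split: "\<exists>a\<in>W \<inter> X. \<exists>b\<in>W \<inter> Y. w = a \<otimes> b" if "w \<in> W" for w
  proof (cases "w \<in> Y")
    case True
    then show ?thesis using that subgroup.one_closed[OF W(1)] subgroup.one_closed[OF X(1)] WG
      by (intro bexI[of _ \<one>] bexI[of _ w]) auto
  next
    case False
    have "p \<otimes> w \<in> Y" using nearD[OF WY(1) W Y(1)] p that False by blast
    moreover have "w = inv p \<otimes> (p \<otimes> w)" using p that WG by (simp add: m_assoc[symmetric])
    ultimately show ?thesis
      using p that cl subgroup.m_inv_closed[OF X(1)] by (intro bexI[of _ "inv p"] bexI[of _ "p \<otimes> w"]) auto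
  qed
  have normalises: "t \<otimes> w \<otimes> inv t \<in> W" if t: "t \<in> X" "t \<in> Y" and w: "w \<in> W" for t w
  proof -
    obtain a b where ab: "a \<in> W \<inter> X" "b \<in> W \<inter> Y" "w = a \<otimes> b" using split[OF w] by auto
    have "t \<otimes> a \<otimes> inv t \<in> W" "t \<otimes> b \<otimes> inv t \<in> W"
      using near_conjugate[OF WX(2) X W(1) t(1), of a] near_conjugate[OF WY(2) Y W(1) t(2), of b] ab by auto
    then have "(t \<otimes> a \<otimes> inv t) \<otimes> (t \<otimes> b \<otimes> inv t) \<in> W" by (rule cl)
    moreover have "(t \<otimes> a \<otimes> inv t) \<otimes> (t \<otimes> b \<otimes> inv t) = t \<otimes> w \<otimes> inv t"
      using ab t XG WG by (simp add: m_assoc)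
    ultimately show ?thesis by simp
  qed
  have zG: "z \<in> carrier G" using z XG by auto
  have zz: "z \<otimes> z \<in> W" using nearD[OF WX(2) X W(1)] z by auto
  have zi: "inv z \<otimes> w \<otimes> z \<in> W" if "w \<in> W" for w
    using normalises[of "inv z" w] z that subgroup.m_inv_closed[OF X(1)] subgroup.m_inv_closed[OF Y(1)] zG
    by simp
  define U where "U = W \<union> (\<lambda>w. z \<otimes> w) ` W"
  have zU: "x \<in> U" if "x \<in> carrier G" "inv z \<otimes> x \<in> W" for x
    using that zG by (auto simp: U_def m_assoc[symmetric] intro!: image_eqI[of _ _ "inv z \<otimes> x"])
  have "subgroup U G"
  proof (rule subgroup_finiteI)
    show "finite U" "\<one> \<in> U" using W subgroup.one_closed[OF W(1)] by (auto simp: U_def)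
    show "U \<subseteq> carrier G" using WG zG by (auto simp: U_def)
    have m1: "v \<otimes> (z \<otimes> w) \<in> U" if "v \<in> W" "w \<in> W" for v w
    proof (rule zU)
      have "inv z \<otimes> (v \<otimes> (z \<otimes> w)) = (inv z \<otimes> v \<otimes> z) \<otimes> w" using that WG zG by (simp add: m_assoc)
      then show "inv z \<otimes> (v \<otimes> (z \<otimes> w)) \<in> W" using zi that cl by simp
    qed (use that zG WG in auto)
    have m2: "(z \<otimes> v) \<otimes> (z \<otimes> w) \<in> U" if "v \<in> W" "w \<in> W" for v w
    proof -
      have "(z \<otimes> v) \<otimes> (z \<otimes> w) = (z \<otimes> z) \<otimes> (inv z \<otimes> v \<otimes> z) \<otimes> w"
        using that WG zG by (simp add: m_assoc)
      then show ?thesis using zi that cl zz by (simp add: U_def)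
    qed
    show "x \<otimes> y \<in> U" if x: "x \<in> U" and y: "y \<in> U" for x y
    proof -
      have UI: "w \<in> U" "z \<otimes> w \<in> U" if "w \<in> W" for w using that by (auto simp: U_def)
      have UE: "u \<in> W \<or> (\<exists>w\<in>W. u = z \<otimes> w)" if "u \<in> U" for u using that by (auto simp: U_def)
      show ?thesis
        using UE[OF x] UE[OF y] m1 m2 UI cl(1) WG zG by (auto simp: m_assoc)
    qed
  qed
  moreover have "card U = 2 * card W"
  proof -
    have "W \<inter> (\<lambda>w. z \<otimes> w) ` W = {}"
    proof (rule ccontr)
      assume "\<not> ?thesis"
      then obtain v w where vw: "v \<in> W" "w \<in> W" "v = z \<otimes> w" by auto
      then have "v \<otimes> inv w = z" using WG zG by (simp add: m_assoc)
      then show False using z vw cl by metis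
    qed
    moreover have "inj_on (\<lambda>w. z \<otimes> w) W" using WG zG by (auto intro!: inj_onI)
    ultimately show ?thesis using W by (simp add: U_def card_Un_disjoint card_image)
  qed
  moreover have "x \<in> U" if "A = X \<or> A = Y" "x \<in> A" for A x
  proof (cases "x \<in> W")
    case True then show ?thesis by (simp add: U_def)
  next
    case False
    have "inv z \<otimes> x \<in> W"
      using that nearD[OF WX(2) X W(1), of "inv z" x] nearD[OF WY(2) Y W(1), of "inv z" x] False z zG
        subgroup.m_inv_closed[OF X(1), of z] subgroup.m_inv_closed[OF Y(1), of z]
        subgroup.m_inv_closed[OF W(1), of "inv z"] by auto
    then show ?thesis using zU that XG YG by auto
  qed
  ultimately show thesis using that[of U] by (auto simp: U_def)
qed

text \<open>
  There is no room between \<open>W\<close> and a group in which it has index two. This makes the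
  group \<open>U\<close> of the preceding lemma a function of \<open>W\<close> and \<open>X\<close>.
\<close>

lemma generate_double:
  assumes W: "subgroup W G" "finite W" and X: "subgroup X G" and U: "subgroup U G"
    and c: "card U = 2 * card W" and sub: "W \<union> X \<subseteq> U" and ne: "\<not> X \<subseteq> W"
  shows "generate G (W \<union> X) = U"
proof
  have sG: "W \<union> X \<subseteq> carrier G" using W X subgroup.subset by auto
  show "generate G (W \<union> X) \<subseteq> U" by (rule generate_subgroup_incl[OF sub U])
  have D: "subgroup (generate G (W \<union> X)) G" by (rule generate_is_subgroup[OF sG])
  have "card W > 0" using W subgroup.one_closed card_gt_0_iff by blast
  then have finU: "finite U" using c card_ge_0_finite by force
  have n: "near U W" using c sub by (simp add: near_def Int_absorb1)
  obtain x where x: "x \<in> X" "x \<notin> W" using ne by auto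
  have xi: "inv x \<notin> W" "inv x \<in> X"
    using x X W(1) by (metis inv_inv subgroup.m_inv_closed subgroup.mem_carrier, metis subgroup.m_inv_closed)
  show "U \<subseteq> generate G (W \<union> X)"
  proof
    fix u assume u: "u \<in> U"
    show "u \<in> generate G (W \<union> X)"
    proof (cases "u \<in> W")
      case True then show ?thesis by (auto intro: generate.incl)
    next
      case False
      have "inv x \<otimes> u \<in> W" using nearD[OF n U finU W(1)] u False x xi sub by auto
      then have "inv x \<otimes> u \<in> generate G (W \<union> X)" by (auto intro: generate.incl)
      then have "x \<otimes> (inv x \<otimes> u) \<in> generate G (W \<union> X)" using x by (auto intro: generate.incl generate.eng)
      moreover have "x \<otimes> (inv x \<otimes> u) = u"
        using x u subgroup.mem_carrier[OF X] subgroup.mem_carrier[OF U] by (simp add: m_assoc[symmetric])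
      ultimately show ?thesis by simp
    qed
  qed
qed

end

section \<open>Families of conjugate subgroups\<close>

lemma card_filter_bij:
  assumes h: "bij_betw h A A" and PQ: "\<And>x. x \<in> A \<Longrightarrow> Q (h x) \<longleftrightarrow> P x"
  shows "card {y \<in> A. Q y} = card {x \<in> A. P x}"
proof -
  have im: "h ` A = A" and inj: "inj_on h A" using h by (simp_all add: bij_betw_def)
  have "{y \<in> A. Q y} = h ` {x \<in> A. P x}"
  proof (intro equalityI subsetI)
    fix y assume y: "y \<in> {y \<in> A. Q y}"
    then have "y \<in> h ` A" using im by simp
    then obtain x where "x \<in> A" "y = h x" by blast
    then show "y \<in> h ` {x \<in> A. P x}" using PQ[of x] y by simp
  next
    fix y assume "y \<in> h ` {x \<in> A. P x}"
    then obtain x where "x \<in> A" "P x" "y = h x" by blast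
    then show "y \<in> {y \<in> A. Q y}" using PQ[of x] im by blast
  qed
  moreover have "inj_on h {x \<in> A. P x}" by (rule inj_on_subset[OF inj]) blast
  ultimately show ?thesis by (simp add: card_image)
qed

context group
begin

definition conj_set :: "'a \<Rightarrow> 'a set \<Rightarrow> 'a set" where
  "conj_set g X = (\<lambda>x. g \<otimes> x \<otimes> inv g) ` X"

lemma conj_inj: "g \<in> carrier G \<Longrightarrow> X \<subseteq> carrier G \<Longrightarrow> inj_on (\<lambda>x. g \<otimes> x \<otimes> inv g) X"
  by (rule inj_onI) (metis conjugation_is_inj subsetD)

lemma card_conj_set: "g \<in> carrier G \<Longrightarrow> X \<subseteq> carrier G \<Longrightarrow> card (conj_set g X) = card X"
  by (simp add: conj_set_def card_image conj_inj)

lemma conj_set_inv: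
  assumes "g \<in> carrier G" "X \<subseteq> carrier G"
  shows "conj_set (inv g) (conj_set g X) = X"
proof -
  have "inv g \<otimes> (g \<otimes> x \<otimes> inv g) \<otimes> inv (inv g) = x" if "x \<in> X" for x
    using that assms by (simp add: m_assoc subset_iff)
  then show ?thesis by (simp add: conj_set_def image_image cong: image_cong_simp)
qed

lemma conj_set_inv': "g \<in> carrier G \<Longrightarrow> X \<subseteq> carrier G \<Longrightarrow> conj_set g (conj_set (inv g) X) = X"
  using conj_set_inv[of "inv g" X] by simp

lemma conj_set_mono: "X \<subseteq> Y \<Longrightarrow> conj_set g X \<subseteq> conj_set g Y"
  by (auto simp: conj_set_def)

lemma conj_set_subset_iff:
  "g \<in> carrier G \<Longrightarrow> X \<subseteq> carrier G \<Longrightarrow> Y \<subseteq> carrier G \<Longrightarrow> conj_set g X \<subseteq> conj_set g Y \<longleftrightarrow> X \<subseteq> Y"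
  using conj_set_mono[of X Y g] conj_set_mono[of "conj_set g X" "conj_set g Y" "inv g"] conj_set_inv by auto

lemma conj_set_Int:
  "g \<in> carrier G \<Longrightarrow> X \<subseteq> carrier G \<Longrightarrow> Y \<subseteq> carrier G \<Longrightarrow> conj_set g (X \<inter> Y) = conj_set g X \<inter> conj_set g Y"
  unfolding conj_set_def by (rule inj_on_image_Int[OF conj_inj[of g "carrier G"]]) auto

lemma conj_set_subgroup:
  assumes "g \<in> carrier G" "subgroup X G"
  shows "subgroup (conj_set g X) G"
proof -
  have "conj_set g X = g <# X #> inv g"
    by (auto simp: conj_set_def l_coset_def r_coset_def)
  then show ?thesis using subgroup_conjugation_is_surj2[OF assms] by simp
qed

lemma near_mono:
  assumes "near X Y" "subgroup X G" "finite X" "subgroup Y G" "subgroup X' G" "X' \<subseteq> X"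
  shows "near X' Y"
proof -
  have "finite X'" using finite_subset[OF assms(6,3)] .
  show ?thesis unfolding near_iff[OF assms(5) \<open>finite X'\<close> assms(4)]
  proof (intro ballI)
    fix a b assume "a \<in> X' - Y" "b \<in> X' - Y"
    then show "a \<otimes> b \<in> Y" using nearD[OF assms(1-4), of a b] assms(6) by auto
  qed
qed

lemma subgroup_card_2:
  assumes "subgroup M G" "card M = 2"
  obtains f where "M = {\<one>, f}" "f \<noteq> \<one>" "f \<in> carrier G" "f \<otimes> f = \<one>"
proof -
  obtain a b where ab: "M = {a, b}" "a \<noteq> b" using assms(2) card_2_iff by metis
  have one: "\<one> \<in> M" using assms subgroup.one_closed by auto
  obtain f where f: "M = {\<one>, f}" "f \<noteq> \<one>" using ab one by auto
  then have fM: "f \<in> M" by simp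
  have fG: "f \<in> carrier G" using fM assms subgroup.mem_carrier by metis
  have "f \<otimes> f \<in> M" using fM assms(1) subgroup.m_closed by metis
  moreover have "f \<otimes> f \<noteq> f" using f fG by (metis r_cancel_one')
  ultimately show thesis using that f fG by blast
qed

lemma klein_four:
  assumes X: "subgroup X G" "card X = 4" and a: "a \<in> X" "a \<noteq> \<one>" "a \<otimes> a = \<one>"
    and b: "b \<in> X" "b \<noteq> \<one>" "b \<otimes> b = \<one>" and ab: "a \<noteq> b"
  shows "a \<otimes> b = b \<otimes> a" "X = {\<one>, a, b, a \<otimes> b}"
proof -
  have car: "a \<in> carrier G" "b \<in> carrier G" using a b subgroup.mem_carrier[OF X(1)] by auto
  have prod: "x \<otimes> y \<noteq> \<one>" "x \<otimes> y \<noteq> x" "x \<otimes> y \<noteq> y"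
    if "x \<in> carrier G" "y \<in> carrier G" "x \<noteq> y" "x \<noteq> \<one>" "y \<noteq> \<one>" "x \<otimes> x = \<one>" for x y
  proof -
    have "x = y" if "x \<otimes> y = x \<otimes> x" using that \<open>x \<in> carrier G\<close> \<open>y \<in> carrier G\<close> by simp
    then show "x \<otimes> y \<noteq> \<one>" using that by auto
  qed (use that in auto)
  have sub: "{\<one>, a, b, a \<otimes> b} \<subseteq> X"
    using a b X by (auto intro: subgroup.one_closed subgroup.m_closed)
  have "card {\<one>, a, b, a \<otimes> b} = 4"
    using prod[of a b] car ab a b by auto
  then show *: "X = {\<one>, a, b, a \<otimes> b}"
    using sub X by (metis card_subset_eq card.infinite zero_neq_numeral)
  have "b \<otimes> a \<in> X" using a b X by (auto intro: subgroup.m_closed)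
  then have "b \<otimes> a \<in> {\<one>, a, b, a \<otimes> b}" using * by simp
  then show "a \<otimes> b = b \<otimes> a" using prod[of b a] car ab a b by auto
qed

end

text \<open>
  The point stabilizers of a faithful transitive group of ratio \<open>5 / 6\<close>, detached from the action.
\<close>

locale conjugate_family = group G for G (structure) +
  fixes C :: "'a set set" and m :: nat
  assumes finite_C: "finite C" and nonempty: "C \<noteq> {}"
    and sub: "X \<in> C \<Longrightarrow> subgroup X G"
    and fin: "X \<in> C \<Longrightarrow> finite X"
    and conj_closed: "g \<in> carrier G \<Longrightarrow> X \<in> C \<Longrightarrow> conj_set g X \<in> C"
    and conj_trans: "X \<in> C \<Longrightarrow> Y \<in> C \<Longrightarrow> \<exists>g\<in>carrier G. Y = conj_set g X"
    and core: "\<Inter>C = {\<one>}"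
    and card_C: "card C = 6 * m"
    and card_far: "X \<in> C \<Longrightarrow> card {Y \<in> C. \<not> near X Y} = m"
begin

lemma car: "X \<in> C \<Longrightarrow> X \<subseteq> carrier G"
  using sub subgroup.subset by blast

lemma card_eq: "X \<in> C \<Longrightarrow> Y \<in> C \<Longrightarrow> card X = card Y"
  using conj_trans[of X Y] card_conj_set[OF _ car[of X]] by auto

lemma near_sym: "X \<in> C \<Longrightarrow> Y \<in> C \<Longrightarrow> near X Y \<Longrightarrow> near Y X"
  by (simp add: near_def card_eq[of X Y] Int_commute)

lemma m_pos: "m > 0"
  using card_C nonempty finite_C by (cases m) auto

lemma card_half: "X \<in> C \<Longrightarrow> Y \<in> C \<Longrightarrow> near X Y \<Longrightarrow> X \<noteq> Y \<Longrightarrow> card (X \<inter> Y) * 2 = card X"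
  using near_card_half[of X Y] sub[of X] sub[of Y] fin[of X] fin[of Y] card_eq[of X Y] by blast

lemma card_pos: "X \<in> C \<Longrightarrow> card X > 0"
  using fin[of X] subgroup.one_closed[OF sub[of X]] by (auto simp: card_gt_0_iff)

lemma exists_far: "X \<in> C \<Longrightarrow> \<exists>Y\<in>C. \<not> near X Y"
proof (rule ccontr)
  assume "X \<in> C" "\<not> (\<exists>Y\<in>C. \<not> near X Y)"
  then have "{Y \<in> C. \<not> near X Y} = {}" by auto
  then have "card {Y \<in> C. \<not> near X Y} = 0" by (simp only: card.empty)
  then show False using card_far[OF \<open>X \<in> C\<close>] m_pos by linarith
qed

lemma bij_conj:
  assumes g: "g \<in> carrier G"
  shows "bij_betw (conj_set g) C C"
  by (rule bij_betw_byWitness[of _ "conj_set (inv g)"])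
     (simp_all add: g car conj_set_inv conj_set_inv' conj_closed image_subset_iff)

text \<open>
  As \<open>|C| = 6 m\<close> and both families have at least \<open>3 m + 1\<close> members, they share at least two.
\<close>

lemma two_large:
  assumes "card {Y \<in> C. P Y} > 3 * m" "card {Y \<in> C. Q Y} > 3 * m"
  obtains Y Z where "Y \<in> C" "Z \<in> C" "Y \<noteq> Z" "P Y" "Q Y" "P Z" "Q Z"
proof -
  let ?A = "{Y \<in> C. P Y}" and ?B = "{Y \<in> C. Q Y}"
  have "card ?A + card ?B = card (?A \<union> ?B) + card (?A \<inter> ?B)"
    using card_Un_Int[of ?A ?B] finite_C by simp
  moreover have "card (?A \<union> ?B) \<le> card C" by (rule card_mono[OF finite_C]) auto
  ultimately have "card (?A \<inter> ?B) \<ge> 2" using assms card_C by linarith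
  then obtain Y Z where "Y \<in> ?A \<inter> ?B" "Z \<in> ?A \<inter> ?B" "Y \<noteq> Z"
    using card_le_Suc0_iff_eq[of "?A \<inter> ?B"] finite_C by auto
  then show thesis using that by auto
qed

text \<open>
  The common part of \<open>few_above\<close> and \<open>few_below\<close>, with \<open>R\<close> containment in either direction. A
  conjugate of \<open>A\<close> is related to as many members as \<open>A\<close>, so some two members are related to both,
  and two members determine the subgroup that is related to both.
\<close>

lemma fixed_if_large:
  assumes A: "A \<subseteq> carrier G" and large: "card {Y \<in> C. R A Y} > 3 * m"
    and equiv: "\<And>g Y. g \<in> carrier G \<Longrightarrow> Y \<in> C \<Longrightarrow> R (conj_set g A) (conj_set g Y) = R A Y"
    and uniq: "\<And>Y Z B. \<lbrakk>Y \<in> C; Z \<in> C; Y \<noteq> Z; R A Y; R A Z; R B Y; R B Z; \<exists>g\<in>carrier G. B = conj_set g A\<rbrakk> \<Longrightarrow> B = A"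
    and g: "g \<in> carrier G"
  shows "conj_set g A = A"
proof -
  have "card {Y \<in> C. R (conj_set g A) Y} = card {Y \<in> C. R A Y}"
    by (rule card_filter_bij[OF bij_conj[OF g]]) (rule equiv[OF g])
  then have "card {Y \<in> C. R (conj_set g A) Y} > 3 * m" using large by simp
  from two_large[OF large this] obtain Y Z where
    "Y \<in> C" "Z \<in> C" "Y \<noteq> Z" "R A Y" "R A Z" "R (conj_set g A) Y" "R (conj_set g A) Z" by blast
  then show ?thesis by (rule uniq) (use g in auto)
qed

text \<open>
  Two distinct members that contain \<open>M\<close> meet in \<open>M\<close>, so \<open>M\<close> is determined by them. With more than half of the
  members above it, \<open>M\<close> would be invariant under conjugation and lie in all members, which would
  then all be near to each other.
\<close>

lemma few_above:
  assumes M: "subgroup M G" "X \<in> C" "M \<subseteq> X" "card M * 2 = card X"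
  shows "card {Y \<in> C. M \<subseteq> Y} \<le> 3 * m"
proof (rule ccontr)
  assume "\<not> ?thesis"
  then have large: "card {Y \<in> C. M \<subseteq> Y} > 3 * m" by simp
  have MG: "M \<subseteq> carrier G" using M(1) by (rule subgroup.subset)
  have *: "conj_set g M = M" if "g \<in> carrier G" for g
  proof (rule fixed_if_large[where R = "\<lambda>A Y. A \<subseteq> Y", OF MG large _ _ that])
    show "(conj_set g M \<subseteq> conj_set g Y) = (M \<subseteq> Y)" if "g \<in> carrier G" "Y \<in> C" for g Y
      using conj_set_subset_iff[OF that(1) MG car[OF that(2)]] .
  next
    fix Y Z B
    assume YZ: "Y \<in> C" "Z \<in> C" "Y \<noteq> Z" "M \<subseteq> Y" "M \<subseteq> Z" "B \<subseteq> Y" "B \<subseteq> Z"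
      and "\<exists>g\<in>carrier G. B = conj_set g M"
    then have B: "card B = card M" using card_conj_set[OF _ MG] by auto
    have fYZ: "finite (Y \<inter> Z)" using fin YZ(1) by auto
    have cXY: "card X = card Y" using card_eq[OF M(2) YZ(1)] .
    have "card M \<le> card (Y \<inter> Z)" using YZ by (intro card_mono[OF fYZ]) auto
    then have "near Y Z" using M(4) cXY by (simp add: near_def)
    then have c: "card (Y \<inter> Z) = card M" using card_half[OF YZ(1,2)] YZ(3) M(4) cXY by simp
    have "M = Y \<inter> Z" using c YZ by (intro card_subset_eq[OF fYZ]) auto
    moreover have "B = Y \<inter> Z" using c YZ B by (intro card_subset_eq[OF fYZ]) auto
    ultimately show "B = M" by simp
  qed
  have "near X Y" if Y: "Y \<in> C" for Y
  proof -
    obtain g where "g \<in> carrier G" "Y = conj_set g X" using conj_trans[OF M(2) Y] by auto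
    then have "M \<subseteq> Y" using *[of g] conj_set_mono[OF M(3), of g] by simp
    then have "card M \<le> card (X \<inter> Y)" using M(3) fin[OF M(2)] by (intro card_mono) auto
    then show ?thesis using M(4) by (simp add: near_def)
  qed
  then show False using exists_far[OF M(2)] by blast
qed

text \<open>
  The dual of \<open>few_above\<close>: two distinct members inside \<open>U\<close> generate \<open>U\<close>.
\<close>

lemma few_below:
  assumes U: "subgroup U G" "X \<in> C" "card U = 2 * card X"
  shows "card {Y \<in> C. Y \<subseteq> U} \<le> 3 * m"
proof (rule ccontr)
  assume "\<not> ?thesis"
  then have large: "card {Y \<in> C. Y \<subseteq> U} > 3 * m" by simp
  have UG: "U \<subseteq> carrier G" using U(1) by (rule subgroup.subset)
  have "card U > 0" using card_pos[OF U(2)] U(3) by simp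
  then have finU: "finite U" by (rule card_ge_0_finite)
  have *: "conj_set g U = U" if "g \<in> carrier G" for g
  proof (rule fixed_if_large[where R = "\<lambda>A Y. Y \<subseteq> A", OF UG large _ _ that])
    show "(conj_set g Y \<subseteq> conj_set g U) = (Y \<subseteq> U)" if "g \<in> carrier G" "Y \<in> C" for g Y
      using conj_set_subset_iff[OF that(1) car[OF that(2)] UG] .
  next
    fix Y Z B
    assume YZ: "Y \<in> C" "Z \<in> C" "Y \<noteq> Z" "Y \<subseteq> U" "Z \<subseteq> U" "Y \<subseteq> B" "Z \<subseteq> B"
      and "\<exists>g\<in>carrier G. B = conj_set g U"
    then have B: "card B = card U" "subgroup B G"
      using card_conj_set[OF _ UG] conj_set_subgroup[OF _ U(1)] by auto
    have n: "\<not> Z \<subseteq> Y" using card_subset_eq[OF fin[OF YZ(1)], of Z] YZ(3) card_eq[OF YZ(2,1)] by blast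
    have c: "card U = 2 * card Y" using U(3) card_eq[OF U(2) YZ(1)] by simp
    have "generate G (Y \<union> Z) = U"
      by (rule generate_double[OF sub[OF YZ(1)] fin[OF YZ(1)] sub[OF YZ(2)] U(1) c _ n]) (use YZ in auto)
    moreover have "generate G (Y \<union> Z) = B"
      by (rule generate_double[OF sub[OF YZ(1)] fin[OF YZ(1)] sub[OF YZ(2)] B(2) _ _ n]) (use YZ B c in auto)
    ultimately show "B = U" by simp
  qed
  have "{Y \<in> C. Y \<subseteq> U} \<noteq> {}" using large by (metis card.empty not_less_zero)
  then obtain Y0 where Y0: "Y0 \<in> C" "Y0 \<subseteq> U" by auto
  have all: "Y \<subseteq> U" if Y: "Y \<in> C" for Y
  proof -
    obtain g where "g \<in> carrier G" "Y = conj_set g Y0" using conj_trans[OF Y0(1) Y] by auto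
    then show ?thesis using *[of g] conj_set_mono[OF Y0(2), of g] by simp
  qed
  have "near X Y" if Y: "Y \<in> C" for Y
  proof (rule near_mono[OF _ U(1) finU sub[OF Y] sub[OF U(2)] all[OF U(2)]])
    show "near U Y" using all[OF Y] U(3) card_eq[OF U(2) Y] by (simp add: near_def Int_absorb1)
  qed
  then show False using exists_far[OF U(2)] by blast
qed

definition nbrs :: "'a set \<Rightarrow> 'a set set" where
  "nbrs W = {Y \<in> C. Y \<noteq> W \<and> near W Y}"

text \<open>
  The column of a neighbour \<open>Y\<close> of \<open>W\<close>. If \<open>W\<close> does not have index two in the group that
  \<open>W\<close> and \<open>Y\<close> generate, then no other neighbour is to be in the column of \<open>Y\<close>; the label \<open>Y\<close> ensures this, since its order differs from
  that of the labels of the first kind.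
\<close>

definition join_label :: "'a set \<Rightarrow> 'a set \<Rightarrow> 'a set" where
  "join_label W Y = (if card (generate G (W \<union> Y)) = 2 * card W then generate G (W \<union> Y) else Y)"

lemma near_refl [simp]: "near X X" by (simp add: near_def)

lemma card_nbrs:
  assumes W: "W \<in> C" shows "card (nbrs W) + 1 = 5 * m"
proof -
  have "C = (nbrs W \<union> {W}) \<union> {Y \<in> C. \<not> near W Y}" using W by (auto simp: nbrs_def)
  moreover have "card ((nbrs W \<union> {W}) \<union> {Y \<in> C. \<not> near W Y}) = card (nbrs W \<union> {W}) + card {Y \<in> C. \<not> near W Y}"
    by (rule card_Un_disjoint) (use finite_C in \<open>auto simp: nbrs_def\<close>)
  moreover have "card (nbrs W \<union> {W}) = card (nbrs W) + card {W}"
    by (rule card_Un_disjoint) (use finite_C in \<open>auto simp: nbrs_def\<close>)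
  ultimately show ?thesis using card_C card_far[OF W] by simp
qed

lemma near_same_row_or_column:
  assumes W: "W \<in> C" and X: "X \<in> nbrs W" and Y: "Y \<in> nbrs W" and XY: "near X Y"
  shows "W \<inter> X = W \<inter> Y \<or> join_label W X = join_label W Y"
proof (cases "W \<inter> X = W \<inter> Y")
  case False
  then have "join_label W X = join_label W Y" if ne: "W \<inter> X \<noteq> W \<inter> Y"
  proof -
  have C: "X \<in> C" "Y \<in> C" "X \<noteq> W" "Y \<noteq> W" "near W X" "near W Y" using X Y by (auto simp: nbrs_def)
  obtain U where U: "subgroup U G" "card U = 2 * card W" "W \<union> X \<union> Y \<subseteq> U"
    by (rule near_triple[OF sub[OF W] fin[OF W] sub[OF C(1)] fin[OF C(1)] sub[OF C(2)] fin[OF C(2)] C(5)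
          near_sym[OF W C(1) C(5)] C(6) near_sym[OF W C(2) C(6)] XY card_eq[OF C(1) W] card_eq[OF C(2) W] ne])
       (use C ne in auto)
  have "\<not> X \<subseteq> W" "\<not> Y \<subseteq> W"
    using card_subset_eq[OF fin[OF W]] card_eq[OF C(1) W] card_eq[OF C(2) W] C(3,4) by blast+
  then have "generate G (W \<union> X) = U" "generate G (W \<union> Y) = U"
    using generate_double[OF sub[OF W] fin[OF W] sub[OF C(1)] U(1,2)]
      generate_double[OF sub[OF W] fin[OF W] sub[OF C(2)] U(1,2)] U(3) by auto
  then show ?thesis using U by (simp add: join_label_def)
  qed
  then show ?thesis by blast
qed simp

lemma finite_nbrs: "finite (nbrs W)"
  using finite_C by (simp add: nbrs_def)

lemma not_self_nbr: "W \<notin> nbrs W"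
  by (simp add: nbrs_def)

lemma row_bound:
  assumes W: "W \<in> C" and X: "X \<in> nbrs W"
  shows "card {Y \<in> nbrs W. W \<inter> Y = W \<inter> X} + 1 \<le> 3 * m"
proof -
  have X': "X \<in> C" "X \<noteq> W" "near W X" using X by (auto simp: nbrs_def)
  have "card {Y \<in> nbrs W. W \<inter> Y = W \<inter> X} + 1 = card (insert W {Y \<in> nbrs W. W \<inter> Y = W \<inter> X})"
    using finite_nbrs[of W] not_self_nbr[of W] by simp
  also have "\<dots> \<le> card {Y \<in> C. W \<inter> X \<subseteq> Y}"
    by (rule card_mono) (use finite_C W in \<open>auto simp: nbrs_def\<close>)
  also have "\<dots> \<le> 3 * m"
    by (rule few_above[OF subgroups_Inter_pair[OF sub[OF W] sub[OF X'(1)]] W])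
       (use card_half[OF W X'(1,3)] X'(2) in auto)
  finally show ?thesis .
qed

lemma column_bound:
  assumes W: "W \<in> C" and X: "X \<in> nbrs W"
  shows "card {Y \<in> nbrs W. join_label W Y = join_label W X} + 1 \<le> 3 * m"
proof -
  have X': "X \<in> C" "X \<noteq> W" "near W X" using X by (auto simp: nbrs_def)
  note pos = card_pos[OF W]
  have cY: "card Y = card W" if "Y \<in> nbrs W" for Y
    using that card_eq[of Y W] W by (auto simp: nbrs_def)
  show ?thesis
  proof (cases "card (generate G (W \<union> X)) = 2 * card W")
    case True
    define U where "U = generate G (W \<union> X)"
    have U: "join_label W X = U" "card U = 2 * card W" using True by (simp_all add: join_label_def U_def)
    have WU: "W \<subseteq> U" by (auto simp: U_def intro: generate.incl)
    have YU: "Y \<subseteq> U" if "Y \<in> nbrs W" "join_label W Y = U" for Y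
    proof -
      have "Y \<noteq> U" using cY[OF that(1)] U(2) pos by auto
      then have "generate G (W \<union> Y) = U" using that(2) by (simp add: join_label_def split: if_splits)
      then show ?thesis by (auto intro: generate.incl)
    qed
    have "card {Y \<in> nbrs W. join_label W Y = U} + 1 = card (insert W {Y \<in> nbrs W. join_label W Y = U})"
      using finite_nbrs[of W] not_self_nbr[of W] by simp
    also have "\<dots> \<le> card {Y \<in> C. Y \<subseteq> U}"
    proof (rule card_mono)
      show "insert W {Y \<in> nbrs W. join_label W Y = U} \<subseteq> {Y \<in> C. Y \<subseteq> U}"
        using W WU YU by (auto simp: nbrs_def)
    qed (use finite_C in simp)
    also have "\<dots> \<le> 3 * m"
    proof (rule few_below[OF _ W U(2)])
      show "subgroup U G"
        unfolding U_def using generate_is_subgroup car[OF W] car[OF X'(1)] by simp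
    qed
    finally show ?thesis by (simp add: U)
  next
    case False
    have "Y = X" if "Y \<in> nbrs W" "join_label W Y = join_label W X" for Y
    proof (rule ccontr)
      assume "Y \<noteq> X"
      then have "card (generate G (W \<union> Y)) = 2 * card W" "generate G (W \<union> Y) = X"
        using that(2) False by (auto simp: join_label_def split: if_splits)
      then have "card X = 2 * card W" by simp
      then show False using cY[OF X] pos by simp
    qed
    then have "{Y \<in> nbrs W. join_label W Y = join_label W X} = {X}"
      using X by (intro equalityI subsetI) auto
    then have "card {Y \<in> nbrs W. join_label W Y = join_label W X} = 1" by (simp only: card.insert) simp
    then show ?thesis using m_pos by linarith
  qed
qed

lemma off_bound:
  assumes W: "W \<in> C" and X: "X \<in> nbrs W"
  shows "card {Y \<in> nbrs W. W \<inter> Y \<noteq> W \<inter> X \<and> join_label W Y \<noteq> join_label W X} \<le> m"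
proof -
  have "card {Y \<in> nbrs W. W \<inter> Y \<noteq> W \<inter> X \<and> join_label W Y \<noteq> join_label W X} \<le> card {Y \<in> C. \<not> near X Y}"
  proof (rule card_mono)
    show "{Y \<in> nbrs W. W \<inter> Y \<noteq> W \<inter> X \<and> join_label W Y \<noteq> join_label W X} \<subseteq> {Y \<in> C. \<not> near X Y}"
    proof
      fix Y assume Y: "Y \<in> {Y \<in> nbrs W. W \<inter> Y \<noteq> W \<inter> X \<and> join_label W Y \<noteq> join_label W X}"
      then have "Y \<in> C" by (simp add: nbrs_def)
      moreover have "\<not> near X Y"
        using near_same_row_or_column[OF W X, of Y] Y by auto
      ultimately show "Y \<in> {Y \<in> C. \<not> near X Y}" by simp
    qed
  qed (use finite_C in simp)
  also have "\<dots> = m" using card_far X by (simp add: nbrs_def)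
  finally show ?thesis .
qed

text \<open>
  The grid is the one of \<open>rook_grid\<close>, with rows \<open>W \<inter> Y\<close> and columns \<open>join_label W Y\<close>.
\<close>

lemma m_eq_1: "m = 1"
proof -
  obtain W where W: "W \<in> C" using nonempty by auto
  show ?thesis
    by (rule rook_grid(1)[where r = "\<lambda>Y. W \<inter> Y" and c = "join_label W",
          OF finite_nbrs card_nbrs[OF W] row_bound[OF W] column_bound[OF W] off_bound[OF W]])
qed

lemma card_row:
  assumes W: "W \<in> C" and X: "X \<in> nbrs W"
  shows "card {Y \<in> nbrs W. W \<inter> Y = W \<inter> X} = 2"
  by (rule rook_grid(2)[where r = "\<lambda>Y. W \<inter> Y" and c = "join_label W",
        OF finite_nbrs card_nbrs[OF W] row_bound[OF W] column_bound[OF W] off_bound[OF W] X])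

lemma card_column:
  assumes W: "W \<in> C" and X: "X \<in> nbrs W"
  shows "card {Y \<in> nbrs W. join_label W Y = join_label W X} = 2"
  by (rule rook_grid(3)[where r = "\<lambda>Y. W \<inter> Y" and c = "join_label W",
        OF finite_nbrs card_nbrs[OF W] row_bound[OF W] column_bound[OF W] off_bound[OF W] X])

end

section \<open>The octahedron\<close>

context conjugate_family
begin

text \<open>
  The four neighbours of \<open>V\<close> split into two rows of two, so one row determines the other.
\<close>

lemma row_partner:
  assumes V: "V \<in> C" and N: "{a, b, c, d} \<subseteq> nbrs V" and d: "distinct [a, b, c, d]"
    and ab: "V \<inter> a = V \<inter> b"
  shows "V \<inter> c = V \<inter> d" "V \<inter> c \<noteq> V \<inter> a"
proof -
  have "card (nbrs V) = 4" using card_nbrs[OF V] m_eq_1 by simp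
  moreover have "card {a, b, c, d} = 4" using d by simp
  ultimately have "card {a, b, c, d} = card (nbrs V)" by simp
  from card_subset_eq[OF finite_nbrs N this] have nb: "nbrs V = {a, b, c, d}" by (rule sym)
  have aN: "a \<in> nbrs V" and cN: "c \<in> nbrs V" using nb by simp_all
  define R where "R = {Y \<in> nbrs V. V \<inter> Y = V \<inter> a}"
  have "finite R" "{a, b} \<subseteq> R" using finite_nbrs nb ab by (auto simp: R_def)
  moreover have "card {a, b} = 2" using d by simp
  moreover have "card R = 2" unfolding R_def by (rule card_row[OF V aN])
  ultimately have row: "{a, b} = R" using card_subset_eq[of R "{a, b}"] by simp
  have ca: "V \<inter> c \<noteq> V \<inter> a"
  proof
    assume "V \<inter> c = V \<inter> a"
    then have "c \<in> R" using cN by (simp add: R_def)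
    then have "c \<in> {a, b}" using row by simp
    then show False using d by auto
  qed
  then show "V \<inter> c \<noteq> V \<inter> a" .
  show "V \<inter> c = V \<inter> d"
  proof (rule ccontr)
    assume "V \<inter> c \<noteq> V \<inter> d"
    then have "{Y \<in> nbrs V. V \<inter> Y = V \<inter> c} \<subseteq> {c}" using nb ca ab by auto
    then have "card {Y \<in> nbrs V. V \<inter> Y = V \<inter> c} \<le> card {c}" by (intro card_mono) auto
    then show False using card_row[OF V cN] by simp
  qed
qed

lemma far_unique:
  assumes "X \<in> C" "Y \<in> C" "Z \<in> C" "\<not> near X Y" "\<not> near X Z"
  shows "Y = Z"
proof -
  have "card {Y \<in> C. \<not> near X Y} \<le> Suc 0" using card_far[OF assms(1)] m_eq_1 by simp
  then have "\<forall>a\<in>{Y \<in> C. \<not> near X Y}. \<forall>b\<in>{Y \<in> C. \<not> near X Y}. a = b"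
    using card_le_Suc0_iff_eq[of "{Y \<in> C. \<not> near X Y}"] finite_C by simp
  then show ?thesis using assms by blast
qed

text \<open>
  The vertices come in three antipodal pairs, which are not near: \<open>W, W'\<close> and the two diagonals
  \<open>X, T\<close> and \<open>Y, Z\<close> of the grid with rows \<open>{X, Y}\<close>, \<open>{Z, T}\<close> and columns \<open>{X, Z}\<close>, \<open>{Y, T}\<close>.
\<close>

lemma octahedron:
  assumes W: "W \<in> C"
  obtains X Y Z T W' where "C = {W, X, Y, Z, T, W'}" "distinct [W, X, Y, Z, T, W']"
    "\<not> near W W'" "\<not> near X T" "\<not> near Y Z" "W \<inter> X = W \<inter> Y"
proof -
  let ?r = "\<lambda>Y. W \<inter> Y" and ?c = "join_label W"
  have N4: "card (nbrs W) = 4" using card_nbrs[OF W] m_eq_1 by simp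
  then have "nbrs W \<noteq> {}" by auto
  then obtain X where X: "X \<in> nbrs W" by blast
  have pair: "\<exists>Y. Y \<noteq> X \<and> A = {X, Y}" if "card A = 2" "X \<in> A" for A :: "'a set set"
    using that by (auto simp: card_2_iff insert_commute)
  obtain Y where Y: "Y \<noteq> X" "{Y \<in> nbrs W. ?r Y = ?r X} = {X, Y}"
    using pair[OF card_row[OF W X]] X by auto
  obtain Z where Z: "Z \<noteq> X" "{Y \<in> nbrs W. ?c Y = ?c X} = {X, Z}"
    using pair[OF card_column[OF W X]] X by auto
  have r_iff: "?r V = ?r X \<longleftrightarrow> V = X \<or> V = Y" if "V \<in> nbrs W" for V
  proof -
    have "V \<in> {Y \<in> nbrs W. ?r Y = ?r X} \<longleftrightarrow> V \<in> {X, Y}" by (simp only: Y(2))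
    then show ?thesis using that by simp
  qed
  have c_iff: "?c V = ?c X \<longleftrightarrow> V = X \<or> V = Z" if "V \<in> nbrs W" for V
  proof -
    have "V \<in> {Y \<in> nbrs W. ?c Y = ?c X} \<longleftrightarrow> V \<in> {X, Z}" by (simp only: Z(2))
    then show ?thesis using that by simp
  qed
  have Yn: "Y \<in> nbrs W" using Y(2) by auto
  have Zn: "Z \<in> nbrs W" using Z(2) by auto
  have YZ: "Y \<noteq> Z"
  proof
    assume "Y = Z"
    then have "{V \<in> nbrs W. ?r V \<noteq> ?r X \<and> ?c V \<noteq> ?c X} = nbrs W - {X, Y}"
      using r_iff c_iff by auto
    moreover have "card (nbrs W - {X, Y}) = 2"
      using N4 X Yn Y(1) by (simp add: card_Diff_subset)
    ultimately show False using off_bound[OF W X] m_eq_1 by simp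
  qed
  have "card (nbrs W - {X, Y, Z}) = 1"
    using N4 X Yn Zn Y(1) Z(1) YZ by (simp add: card_Diff_subset)
  then obtain T where T: "nbrs W - {X, Y, Z} = {T}" by (auto simp: card_1_singleton_iff)
  have "nbrs W = (nbrs W - {X, Y, Z}) \<union> {X, Y, Z}" using X Yn Zn by blast
  then have nb: "nbrs W = {X, Y, Z, T}" unfolding T by blast
  have "T \<in> nbrs W - {X, Y, Z}" using T by simp
  then have Tn: "T \<in> nbrs W" and dist: "T \<noteq> X" "T \<noteq> Y" "T \<noteq> Z" by auto
  have rc: "?r T \<noteq> ?r X" "?c T \<noteq> ?c X" "?r Z \<noteq> ?r X" "?c Y \<noteq> ?c X" "?r Y = ?r X" "?c Z = ?c X"
    using dist YZ Y(1) Z(1)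
    by (simp_all only: r_iff[OF Tn] c_iff[OF Tn] r_iff[OF Zn] c_iff[OF Yn] r_iff[OF Yn] c_iff[OF Zn]) simp_all
  have inC: "V \<in> C" "V \<noteq> W" "near W V" if "V \<in> nbrs W" for V using that by (auto simp: nbrs_def)
  have XT: "\<not> near X T" using near_same_row_or_column[OF W X Tn] rc by metis
  have YZ': "\<not> near Y Z" using near_same_row_or_column[OF W Yn Zn] rc by metis
  obtain W' where W': "W' \<in> C" "\<not> near W W'" using exists_far[OF W] by auto
  have W'n: "W' \<notin> insert W (nbrs W)" using W'(2) by (auto simp: nbrs_def)
  have "C \<subseteq> {W, X, Y, Z, T, W'}"
  proof
    fix V assume V: "V \<in> C"
    show "V \<in> {W, X, Y, Z, T, W'}"
    proof (cases "V \<in> nbrs W")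
      case False
      then have "V = W \<or> \<not> near W V" using V by (simp add: nbrs_def)
      then show ?thesis using far_unique[OF W V W'(1)] W'(2) by auto
    qed (auto simp: nb)
  qed
  moreover have "{W, X, Y, Z, T, W'} \<subseteq> C" using W W'(1) inC(1) nb by simp
  ultimately have "C = {W, X, Y, Z, T, W'}" by blast
  moreover have "distinct [W, X, Y, Z, T, W']"
  proof -
    have "W' \<noteq> W" "W' \<noteq> X" "W' \<noteq> Y" "W' \<noteq> Z" "W' \<noteq> T" using W'n by (simp_all add: nb)
    moreover have "W \<noteq> X" "W \<noteq> Y" "W \<noteq> Z" "W \<noteq> T" using not_self_nbr[of W] by (simp_all add: nb)
    ultimately show ?thesis using dist YZ Y(1) Z(1) by simp
  qed
  ultimately show thesis using that[of X Y Z T W'] W'(2) XT YZ' rc(5) by simp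
qed

end

context conjugate_family
begin

text \<open>
  With \<open>W, X, Y, Z, T, W'\<close> as in \<open>octahedron\<close>, the row structure at each vertex shows that the
  intersections of distinct near members are four groups \<open>M1, ..., M4\<close>, each contained in three of the six
  members, and that any two of them are contained in a common member. \<open>M1 \<inter> M2\<close> lies in all
  members, so it is trivial; it has index at most two in \<open>M1\<close>, so \<open>M1\<close> has order two and the members
  have order four. A group of order four with two involutions is elementary abelian, which gives all
  the commutation relations.
\<close>

lemma klein_cover:
  assumes W: "W \<in> C"
  obtains a b c d where
    "C = {{\<one>, a, b, a \<otimes> b}, {\<one>, a, c, a \<otimes> c}, {\<one>, a, d, a \<otimes> d},
          {\<one>, b, c, b \<otimes> c}, {\<one>, b, d, b \<otimes> d}, {\<one>, c, d, c \<otimes> d}}"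
    "W = {\<one>, a, b, a \<otimes> b}" "distinct [\<one>, a, b, c, d]" "{a, b, c, d} \<subseteq> carrier G"
    "a \<otimes> a = \<one>" "b \<otimes> b = \<one>" "c \<otimes> c = \<one>" "d \<otimes> d = \<one>"
    "a \<otimes> b = b \<otimes> a" "a \<otimes> c = c \<otimes> a" "a \<otimes> d = d \<otimes> a"
    "b \<otimes> c = c \<otimes> b" "b \<otimes> d = d \<otimes> b" "c \<otimes> d = d \<otimes> c"
    "{\<one>, a, b, a \<otimes> b} \<inter> {\<one>, c, d, c \<otimes> d} = {\<one>}" "card W = 4"
proof -
  obtain X Y Z T W' where C: "C = {W, X, Y, Z, T, W'}" and dist: "distinct [W, X, Y, Z, T, W']"
    and far: "\<not> near W W'" "\<not> near X T" "\<not> near Y Z" and WXY: "W \<inter> X = W \<inter> Y"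
    by (rule octahedron[OF W])
  have inC: "W \<in> C" "X \<in> C" "Y \<in> C" "Z \<in> C" "T \<in> C" "W' \<in> C" using C by simp_all
  have dist': "distinct (rev [W, X, Y, Z, T, W'])" using dist by (simp only: distinct_rev)
  have far': "\<not> near W' W" "\<not> near T X" "\<not> near Z Y"
    using far near_sym[OF inC(6,1)] near_sym[OF inC(5,2)] near_sym[OF inC(4,3)] by blast+
  have nbI: "V \<in> nbrs U" if "U \<in> C" "V \<in> C" "V \<noteq> U" "P \<in> C" "\<not> near U P" "V \<noteq> P" for U V P
    using far_unique[OF that(1,2,4)] that(2,3,5,6) unfolding nbrs_def by blast
  have nW: "{X, Y, Z, T} \<subseteq> nbrs W" using nbI[OF inC(1) _ _ inC(6) far(1)] inC dist dist' by simp
  have nX: "{W, Y, Z, W'} \<subseteq> nbrs X" using nbI[OF inC(2) _ _ inC(5) far(2)] inC dist dist' by simp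
  have nY: "{W, X, T, W'} \<subseteq> nbrs Y" using nbI[OF inC(3) _ _ inC(4) far(3)] inC dist dist' by simp
  have nZ: "{W, T, X, W'} \<subseteq> nbrs Z" using nbI[OF inC(4) _ _ inC(3) far'(3)] inC dist dist' by simp
  have nT: "{W, Z, Y, W'} \<subseteq> nbrs T" using nbI[OF inC(5) _ _ inC(2) far'(2)] inC dist dist' by simp
  have half: "card (U \<inter> V) * 2 = card W" if "U \<in> C" "V \<in> nbrs U" for U V
  proof -
    have "V \<in> C" "V \<noteq> U" "near U V" using that(2) by (simp_all add: nbrs_def)
    then show ?thesis using card_half[OF that(1), of V] card_eq[OF that(1) W] by simp
  qed
  \<comment> \<open>Rows carry over from \<open>A\<close> to \<open>V\<close>: the containment is clear, and both sides have half the order.\<close>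
  have share: "V \<inter> A = V \<inter> B" if "A \<in> C" "V \<in> C" "V \<in> nbrs A" "B \<in> nbrs V" "A \<inter> V = A \<inter> B" for A V B
  proof (rule card_subset_eq)
    show "finite (V \<inter> B)" using fin[OF that(2)] by simp
    show "V \<inter> A \<subseteq> V \<inter> B" using that(5) by blast
    show "card (V \<inter> A) = card (V \<inter> B)"
      using half[OF that(1,3)] half[OF that(2,4)] by (simp add: Int_commute)
  qed
  have WZT: "W \<inter> Z = W \<inter> T" and ne12: "W \<inter> Z \<noteq> W \<inter> X"
    using row_partner[OF inC(1) nW _ WXY] dist dist' by simp_all
  have "X \<inter> W = X \<inter> Y" using share[OF inC(1,2) _ _ WXY] nW nX by simp
  then have XZW: "X \<inter> Z = X \<inter> W'" and ne13: "X \<inter> Z \<noteq> X \<inter> W"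
    using row_partner[OF inC(2) nX] dist dist' by simp_all
  have XY: "X \<inter> Y = W \<inter> X" using \<open>X \<inter> W = X \<inter> Y\<close> by blast
  have "Y \<inter> W = Y \<inter> X" using share[OF inC(1,3) _ _ WXY[symmetric]] nW nY by simp
  then have YTW: "Y \<inter> T = Y \<inter> W'" and ne14: "Y \<inter> T \<noteq> Y \<inter> W"
    using row_partner[OF inC(3) nY] dist dist' by simp_all
  have "Z \<inter> W = Z \<inter> T" using share[OF inC(1,4) _ _ WZT] nW nZ by simp
  then have ne23: "Z \<inter> X \<noteq> Z \<inter> W" using row_partner[OF inC(4) nZ] dist dist' by simp_all
  have "T \<inter> W = T \<inter> Z" using share[OF inC(1,5) _ _ WZT[symmetric]] nW nT by simp
  then have ne24: "T \<inter> Y \<noteq> T \<inter> W" using row_partner[OF inC(5) nT] dist dist' by simp_all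
  define M1 M2 M3 M4 where M: "M1 = W \<inter> X" "M2 = W \<inter> Z" "M3 = X \<inter> Z" "M4 = Y \<inter> T"
  have sg: "subgroup M1 G" "subgroup M2 G" "subgroup M3 G" "subgroup M4 G"
    unfolding M using sub inC by (simp_all add: subgroups_Inter_pair)
  have cM: "card M1 * 2 = card W" "card M2 * 2 = card W" "card M3 * 2 = card W" "card M4 * 2 = card W"
    unfolding M using half[OF inC(1)] half[OF inC(2)] half[OF inC(3)] nW nX nY by simp_all
  have M12: "M1 \<inter> M2 = {\<one>}"
  proof
    have "M1 \<inter> M2 \<subseteq> W'"
    proof -
      have "M1 \<inter> M2 \<subseteq> X \<inter> Z" by (auto simp: M)
      then show ?thesis using XZW by simp
    qed
    moreover have "M1 \<subseteq> Y" "M2 \<subseteq> T" using WXY WZT by (auto simp: M)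
    ultimately have "M1 \<inter> M2 \<subseteq> \<Inter>C" unfolding C by (auto simp: M)
    then show "M1 \<inter> M2 \<subseteq> {\<one>}" using core by simp
    show "{\<one>} \<subseteq> M1 \<inter> M2" using subgroup.one_closed[OF sg(1)] subgroup.one_closed[OF sg(2)] by simp
  qed
  have "card M1 = 2"
  proof -
    have "near W Z" using nW by (simp add: nbrs_def)
    then have "near M1 Z"
      by (rule near_mono[OF _ sub[OF inC(1)] fin[OF inC(1)] sub[OF inC(4)] sg(1)]) (simp add: M)
    moreover have "M1 \<inter> Z = {\<one>}" using M12 by (auto simp: M)
    ultimately have le: "card M1 \<le> 2" by (simp add: near_def)
    have "card M1 \<noteq> 1"
    proof
      assume "card M1 = 1"
      moreover then have "card M2 = 1" using cM by simp
      ultimately have "M1 = {\<one>}" "M2 = {\<one>}"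
        using subgroup.one_closed[OF sg(1)] subgroup.one_closed[OF sg(2)]
        by (auto simp: card_1_singleton_iff)
      then show False using ne12 M by simp
    qed
    moreover have "card M1 > 0" using cM card_pos[OF W] by simp
    ultimately show ?thesis using le by linarith
  qed
  then have c4: "card W = 4" and c2: "card M2 = 2" "card M3 = 2" "card M4 = 2" using cM by simp_all
  obtain a where a: "M1 = {\<one>, a}" "a \<noteq> \<one>" "a \<in> carrier G" "a \<otimes> a = \<one>"
    using subgroup_card_2[OF sg(1) \<open>card M1 = 2\<close>] by metis
  obtain b where b: "M2 = {\<one>, b}" "b \<noteq> \<one>" "b \<in> carrier G" "b \<otimes> b = \<one>"
    using subgroup_card_2[OF sg(2) c2(1)] by metis
  obtain c where c: "M3 = {\<one>, c}" "c \<noteq> \<one>" "c \<in> carrier G" "c \<otimes> c = \<one>"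
    using subgroup_card_2[OF sg(3) c2(2)] by metis
  obtain d where d: "M4 = {\<one>, d}" "d \<noteq> \<one>" "d \<in> carrier G" "d \<otimes> d = \<one>"
    using subgroup_card_2[OF sg(4) c2(3)] by metis
  have mem: "a \<in> W" "a \<in> X" "a \<in> Y" "b \<in> W" "b \<in> Z" "b \<in> T" "c \<in> X" "c \<in> Z" "c \<in> W'"
    "d \<in> Y" "d \<in> T" "d \<in> W'"
  proof -
    have "a \<in> W \<inter> X" "a \<in> W \<inter> Y" using a(1) WXY by (simp_all add: M)
    moreover have "b \<in> W \<inter> Z" "b \<in> W \<inter> T" using b(1) WZT by (simp_all add: M)
    moreover have "c \<in> X \<inter> Z" "c \<in> X \<inter> W'" using c(1) XZW by (simp_all add: M)
    moreover have "d \<in> Y \<inter> T" "d \<in> Y \<inter> W'" using d(1) YTW by (simp_all add: M)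
    ultimately show "a \<in> W" "a \<in> X" "a \<in> Y" "b \<in> W" "b \<in> Z" "b \<in> T" "c \<in> X" "c \<in> Z" "c \<in> W'"
      "d \<in> Y" "d \<in> T" "d \<in> W'" by simp_all
  qed
  have MI: "M1 = X \<inter> W" "M1 = Y \<inter> W" "M2 = Z \<inter> W" "M2 = T \<inter> W" "M3 = Z \<inter> X" "M4 = T \<inter> Y"
    using WXY WZT by (auto simp: M)
  have ab: "a \<noteq> b" using ne12 a(1) b(1) M by metis
  have ac: "a \<noteq> c" using ne13 a(1) c(1) M(3) MI(1) by metis
  have ad: "a \<noteq> d" using ne14 a(1) d(1) M(4) MI(2) by metis
  have bc: "b \<noteq> c" using ne23 b(1) c(1) MI(3,5) by metis
  have bd: "b \<noteq> d" using ne24 b(1) d(1) MI(4,6) by metis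
  have cd: "c \<noteq> d"
  proof
    assume "c = d"
    then have "c \<in> X \<inter> Y" using mem by simp
    moreover have "X \<inter> Y = {\<one>, a}" using XY a(1) M(1) by (simp only:)
    ultimately have "c \<in> {\<one>, a}" by blast
    then show False using c(2) ac by simp
  qed
  have c4': "card V = 4" if "V \<in> C" for V using card_eq[OF that W] c4 by simp
  note K = klein_four[OF sub c4']
  have KW: "a \<otimes> b = b \<otimes> a" "W = {\<one>, a, b, a \<otimes> b}"
    using K[OF inC(1) inC(1) mem(1) a(2,4) mem(4) b(2,4) ab] by simp_all
  have KX: "a \<otimes> c = c \<otimes> a" "X = {\<one>, a, c, a \<otimes> c}"
    using K[OF inC(2) inC(2) mem(2) a(2,4) mem(7) c(2,4) ac] by simp_all
  have KY: "a \<otimes> d = d \<otimes> a" "Y = {\<one>, a, d, a \<otimes> d}"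
    using K[OF inC(3) inC(3) mem(3) a(2,4) mem(10) d(2,4) ad] by simp_all
  have KZ: "b \<otimes> c = c \<otimes> b" "Z = {\<one>, b, c, b \<otimes> c}"
    using K[OF inC(4) inC(4) mem(5) b(2,4) mem(8) c(2,4) bc] by simp_all
  have KT: "b \<otimes> d = d \<otimes> b" "T = {\<one>, b, d, b \<otimes> d}"
    using K[OF inC(5) inC(5) mem(6) b(2,4) mem(11) d(2,4) bd] by simp_all
  have KW': "c \<otimes> d = d \<otimes> c" "W' = {\<one>, c, d, c \<otimes> d}"
    using K[OF inC(6) inC(6) mem(9) c(2,4) mem(12) d(2,4) cd] by simp_all
  have WW': "W \<inter> W' = {\<one>}"
  proof -
    have "\<one> \<in> W \<inter> W'" using KW KW' by simp
    moreover have "card (W \<inter> W') \<le> Suc 0" using far(1) c4 by (simp add: near_def)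
    moreover have "finite (W \<inter> W')" using fin[OF inC(1)] by simp
    ultimately show ?thesis using card_le_Suc0_iff_eq[of "W \<inter> W'"] by blast
  qed
  show thesis
  proof (rule that[of a b c d])
    show "C = {{\<one>, a, b, a \<otimes> b}, {\<one>, a, c, a \<otimes> c}, {\<one>, a, d, a \<otimes> d},
          {\<one>, b, c, b \<otimes> c}, {\<one>, b, d, b \<otimes> d}, {\<one>, c, d, c \<otimes> d}}"
      unfolding C using KW(2) KX(2) KY(2) KZ(2) KT(2) KW'(2) by simp
    show "distinct [\<one>, a, b, c, d]" using a(2) b(2) c(2) d(2) ab ac ad bc bd cd by auto
    show "{\<one>, a, b, a \<otimes> b} \<inter> {\<one>, c, d, c \<otimes> d} = {\<one>}" using WW' KW(2) KW'(2) by simp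
    show "{a, b, c, d} \<subseteq> carrier G" using a(3) b(3) c(3) d(3) by simp
  qed (fact KW KX(1) KY(1) KZ(1) KT(1) KW'(1) a(4) b(4) c(4) d(4) c4)+
qed

end

section \<open>Permutation groups of degree four that are transitive on pairs\<close>

definition pairs :: "nat set set" where
  "pairs = {T. T \<subseteq> {1..4} \<and> card T = 2}"

lemma finite_pairs: "finite pairs" and card_pairs: "card pairs = 6"
proof -
  have "finite (Pow {1..4::nat})" by simp
  then show "finite pairs" by (rule rev_finite_subset) (auto simp: pairs_def)
  show "card pairs = 6"
    using n_subsets[of "{1..4::nat}" 2] by (simp add: pairs_def choose_two)
qed

lemma pairs_eq: "pairs = {{1, 2}, {1, 3}, {1, 4}, {2, 3}, {2, 4}, {3, 4}}"
proof (rule sym, rule card_subset_eq[OF finite_pairs])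
  show "card {{1, 2}, {1, 3}, {1, 4}, {2, 3}, {2, 4}, {3, 4::nat}} = card pairs"
    unfolding card_pairs by (simp add: doubleton_eq_iff)
qed (simp add: pairs_def)

text \<open>
  A three-cycle is a square of a square, which forces it into every subgroup of index two.
\<close>

lemma three_cycle_cubed:
  assumes "p \<in> three_cycles n"
  shows "(p \<circ> p) \<circ> (p \<circ> p) = p"
proof -
  obtain cs where cs: "p = cycle_of_list cs" "cycle cs" "length cs = 3" using assms by auto
  then obtain a b c where abc: "cs = [a, b, c]"
    by (metis stupid_lemma)
  then have p: "p = Transposition.transpose a b \<circ> Transposition.transpose b c" and d: "a \<noteq> b" "b \<noteq> c" "a \<noteq> c"
    using cs by auto
  show ?thesis
    unfolding p using d by (auto simp: fun_eq_iff Transposition.transpose_def)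
qed

text \<open>
  Each of the six pairs is the image of \<open>{1, 2}\<close> under at least two elements of \<open>Q\<close>, because the
  stabilizer of \<open>{1, 2}\<close> is not trivial. So \<open>Q\<close> has at least \<open>12\<close> elements and index at most two. It then
  contains all three-cycles, hence the alternating group.
\<close>

lemma pair_transitive_subgroup:
  assumes Q: "subgroup Q (sym_group 4)"
    and tr: "\<And>T. T \<in> pairs \<Longrightarrow> \<exists>\<sigma>\<in>Q. \<sigma> ` {1, 2} = T"
  shows "Q = carrier (alt_group 4) \<or> Q = carrier (sym_group 4)"
proof -
  interpret S: group "sym_group 4" by (rule sym_group_is_group)
  have perm: "\<sigma> permutes {1..4}" if "\<sigma> \<in> Q" for \<sigma>
    using subgroup.mem_carrier[OF Q that] by (simp add: sym_group_carrier)
  have comp: "\<sigma> \<circ> \<tau> \<in> Q" if "\<sigma> \<in> Q" "\<tau> \<in> Q" for \<sigma> \<tau>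
    using subgroup.m_closed[OF Q that] by (simp add: sym_group_mult)
  have inv: "inv' \<sigma> \<in> Q" if "\<sigma> \<in> Q" for \<sigma>
    using subgroup.m_inv_closed[OF Q that] subgroup.mem_carrier[OF Q that] by simp
  have fin: "finite Q"
    using finite_subset[OF subgroup.subset[OF Q]] finite_permutations[of "{1..4::nat}"]
    by (simp add: sym_group_def)
  \<comment> \<open>Let \<open>t\<close> swap \<open>{1, 2}\<close> and \<open>{3, 4}\<close>. Either \<open>t \<circ> t\<close> will do, or \<open>t\<close> is an involution and
    stabilises the pair \<open>{1, t 1}\<close>, which can be moved to \<open>{1, 2}\<close>.\<close>
  obtain u where u: "u \<in> Q" "u \<noteq> id" "u ` {1, 2} = {1, 2}"
  proof -
    have "{3, 4} \<in> pairs" by (simp add: pairs_def)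
    then obtain t where t: "t \<in> Q" "t ` {1, 2} = {3, 4}" using tr by blast
    have tp: "t permutes {1..4}" by (rule perm[OF t(1)])
    have nt: "t \<noteq> id" using t(2) by auto
    show thesis
    proof (cases "t \<circ> t = id")
      case False
      have "t ` ({1..4} - {1, 2}) = t ` {1..4} - t ` {1, 2}"
        using permutes_inj[OF tp] by (rule image_set_diff)
      then have "t ` ({1..4} - {1, 2}) = {1..4} - {3, 4}" using t(2) permutes_image[OF tp] by simp
      moreover have "{1..4} - {1, 2} = {3, 4::nat}" "{1..4} - {3, 4} = {1, 2::nat}" by auto
      ultimately have "t ` {3, 4} = {1, 2}" by simp
      then have "(t \<circ> t) ` {1, 2} = {1, 2}" using t(2) by (simp only: image_comp[symmetric])
      then show thesis using that[OF comp[OF t(1) t(1)] False] by simp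
    next
      case True
      define x where "x = t 1"
      have tx: "t x = 1" using True unfolding x_def by (metis comp_apply id_apply)
      have "x \<in> {3, 4}" using t(2) unfolding x_def by blast
      then have "{1, x} \<in> pairs" by (auto simp: pairs_def)
      then obtain r where r: "r \<in> Q" "r ` {1, 2} = {1, x}" using tr by blast
      have rp: "r permutes {1..4}" by (rule perm[OF r(1)])
      let ?u = "inv' r \<circ> t \<circ> r"
      have "?u ` {1, 2} = inv' r ` (t ` (r ` {1, 2}))" by (simp only: image_comp comp_assoc)
      also have "\<dots> = inv' r ` {1, x}"
      proof -
        have "t ` {1, x} = {1, x}" using tx by (auto simp: x_def)
        then show ?thesis by (simp only: r(2))
      qed
      also have "\<dots> = inv' r ` (r ` {1, 2})" by (simp only: r(2))
      also have "\<dots> = {1, 2}" using permutes_inj[OF rp] by (simp only: image_inv_f_f)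
      finally have "?u ` {1, 2} = {1, 2}" .
      moreover have "?u \<noteq> id"
      proof
        assume "?u = id"
        then have u_id: "?u (inv' r y) = inv' r y" for y by (simp only: id_apply)
        have "t y = y" for y
        proof -
          have "inv' r (t y) = inv' r y" using u_id[of y] permutes_inverses(1)[OF rp] by simp
          then show ?thesis by (metis permutes_inverses(1)[OF rp])
        qed
        then show False using nt by (auto simp: fun_eq_iff)
      qed
      ultimately show thesis using that comp[OF comp[OF inv[OF r(1)] t(1)] r(1)] by blast
    qed
  qed
  define F where "F T = {\<sigma> \<in> Q. \<sigma> ` {1, 2} = T}" for T
  have two: "2 \<le> card (F T)" if T: "T \<in> pairs" for T
  proof -
    obtain r where r: "r \<in> Q" "r ` {1, 2} = T" using tr[OF T] by blast
    have "(r \<circ> u) ` {1, 2} = T" using u(3) r(2) by (simp only: image_comp[symmetric])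
    then have "{r, r \<circ> u} \<subseteq> F T" using r u(1) comp by (simp add: F_def)
    moreover have "r \<circ> u \<noteq> r"
    proof
      assume "r \<circ> u = r"
      then have "inv' r \<circ> r \<circ> u = inv' r \<circ> r" by (simp add: comp_assoc)
      then show False using u(2) permutes_inv_o(2)[OF perm[OF r(1)]] by simp
    qed
    then have "card {r, r \<circ> u} = 2" by simp
    ultimately show ?thesis using card_mono[of "F T" "{r, r \<circ> u}"] fin by (simp add: F_def)
  qed
  have "12 = (\<Sum>T\<in>pairs. 2::nat)" by (simp add: card_pairs)
  also have "\<dots> \<le> (\<Sum>T\<in>pairs. card (F T))" by (intro sum_mono two)
  also have "\<dots> = card (\<Union>T\<in>pairs. F T)"
    by (rule card_UN_disjoint[symmetric]) (use fin finite_pairs in \<open>auto simp: F_def\<close>)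
  also have "\<dots> \<le> card Q" by (rule card_mono[OF fin]) (auto simp: F_def)
  finally have "12 \<le> card Q" .
  then have near: "near (carrier (sym_group 4)) Q"
    using subgroup.subset[OF Q] sym_group_card_carrier[of 4]
    by (simp add: near_def Int_absorb1 fact_numeral)
  have finS: "finite (carrier (sym_group 4))"
    using finite_permutations[of "{1..4::nat}"] by (simp add: sym_group_def)
  have index2: "a \<circ> b \<in> Q" if "a permutes {1..4}" "b permutes {1..4}" "a \<notin> Q" "b \<notin> Q" for a b
    using S.nearD[OF near S.subgroup_self finS Q, of a b] that by (simp add: sym_group_carrier sym_group_mult)
  have "three_cycles 4 \<subseteq> Q"
  proof
    fix p assume p: "p \<in> three_cycles 4"
    then have pp: "p permutes {1..4}" using three_cycles_incl[of 4] alt_group_carrier[of p 4] by blast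
    show "p \<in> Q"
    proof (rule ccontr)
      assume "p \<notin> Q"
      then have "p \<circ> p \<in> Q" using index2[OF pp pp] by blast
      then have "(p \<circ> p) \<circ> (p \<circ> p) \<in> Q" using comp by blast
      then show False using three_cycle_cubed[OF p] \<open>p \<notin> Q\<close> by simp
    qed
  qed
  then have "generate (sym_group 4) (three_cycles 4) \<subseteq> Q"
    by (rule S.generate_subgroup_incl[OF _ Q])
  moreover have "generate (sym_group 4) (three_cycles 4) = carrier (alt_group 4)"
    using S.generate_consistent[OF three_cycles_incl alt_group_is_subgroup] alt_group_carrier_as_three_cycles[of 4]
    by (simp add: alt_group_def)
  ultimately have alt: "carrier (alt_group 4) \<subseteq> Q" by simp
  show ?thesis
  proof (cases "Q \<subseteq> carrier (alt_group 4)")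
    case True
    then show ?thesis using alt by blast
  next
    case False
    then obtain \<tau> where \<tau>': "\<tau> \<in> Q" "\<tau> \<notin> carrier (alt_group 4)" by blast
    then have \<tau>: "\<tau> \<in> Q" "\<not> evenperm \<tau>" using perm[OF \<tau>'(1)] by (simp_all add: alt_group_carrier)
    have "\<pi> \<in> Q" if \<pi>: "\<pi> permutes {1..4}" for \<pi>
    proof (cases "evenperm \<pi>")
      case True
      then show ?thesis using alt \<pi> by (auto simp: alt_group_carrier)
    next
      case False
      have tp: "\<tau> permutes {1..4}" by (rule perm[OF \<tau>(1)])
      have P: "permutation \<tau>" "permutation \<pi>" "permutation (inv' \<tau>)"
        using tp \<pi> permutes_inv[OF tp] by (auto simp: permutation_permutes)
      have "evenperm (inv' \<tau> \<circ> \<pi>)"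
        using P \<tau>(2) False by (simp add: evenperm_comp evenperm_inv)
      moreover have "inv' \<tau> \<circ> \<pi> permutes {1..4}" by (rule permutes_compose[OF \<pi> permutes_inv[OF tp]])
      ultimately have "inv' \<tau> \<circ> \<pi> \<in> Q" using alt by (auto simp: alt_group_carrier)
      then have "\<tau> \<circ> (inv' \<tau> \<circ> \<pi>) \<in> Q" using \<tau>(1) comp by blast
      then show ?thesis using permutes_inv_o(1)[OF tp] by (simp add: comp_assoc[symmetric])
    qed
    then show ?thesis using subgroup.subset[OF Q] by (auto simp: sym_group_carrier)
  qed
qed

text \<open>
  The permutations that correspond to the three matrices of \<open>H1\<close> and \<open>H2\<close> under the
  representation \<open>perm_rep\<close> below.
\<close>

definition gen_a :: "nat \<Rightarrow> nat" where "gen_a = Transposition.transpose 2 3 \<circ> Transposition.transpose 1 2"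
definition gen_b :: "nat \<Rightarrow> nat" where "gen_b = Transposition.transpose 1 4 \<circ> Transposition.transpose 2 3"
definition gen_c :: "nat \<Rightarrow> nat" where "gen_c = Transposition.transpose 3 4"

lemma gens_permute: "gen_a permutes {1..4}" "gen_b permutes {1..4}" "gen_c permutes {1..4}"
  unfolding gen_a_def gen_b_def gen_c_def
  by (auto intro!: permutes_compose permutes_swap_id)

lemma gens_sign: "evenperm gen_a" "evenperm gen_b" "\<not> evenperm gen_c"
  unfolding gen_a_def gen_b_def gen_c_def
  by (simp_all add: evenperm_comp permutation_swap_id evenperm_swap)

lemma generate_pair_transitive:
  assumes K: "{gen_a, gen_b} \<subseteq> K" and T: "T \<in> pairs"
  shows "\<exists>\<sigma>\<in>generate (sym_group 4) K. \<sigma> ` {1, 2} = T"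
proof -
  let ?Q = "generate (sym_group 4) K"
  have m: "\<sigma> \<circ> \<tau> \<in> ?Q" if "\<sigma> \<in> ?Q" "\<tau> \<in> ?Q" for \<sigma> \<tau>
    using generate.eng[OF that] by (simp add: sym_group_mult)
  have id: "id \<in> ?Q" using generate.one[of "sym_group 4" K] by (simp add: sym_group_one)
  have a: "gen_a \<in> ?Q" and b: "gen_b \<in> ?Q" using K by (auto intro: generate.incl)
  have "T \<in> {{1, 2}, {1, 3}, {1, 4}, {2, 3}, {2, 4}, {3, 4}}" using T by (simp only: pairs_eq)
  then consider "T = {1, 2}" | "T = {1, 3}" | "T = {1, 4}" | "T = {2, 3}" | "T = {2, 4}" | "T = {3, 4}"
    by blast
  then show ?thesis
  proof cases
    case 1
    then show ?thesis using id by (intro bexI[of _ id]) auto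
  next
    case 2
    then show ?thesis using a
      by (intro bexI[of _ gen_a]) (auto simp: gen_a_def Transposition.transpose_def)
  next
    case 3
    then show ?thesis using m[OF a m[OF a b]]
      by (intro bexI[of _ "gen_a \<circ> (gen_a \<circ> gen_b)"]) (auto simp: gen_a_def gen_b_def Transposition.transpose_def)
  next
    case 4
    then show ?thesis using m[OF a a]
      by (intro bexI[of _ "gen_a \<circ> gen_a"]) (auto simp: gen_a_def Transposition.transpose_def)
  next
    case 5
    then show ?thesis using m[OF a b]
      by (intro bexI[of _ "gen_a \<circ> gen_b"]) (auto simp: gen_a_def gen_b_def Transposition.transpose_def)
  next
    case 6
    then show ?thesis using b
      by (intro bexI[of _ gen_b]) (auto simp: gen_b_def Transposition.transpose_def)
  qed
qed

lemma generate_alt_4: "generate (sym_group 4) {gen_a, gen_b} = carrier (alt_group 4)"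
proof -
  interpret S: group "sym_group 4" by (rule sym_group_is_group)
  have sub: "{gen_a, gen_b} \<subseteq> carrier (alt_group 4)"
    using gens_permute gens_sign by (simp add: alt_group_carrier)
  have altS: "carrier (alt_group 4) \<subseteq> carrier (sym_group 4)"
    by (rule subgroup.subset[OF alt_group_is_subgroup])
  have "generate (sym_group 4) {gen_a, gen_b} \<subseteq> carrier (alt_group 4)"
    by (rule S.generate_subgroup_incl[OF sub alt_group_is_subgroup])
  moreover have "subgroup (generate (sym_group 4) {gen_a, gen_b}) (sym_group 4)"
    using sub altS by (intro S.generate_is_subgroup) blast
  from pair_transitive_subgroup[OF this generate_pair_transitive]
  have "generate (sym_group 4) {gen_a, gen_b} = carrier (alt_group 4)
      \<or> generate (sym_group 4) {gen_a, gen_b} = carrier (sym_group 4)" by simp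
  ultimately show ?thesis using altS by blast
qed

lemma generate_sym_4: "generate (sym_group 4) {gen_a, gen_b, gen_c} = carrier (sym_group 4)"
proof -
  interpret S: group "sym_group 4" by (rule sym_group_is_group)
  have "subgroup (generate (sym_group 4) {gen_a, gen_b, gen_c}) (sym_group 4)"
    using gens_permute by (intro S.generate_is_subgroup) (simp add: sym_group_carrier)
  from pair_transitive_subgroup[OF this generate_pair_transitive]
  have "generate (sym_group 4) {gen_a, gen_b, gen_c} = carrier (alt_group 4)
      \<or> generate (sym_group 4) {gen_a, gen_b, gen_c} = carrier (sym_group 4)" by simp
  moreover have "gen_c \<in> generate (sym_group 4) {gen_a, gen_b, gen_c}" by (simp add: generate.incl)
  moreover have "gen_c \<notin> carrier (alt_group 4)" using gens_sign by (simp add: alt_group_carrier)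
  ultimately show ?thesis by auto
qed

section \<open>The two matrix groups\<close>

lemma interval_4: "{1..4::nat} = {1, 2, 3, 4}"
  by auto

text \<open>
  The basis that \<open>H1\<close> and \<open>H2\<close> permute: \<open>e\<^sub>2\<close>, \<open>e\<^sub>1 + e\<^sub>2\<close>, \<open>e\<^sub>1 + e\<^sub>2 + e\<^sub>4\<close>, \<open>e\<^sub>3\<close>. It is found
  from the orbits of the first generator, and its first two vectors span
  \<open>\<langle>e\<^sub>1, e\<^sub>2\<rangle>\<close>.
\<close>

definition frame_vec :: "nat \<Rightarrow> bit^4" where
  "frame_vec i = (if i = 1 then vector [0, 1, 0, 0] else if i = 2 then vector [1, 1, 0, 0]
     else if i = 3 then vector [1, 1, 0, 1] else vector [0, 0, 1, 0])"

text \<open>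
  The matrix of the map that permutes \<open>frame_vec\<close> by \<open>\<sigma>\<close>. Its rows are the images of \<open>e\<^sub>1 = b\<^sub>1 + b\<^sub>2\<close>,
  \<open>e\<^sub>2 = b\<^sub>1\<close>, \<open>e\<^sub>3 = b\<^sub>4\<close>, \<open>e\<^sub>4 = b\<^sub>2 + b\<^sub>3\<close>, where \<open>b\<^sub>i\<close> is the \<open>i\<close>-th vector of this basis.
\<close>

definition permmat :: "(nat \<Rightarrow> nat) \<Rightarrow> bit^4^4" where
  "permmat \<sigma> = vector [frame_vec (\<sigma> 1) + frame_vec (\<sigma> 2), frame_vec (\<sigma> 1),
     frame_vec (\<sigma> 4), frame_vec (\<sigma> 2) + frame_vec (\<sigma> 3)]"

lemma vec4_nth [simp]:
  "(vector [a, b, c, d] :: ('x::zero)^4) $ 1 = a" "(vector [a, b, c, d] :: ('x::zero)^4) $ 2 = b"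
  "(vector [a, b, c, d] :: ('x::zero)^4) $ 3 = c" "(vector [a, b, c, d] :: ('x::zero)^4) $ 4 = d"
  by (simp_all add: vector_def)

lemma frame_vec_simps:
  "frame_vec 1 = vector [0, 1, 0, 0]" "frame_vec (Suc 0) = vector [0, 1, 0, 0]"
  "frame_vec 2 = vector [1, 1, 0, 0]"
  "frame_vec 3 = vector [1, 1, 0, 1]" "frame_vec 4 = vector [0, 0, 1, 0]"
  by (simp_all add: frame_vec_def)

lemma bit_double: "x + (x + y) = y" "x + x = 0" for x y :: bit
  by (cases x; cases y; simp)+

lemma vmult_4: "(x v* A) $ j = x $ 1 * A $ 1 $ j + x $ 2 * A $ 2 $ j + x $ 3 * A $ 3 $ j + x $ 4 * A $ 4 $ j"
  for x :: "bit^4" and A :: "bit^4^4"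
  by (simp only: vector_matrix_mult_def vec_lambda_beta sum_4)

lemma frame_vec_permmat:
  assumes "i \<in> {1..4}" shows "frame_vec i v* permmat \<sigma> = frame_vec (\<sigma> i)"
proof -
  have *: "frame_vec 1 v* permmat \<sigma> = frame_vec (\<sigma> 1)" "frame_vec 2 v* permmat \<sigma> = frame_vec (\<sigma> 2)"
    "frame_vec 3 v* permmat \<sigma> = frame_vec (\<sigma> 3)" "frame_vec 4 v* permmat \<sigma> = frame_vec (\<sigma> 4)"
    unfolding vec_eq_iff vmult_4 permmat_def frame_vec_simps vec4_nth vector_add_component
    by (simp_all only: mult_zero_left mult_1_left add_0_left add_0_right bit_double add.assoc add.commute add.left_commute simp_thms)
  have "i = 1 \<or> i = 2 \<or> i = 3 \<or> i = 4" using assms by auto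
  then show ?thesis using * by auto
qed

lemma frame_vec_comb:
  fixes x :: "bit^4"
  shows "x = (x $ 1 + x $ 2) *s frame_vec 1 + (x $ 1 + x $ 4) *s frame_vec 2 + x $ 4 *s frame_vec 3 + x $ 3 *s frame_vec 4"
  unfolding vec_eq_iff forall_4
  by (simp only: vector_add_component vector_smult_component frame_vec_simps vec4_nth)
     (simp only: mult_zero_right mult_1_right add_0_left add_0_right bit_double add.assoc add.commute add.left_commute simp_thms)

lemma matrix_eq_on_frame:
  fixes A B :: "bit^4^4"
  assumes "\<And>i. i \<in> {1..4} \<Longrightarrow> frame_vec i v* A = frame_vec i v* B"
  shows "A = B"
proof -
  have e: "(frame_vec i v* A) $ j = (frame_vec i v* B) $ j" if "i \<in> {1..4}" for i j
    using assms[OF that] by simp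
  have mem: "1 \<in> {1..4::nat}" "2 \<in> {1..4::nat}" "3 \<in> {1..4::nat}" "4 \<in> {1..4::nat}" by simp_all
  have "A $ 2 $ j = B $ 2 $ j" for j
    using e[OF mem(1), of j] unfolding vmult_4 frame_vec_simps vec4_nth
    by (simp only: mult_zero_left mult_1_left add_0_left add_0_right)
  moreover have "A $ 3 $ j = B $ 3 $ j" for j
    using e[OF mem(4), of j] unfolding vmult_4 frame_vec_simps vec4_nth
    by (simp only: mult_zero_left mult_1_left add_0_left add_0_right)
  moreover have "A $ 1 $ j + A $ 2 $ j = B $ 1 $ j + B $ 2 $ j" for j
    using e[OF mem(2), of j] unfolding vmult_4 frame_vec_simps vec4_nth
    by (simp only: mult_zero_left mult_1_left add_0_left add_0_right)
  moreover have "A $ 1 $ j + A $ 2 $ j + A $ 4 $ j = B $ 1 $ j + B $ 2 $ j + B $ 4 $ j" for j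
    using e[OF mem(3), of j] unfolding vmult_4 frame_vec_simps vec4_nth
    by (simp only: mult_zero_left mult_1_left add_0_left add_0_right)
  ultimately have "A $ 1 $ j = B $ 1 $ j" "A $ 2 $ j = B $ 2 $ j" "A $ 3 $ j = B $ 3 $ j" "A $ 4 $ j = B $ 4 $ j" for j
    by (metis add_right_cancel, metis, metis, metis add_left_cancel)
  then show ?thesis unfolding vec_eq_iff forall_4 by simp
qed

lemma permmat_mult:
  assumes "\<And>i. i \<in> {1..4} \<Longrightarrow> \<sigma> i \<in> {1..4}"
  shows "permmat \<sigma> ** permmat \<tau> = permmat (\<tau> \<circ> \<sigma>)"
proof (rule matrix_eq_on_frame)
  fix i :: nat assume i: "i \<in> {1..4}"
  have "frame_vec i v* (permmat \<sigma> ** permmat \<tau>) = (frame_vec i v* permmat \<sigma>) v* permmat \<tau>"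
    by (simp only: vector_matrix_mul_assoc)
  also have "\<dots> = frame_vec (\<tau> (\<sigma> i))" by (simp only: frame_vec_permmat[OF i] frame_vec_permmat[OF assms[OF i]])
  also have "\<dots> = frame_vec i v* permmat (\<tau> \<circ> \<sigma>)" by (simp only: frame_vec_permmat[OF i] comp_apply)
  finally show "frame_vec i v* (permmat \<sigma> ** permmat \<tau>) = frame_vec i v* permmat (\<tau> \<circ> \<sigma>)" .
qed

lemma permmat_id: "permmat id = mat 1"
  by (rule matrix_eq_on_frame) (simp only: frame_vec_permmat vector_matrix_mul_rid id_apply)

lemma frame_vec_inj: "inj_on frame_vec {1..4}"
proof -
  have "frame_vec 1 \<noteq> frame_vec 2" "frame_vec 1 \<noteq> frame_vec 3" "frame_vec 1 \<noteq> frame_vec 4"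
     "frame_vec 2 \<noteq> frame_vec 3" "frame_vec 2 \<noteq> frame_vec 4" "frame_vec 3 \<noteq> frame_vec 4"
    unfolding vec_eq_iff forall_4 frame_vec_simps vec4_nth by simp_all
  then show ?thesis unfolding interval_4 inj_on_def by auto
qed

lemma group_GL4: "group GL4"
proof (rule groupI)
  fix A assume "A \<in> carrier GL4"
  then obtain B where "A ** B = mat 1" "B ** A = mat 1" by (auto simp: GL4_def invertible_def)
  then show "\<exists>B\<in>carrier GL4. B \<otimes>\<^bsub>GL4\<^esub> A = \<one>\<^bsub>GL4\<^esub>" by (auto simp: GL4_def invertible_def)
next
  fix A B assume "A \<in> carrier GL4" "B \<in> carrier GL4"
  then show "A \<otimes>\<^bsub>GL4\<^esub> B \<in> carrier GL4" by (simp add: GL4_def invertible_mult)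
next
  have "mat 1 ** mat 1 = (mat 1 :: bit^4^4)" by (rule matrix_mul_lid)
  then show "\<one>\<^bsub>GL4\<^esub> \<in> carrier GL4" by (auto simp: GL4_def invertible_def)
qed (simp_all add: GL4_def matrix_mul_assoc)

text \<open>
  Matrices act on the right and permutations are composed from right to left; the inverse turns the
  antihomomorphism \<open>permmat\<close> into a homomorphism.
\<close>

definition perm_rep :: "(nat \<Rightarrow> nat) \<Rightarrow> bit^4^4" where
  "perm_rep \<sigma> = permmat (inv' \<sigma>)"

lemma perm_rep_hom: "group_hom (sym_group 4) GL4 perm_rep"
proof (rule group_hom.intro[OF sym_group_is_group group_GL4], rule group_hom_axioms.intro, rule homI)
  fix \<sigma> assume "\<sigma> \<in> carrier (sym_group 4)"
  then have \<sigma>: "\<sigma> permutes {1..4}" by (simp add: sym_group_carrier)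
  note r = permutes_in_image[OF \<sigma>] permutes_in_image[OF permutes_inv[OF \<sigma>]]
  have "permmat \<sigma> ** permmat (inv' \<sigma>) = mat 1" "permmat (inv' \<sigma>) ** permmat \<sigma> = mat 1"
    using permmat_mult[of \<sigma> "inv' \<sigma>"] permmat_mult[of "inv' \<sigma>" \<sigma>] r
    by (simp_all add: permutes_inv_o[OF \<sigma>] permmat_id)
  then show "perm_rep \<sigma> \<in> carrier GL4" by (auto simp: GL4_def invertible_def perm_rep_def)
next
  fix \<sigma> \<tau> assume "\<sigma> \<in> carrier (sym_group 4)" "\<tau> \<in> carrier (sym_group 4)"
  then have \<sigma>: "\<sigma> permutes {1..4}" and \<tau>: "\<tau> permutes {1..4}" by (simp_all add: sym_group_carrier)
  have "inv' (\<sigma> \<circ> \<tau>) = inv' \<tau> \<circ> inv' \<sigma>"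
    by (rule o_inv_distrib[OF permutes_bij[OF \<sigma>] permutes_bij[OF \<tau>]])
  then show "perm_rep (\<sigma> \<otimes>\<^bsub>sym_group 4\<^esub> \<tau>) = perm_rep \<sigma> \<otimes>\<^bsub>GL4\<^esub> perm_rep \<tau>"
    using permmat_mult[of "inv' \<sigma>" "inv' \<tau>"] permutes_in_image[OF permutes_inv[OF \<sigma>]]
    by (simp add: perm_rep_def sym_group_mult GL4_def)
qed

lemma perm_rep_inj: "inj_on perm_rep (carrier (sym_group 4))"
proof (rule inj_onI)
  fix \<sigma> \<tau> assume "\<sigma> \<in> carrier (sym_group 4)" "\<tau> \<in> carrier (sym_group 4)" and eq: "perm_rep \<sigma> = perm_rep \<tau>"
  then have \<sigma>: "\<sigma> permutes {1..4}" and \<tau>: "\<tau> permutes {1..4}" by (simp_all add: sym_group_carrier)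
  note \<sigma>' = permutes_inv[OF \<sigma>] and \<tau>' = permutes_inv[OF \<tau>]
  have "inv' \<sigma> i = inv' \<tau> i" for i
  proof (cases "i \<in> {1..4}")
    case True
    have "frame_vec (inv' \<sigma> i) = frame_vec (inv' \<tau> i)"
      using frame_vec_permmat[OF True] eq unfolding perm_rep_def by metis
    then show ?thesis
      by (rule inj_onD[OF frame_vec_inj])
         (simp_all only: permutes_in_image[OF \<sigma>'] permutes_in_image[OF \<tau>'] True)
  next
    case False
    then show ?thesis by (metis permutes_not_in[OF \<sigma>'] permutes_not_in[OF \<tau>'])
  qed
  then have "inv' \<sigma> = inv' \<tau>" by (rule ext)
  then have "inv' (inv' \<sigma>) = inv' (inv' \<tau>)" by (rule arg_cong)
  then show "\<sigma> = \<tau>" by (simp only: permutes_inv_inv[OF \<sigma>] permutes_inv_inv[OF \<tau>])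
qed

lemma perm_rep_gens: "perm_rep gen_a = mat_a" "perm_rep gen_b = mat_b" "perm_rep gen_c = mat_c"
proof -
  have "inv' gen_a = Transposition.transpose 1 2 \<circ> Transposition.transpose 2 3"
    unfolding gen_a_def by (rule inv_unique_comp) (simp_all add: fun_eq_iff)
  moreover have "inv' gen_b = gen_b"
    by (rule inv_unique_comp) (auto simp: gen_b_def fun_eq_iff Transposition.transpose_def)
  moreover have "inv' gen_c = gen_c"
    by (rule inv_unique_comp) (auto simp: gen_c_def fun_eq_iff Transposition.transpose_def)
  ultimately have *: "perm_rep gen_a = vector [frame_vec 2 + frame_vec 3, frame_vec 2, frame_vec 4, frame_vec 3 + frame_vec 1]"
    "perm_rep gen_b = vector [frame_vec 4 + frame_vec 3, frame_vec 4, frame_vec 1, frame_vec 3 + frame_vec 2]"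
    "perm_rep gen_c = vector [frame_vec 1 + frame_vec 2, frame_vec 1, frame_vec 3, frame_vec 2 + frame_vec 4]"
    by (simp_all add: perm_rep_def permmat_def gen_b_def gen_c_def Transposition.transpose_def)
  show "perm_rep gen_a = mat_a" "perm_rep gen_b = mat_b" "perm_rep gen_c = mat_c"
    unfolding * mat_a_def mat_b_def mat_c_def vec_eq_iff forall_4 frame_vec_simps
    by (simp_all only: vec4_nth vector_add_component) simp_all
qed

lemma perm_rep_image:
  assumes "subgroup Q (sym_group 4)"
  shows "perm_rep ` Q = permmat ` Q"
proof -
  interpret S: group "sym_group 4" by (rule sym_group_is_group)
  have c: "q \<in> carrier (sym_group 4)" if "q \<in> Q" for q by (rule subgroup.mem_carrier[OF assms that])
  have i: "inv' q \<in> Q" if "q \<in> Q" for q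
    using subgroup.m_inv_closed[OF assms that] c[OF that] by simp
  have ii: "inv' (inv' q) = q" if "q \<in> Q" for q
    using c[OF that] by (intro permutes_inv_inv) (simp add: sym_group_carrier)
  have "inv' ` Q = Q" using i ii by (metis image_eqI image_subsetI subsetI subset_antisym)
  then have "permmat ` inv' ` Q = permmat ` Q" by simp
  then show ?thesis by (simp add: image_image perm_rep_def)
qed

lemma H1_eq: "H1 = perm_rep ` carrier (alt_group 4)"
proof -
  have "{gen_a, gen_b} \<subseteq> carrier (sym_group 4)" using gens_permute by (simp add: sym_group_carrier)
  from group_hom.generate_img[OF perm_rep_hom this] show ?thesis
    by (simp add: H1_def perm_rep_gens generate_alt_4)
qed

lemma H2_eq: "H2 = perm_rep ` carrier (sym_group 4)"
proof -
  have "{gen_a, gen_b, gen_c} \<subseteq> carrier (sym_group 4)" using gens_permute by (simp add: sym_group_carrier)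
  from group_hom.generate_img[OF perm_rep_hom this] show ?thesis
    by (simp add: H2_def perm_rep_gens generate_sym_4)
qed

lemma image_iso:
  assumes h: "group_hom A B h" and inj: "inj_on h (carrier A)" and Q: "subgroup Q A"
  shows "B\<lparr>carrier := h ` Q\<rparr> \<cong> A\<lparr>carrier := Q\<rparr>"
proof -
  have "h \<in> iso (A\<lparr>carrier := Q\<rparr>) (B\<lparr>carrier := h ` Q\<rparr>)"
    using inj_on_subset[OF inj subgroup.subset[OF Q]] subgroup.mem_carrier[OF Q] group_hom.hom_mult[OF h]
    by (auto simp: iso_def hom_def bij_betw_def)
  then have "A\<lparr>carrier := Q\<rparr> \<cong> B\<lparr>carrier := h ` Q\<rparr>" by (rule is_isoI)
  moreover have "group (A\<lparr>carrier := Q\<rparr>)"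
    using h Q by (simp add: group_hom_def group.subgroup_imp_group)
  ultimately show ?thesis by (simp add: group.iso_sym)
qed

lemma order_H1: "order (GL4\<lparr>carrier := H1\<rparr>) = 12" and iso_H1: "GL4\<lparr>carrier := H1\<rparr> \<cong> alt_group 4"
proof -
  have "card H1 = card (carrier (alt_group 4))" unfolding H1_eq
    by (rule card_image[OF inj_on_subset[OF perm_rep_inj subgroup.subset[OF alt_group_is_subgroup]]])
  then show "order (GL4\<lparr>carrier := H1\<rparr>) = 12"
    using alt_group_card_carrier[of 4] by (simp add: order_def fact_numeral)
  show "GL4\<lparr>carrier := H1\<rparr> \<cong> alt_group 4"
    using image_iso[OF perm_rep_hom perm_rep_inj alt_group_is_subgroup]
    by (simp add: H1_eq alt_group_def)
qed

lemma order_H2: "order (GL4\<lparr>carrier := H2\<rparr>) = 24" and iso_H2: "GL4\<lparr>carrier := H2\<rparr> \<cong> sym_group 4"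
proof -
  interpret S: group "sym_group 4" by (rule sym_group_is_group)
  have "card H2 = card (carrier (sym_group 4))" unfolding H2_eq by (rule card_image[OF perm_rep_inj])
  then show "order (GL4\<lparr>carrier := H2\<rparr>) = 24"
    using sym_group_card_carrier[of 4] by (simp add: order_def fact_numeral)
  show "GL4\<lparr>carrier := H2\<rparr> \<cong> sym_group 4"
    using image_iso[OF perm_rep_hom perm_rep_inj S.subgroup_self] by (simp add: H2_eq)
qed

lemma H1_permmat: "H1 = permmat ` carrier (alt_group 4)"
  unfolding H1_eq by (rule perm_rep_image[OF alt_group_is_subgroup])

lemma H2_permmat: "H2 = permmat ` carrier (sym_group 4)"
  unfolding H2_eq by (rule perm_rep_image[OF group.subgroup_self[OF sym_group_is_group]])

section \<open>Linear algebra over the field with two elements\<close>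

lemma (in group) comb_axis:
  assumes "\<And>j. e j \<in> carrier G"
  shows "F2_comb G e (axis j 1) = e j"
proof -
  have "\<forall>j. F2_comb G e (axis j 1) = e j"
    unfolding forall_4 by (simp add: F2_comb_def F2_smult_def axis_def assms)
  then show ?thesis by blast
qed

text \<open>
  An elementary abelian \<open>2\<close>-subgroup, with the axioms in the form in which they are used.
\<close>

locale binary_space = group G for G (structure) +
  fixes V :: "'a set"
  assumes V_subgroup: "subgroup V G"
    and V_comm: "u \<in> V \<Longrightarrow> v \<in> V \<Longrightarrow> u \<otimes> v = v \<otimes> u"
    and V_sq: "v \<in> V \<Longrightarrow> v \<otimes> v = \<one>"
begin

lemma V_car: "v \<in> V \<Longrightarrow> v \<in> carrier G"
  using subgroup.mem_carrier[OF V_subgroup] .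

lemma V_one: "\<one> \<in> V"
  using subgroup.one_closed[OF V_subgroup] .

lemma V_mult: "u \<in> V \<Longrightarrow> v \<in> V \<Longrightarrow> u \<otimes> v \<in> V"
  using subgroup.m_closed[OF V_subgroup] .

lemma V_left_comm: "u \<in> V \<Longrightarrow> v \<in> V \<Longrightarrow> w \<in> V \<Longrightarrow> u \<otimes> (v \<otimes> w) = v \<otimes> (u \<otimes> w)"
  using V_comm[of u v] by (simp add: m_assoc[symmetric] V_car)

lemma V_assoc: "u \<in> V \<Longrightarrow> v \<in> V \<Longrightarrow> w \<in> V \<Longrightarrow> (u \<otimes> v) \<otimes> w = u \<otimes> (v \<otimes> w)"
  by (simp add: m_assoc V_car)

lemma V_eq_iff: "u \<in> V \<Longrightarrow> v \<in> V \<Longrightarrow> u \<otimes> v = \<one> \<longleftrightarrow> u = v"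
  by (metis V_car V_sq l_cancel_one' inv_cancel_left(1))

lemma smult_closed: "v \<in> V \<Longrightarrow> F2_smult G c v \<in> V"
  by (simp add: F2_smult_def V_one)

lemma smult_add: "v \<in> V \<Longrightarrow> F2_smult G (c + d) v = F2_smult G c v \<otimes> F2_smult G d v"
  by (cases c; cases d) (simp_all add: F2_smult_def V_sq V_car)

lemma comb_closed: "range e \<subseteq> V \<Longrightarrow> F2_comb G e x \<in> V"
  unfolding F2_comb_def by (intro V_mult smult_closed) auto

lemma comb_add:
  assumes "range e \<subseteq> V"
  shows "F2_comb G e (x + y) = F2_comb G e x \<otimes> F2_comb G e y"
proof -
  have c: "F2_smult G c (e j) \<in> V" for c j using assms by (intro smult_closed) auto
  have eV: "e j \<in> V" for j using assms by auto
  show ?thesis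
    unfolding F2_comb_def vector_add_component smult_add[OF eV]
    by (simp only: V_assoc V_comm V_left_comm c V_mult)
qed

lemma basis_axis:
  assumes "range e \<subseteq> V"
  shows "F2_comb G e (axis j 1) = e j"
  using assms V_car by (intro comb_axis) auto

lemma comb_0: "F2_comb G e 0 = \<one>"
  by (simp add: F2_comb_def F2_smult_def)

lemma additive_0:
  assumes "\<And>x y. P (x + y) = P x \<otimes> P y" "\<And>x. P x \<in> V"
  shows "P (0 :: bit^4) = \<one>"
  using assms(1)[of 0 0] V_sq[OF assms(2)[of 0]] by simp

lemma additive_smult:
  assumes "\<And>x y. P (x + y) = P x \<otimes> P y" "\<And>x. P x \<in> V"
  shows "P (c *s (v :: bit^4)) = F2_smult G c (P v)"
  using additive_0[OF assms] by (cases c) (simp_all add: F2_smult_def)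

lemma additive_comb:
  assumes P: "\<And>x y. P (x + y) = P x \<otimes> P y" "\<And>x. P x \<in> V"
  shows "P (c1 *s v1 + c2 *s v2 + c3 *s v3 + c4 *s (v4 :: bit^4)) =
    F2_smult G c1 (P v1) \<otimes> F2_smult G c2 (P v2) \<otimes> F2_smult G c3 (P v3) \<otimes> F2_smult G c4 (P v4)"
  by (simp only: P(1) additive_smult[OF P])

text \<open>
  Additive maps are linear over the field with two elements, so they are determined on a basis.
\<close>

lemma additive_eq_on_frame:
  assumes P: "\<And>x y. P (x + y) = P x \<otimes> P y" "\<And>x. P x \<in> V"
    and R: "\<And>x y. R (x + y) = R x \<otimes> R y" "\<And>x. R x \<in> V"
    and eq: "\<And>i. i \<in> {1..4} \<Longrightarrow> P (frame_vec i) = R (frame_vec i)"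
  shows "P x = R x"
proof -
  have mem: "1 \<in> {1..4::nat}" "2 \<in> {1..4::nat}" "3 \<in> {1..4::nat}" "4 \<in> {1..4::nat}" by simp_all
  show ?thesis
    by (subst (1 2) frame_vec_comb)
       (simp only: additive_comb[OF P] additive_comb[OF R] eq[OF mem(1)] eq[OF mem(2)] eq[OF mem(3)] eq[OF mem(4)])
qed

lemma F2_basisD:
  assumes "F2_basis G V e"
  shows "range e \<subseteq> V" "v \<in> V \<Longrightarrow> \<exists>x. v = F2_comb G e x"
    "F2_comb G e x = F2_comb G e y \<Longrightarrow> x = y"
  using assms comb_closed unfolding F2_basis_def by (blast, blast, metis)

lemma F2_basisI:
  assumes "range e \<subseteq> V" "\<And>v. v \<in> V \<Longrightarrow> \<exists>x. v = F2_comb G e x"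
    "\<And>x. F2_comb G e x = \<one> \<Longrightarrow> x = 0"
  shows "F2_basis G V e"
proof -
  have "x = y" if "F2_comb G e x = F2_comb G e y" for x y
  proof -
    have "F2_comb G e (x + y) = \<one>"
      using that comb_add[OF assms(1)] V_sq comb_closed[OF assms(1)] by simp
    then have "x + y = 0" by (rule assms(3))
    then have "x + y + y = y" by simp
    moreover have "y + y = 0" unfolding vec_eq_iff vector_add_component zero_index by (simp only: bit_double simp_thms)
    ultimately show "x = y" by (simp add: add.assoc)
  qed
  then show ?thesis unfolding F2_basis_def using assms(1,2) by metis
qed

abbreviation GLV where "GLV \<equiv> GL_group G V"

lemma GL_mult: "f \<otimes>\<^bsub>GLV\<^esub> g = compose V g f"
  by (simp add: GL_group_def)

lemma GL_carrier:
  "f \<in> carrier (GLV) \<longleftrightarrow> f \<in> Bij V \<and> (\<forall>u\<in>V. \<forall>v\<in>V. f (u \<otimes> v) = f u \<otimes> f v)"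
proof -
  have "f (F2_smult G c v) = F2_smult G c (f v)"
    if "f \<in> Bij V" "\<forall>u\<in>V. \<forall>v\<in>V. f (u \<otimes> v) = f u \<otimes> f v" "v \<in> V" for c v
  proof -
    have fV: "f \<one> \<in> V" using Bij_imp_funcset[OF that(1)] V_one by auto
    have "f \<one> = f \<one> \<otimes> f \<one>" using that(2) V_one V_car by (metis l_one)
    then have "f \<one> = \<one>" using V_sq[OF fV] by simp
    then show ?thesis by (simp add: F2_smult_def)
  qed
  then show ?thesis by (auto simp: GL_group_def)
qed

lemma GL_closed: "f \<in> carrier (GLV) \<Longrightarrow> v \<in> V \<Longrightarrow> f v \<in> V"
  using Bij_imp_funcset[of f V] by (auto simp: GL_carrier)

lemma GL_hom: "f \<in> carrier (GLV) \<Longrightarrow> u \<in> V \<Longrightarrow> v \<in> V \<Longrightarrow> f (u \<otimes> v) = f u \<otimes> f v"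
  by (simp add: GL_carrier)

lemma GL_one: "f \<in> carrier (GLV) \<Longrightarrow> f \<one> = \<one>"
  using GL_hom[of f \<one> \<one>] V_one V_sq GL_closed by fastforce

lemma group_GL: "group (GLV)"
proof (rule groupI)
  fix f g assume fg: "f \<in> carrier (GLV)" "g \<in> carrier (GLV)"
  then show "f \<otimes>\<^bsub>GLV\<^esub> g \<in> carrier (GLV)"
    unfolding GL_carrier GL_mult
    using compose_Bij[of g V f] GL_closed[OF fg(1)] by (auto simp: compose_eq V_mult)
next
  show "\<one>\<^bsub>GLV\<^esub> \<in> carrier (GLV)"
    unfolding GL_carrier by (simp add: GL_group_def id_Bij V_mult)
next
  fix f g h assume "f \<in> carrier (GLV)" "g \<in> carrier (GLV)" "h \<in> carrier (GLV)"
  then show "f \<otimes>\<^bsub>GLV\<^esub> g \<otimes>\<^bsub>GLV\<^esub> h = f \<otimes>\<^bsub>GLV\<^esub> (g \<otimes>\<^bsub>GLV\<^esub> h)"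
    unfolding GL_mult by (simp add: GL_carrier compose_assoc Bij_imp_funcset)
next
  fix f assume f: "f \<in> carrier (GLV)"
  then show "\<one>\<^bsub>GLV\<^esub> \<otimes>\<^bsub>GLV\<^esub> f = f"
    unfolding GL_mult by (auto simp: GL_group_def compose_def Bij_def extensional_def fun_eq_iff)
  have B: "f \<in> Bij V" using f by (simp add: GL_carrier)
  let ?g = "restrict (inv_into V f) V"
  have inj: "inj_on f V" and im: "f ` V = V" using B by (auto simp: Bij_def bij_betw_def)
  have gV: "?g v \<in> V" "f (?g v) = v" if "v \<in> V" for v
    using that im by (auto simp: inv_into_into f_inv_into_f)
  have "?g (u \<otimes> v) = ?g u \<otimes> ?g v" if "u \<in> V" "v \<in> V" for u v
  proof (rule inj_onD[OF inj])
    show "f (?g (u \<otimes> v)) = f (?g u \<otimes> ?g v)"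
      using gV that V_mult GL_hom[OF f] by metis
  qed (use gV that V_mult in blast)+
  then have "?g \<in> carrier (GLV)"
    unfolding GL_carrier using restrict_inv_into_Bij[OF B] by blast
  moreover have "?g \<otimes>\<^bsub>GLV\<^esub> f = \<one>\<^bsub>GLV\<^esub>"
    unfolding GL_mult using gV by (auto simp: GL_group_def compose_def fun_eq_iff)
  ultimately show "\<exists>g\<in>carrier (GLV). g \<otimes>\<^bsub>GLV\<^esub> f = \<one>\<^bsub>GLV\<^esub>" by blast
qed

lemma GL_mult_apply: "v \<in> V \<Longrightarrow> (f \<otimes>\<^bsub>GLV\<^esub> g) v = g (f v)"
  by (simp add: GL_mult compose_def)

lemma GL_inv_apply:
  assumes k: "k \<in> carrier (GLV)" and v: "v \<in> V"
  shows "(inv\<^bsub>GLV\<^esub> k) (k v) = v" "k ((inv\<^bsub>GLV\<^esub> k) v) = v"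
proof -
  have 1: "\<one>\<^bsub>GLV\<^esub> v = v" using v by (simp add: GL_group_def)
  show "(inv\<^bsub>GLV\<^esub> k) (k v) = v"
    using GL_mult_apply[OF v, of k "inv\<^bsub>GLV\<^esub> k"] group.r_inv[OF group_GL k] 1 by simp
  show "k ((inv\<^bsub>GLV\<^esub> k) v) = v"
    using GL_mult_apply[OF v, of "inv\<^bsub>GLV\<^esub> k" k] group.l_inv[OF group_GL k] 1 by simp
qed

lemma GL_comb:
  assumes k: "k \<in> carrier (GLV)" and e: "range e \<subseteq> V"
  shows "k (F2_comb G e x) = F2_comb G (\<lambda>j. k (e j)) x"
proof -
  have s: "k (F2_smult G c (e j)) = F2_smult G c (k (e j))" for c j
    using GL_one[OF k] by (simp add: F2_smult_def)
  have eV: "F2_smult G c (e j) \<in> V" for c j using e by (intro smult_closed) auto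
  show ?thesis unfolding F2_comb_def by (simp only: GL_hom[OF k] eV V_mult s)
qed

lemma GL_eqI:
  assumes "f \<in> carrier (GLV)" "g \<in> carrier (GLV)" "\<And>v. v \<in> V \<Longrightarrow> f v = g v"
  shows "f = g"
proof
  fix v
  have "f \<in> extensional V" "g \<in> extensional V" using assms(1,2) by (simp_all add: GL_carrier Bij_def)
  then show "f v = g v" using assms(3)[of v] by (cases "v \<in> V") (auto simp: extensional_def)
qed

lemma GL_eq_on_basis:
  assumes f: "f \<in> carrier (GLV)" and g: "g \<in> carrier (GLV)"
    and e: "F2_basis G V e" and eq: "\<And>j. f (e j) = g (e j)"
  shows "f = g"
proof (rule GL_eqI[OF f g])
  fix v assume "v \<in> V"
  then obtain x where x: "v = F2_comb G e x" using F2_basisD(2)[OF e] by blast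
  show "f v = g v" unfolding x GL_comb[OF f F2_basisD(1)[OF e]] GL_comb[OF g F2_basisD(1)[OF e]] eq ..
qed

text \<open>
  Expand in coordinates with respect to \<open>e\<close> and read the coordinates with respect to \<open>f\<close>.
\<close>

lemma exists_GL:
  assumes e: "F2_basis G V e" and f: "F2_basis G V f"
  obtains k where "k \<in> carrier (GLV)" "\<And>x. k (F2_comb G e x) = F2_comb G f x"
proof -
  define k where "k = (\<lambda>v\<in>V. F2_comb G f (THE x. v = F2_comb G e x))"
  note eV = F2_basisD(1)[OF e] and fV = F2_basisD(1)[OF f]
  have k: "k (F2_comb G e x) = F2_comb G f x" for x
  proof -
    have "(THE y. F2_comb G e x = F2_comb G e y) = x"
      by (rule the_equality) (auto dest: F2_basisD(3)[OF e])
    then show ?thesis using comb_closed[OF eV] by (simp add: k_def)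
  qed
  have "bij_betw k V V"
    unfolding bij_betw_def
  proof
    show "inj_on k V"
    proof (rule inj_onI)
      fix u v assume uv: "u \<in> V" "v \<in> V" "k u = k v"
      obtain x y where "u = F2_comb G e x" "v = F2_comb G e y" using F2_basisD(2)[OF e] uv by blast
      then show "u = v" using uv(3) k F2_basisD(3)[OF f] by metis
    qed
    show "k ` V = V"
    proof
      show "k ` V \<subseteq> V" using F2_basisD(2)[OF e] k comb_closed[OF fV] by (auto simp: k_def)
      show "V \<subseteq> k ` V"
      proof
        fix v assume "v \<in> V"
        then obtain x where "v = F2_comb G f x" using F2_basisD(2)[OF f] by blast
        then show "v \<in> k ` V" using k[of x] comb_closed[OF eV, of x] by (metis image_eqI)
      qed
    qed
  qed
  then have "k \<in> Bij V" by (simp add: Bij_def k_def)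
  moreover have "k (u \<otimes> v) = k u \<otimes> k v" if "u \<in> V" "v \<in> V" for u v
  proof -
    obtain x y where "u = F2_comb G e x" "v = F2_comb G e y" using F2_basisD(2)[OF e] \<open>u \<in> V\<close> \<open>v \<in> V\<close> by blast
    then show ?thesis by (simp only: comb_add[OF eV, symmetric] comb_add[OF fV] k)
  qed
  ultimately have "k \<in> carrier (GLV)" by (simp add: GL_carrier)
  with k show thesis using that by blast
qed

end

text \<open>
  Bases are indexed by the type \<open>4\<close>, in which \<open>4 = 0\<close>, but permutations act on \<open>{1..4}\<close>. The
  basis \<open>f \<circ> nat_index\<close> belongs to a family \<open>f\<close> that is indexed by natural numbers.
\<close>

definition nat_index :: "4 \<Rightarrow> nat" where
  "nat_index j = (if j = 1 then 1 else if j = 2 then 2 else if j = 3 then 3 else 4)"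

lemma nat_index_simps: "nat_index 1 = 1" "nat_index 2 = 2" "nat_index 3 = 3" "nat_index 4 = 4"
  by (simp_all add: nat_index_def)

lemma nat_index_range: "nat_index j \<in> {1..4}"
  by (simp add: nat_index_def)

lemma nat_index_surj:
  assumes "i \<in> {1..4}" obtains j where "i = nat_index j"
proof -
  have "i = nat_index 1 \<or> i = nat_index 2 \<or> i = nat_index 3 \<or> i = nat_index 4" using assms unfolding nat_index_simps interval_4 by simp
  then show thesis using that by blast
qed

lemma nat_index_inj: "nat_index i = nat_index j \<Longrightarrow> i = j"
proof -
  have "\<forall>i j. nat_index i = nat_index j \<longrightarrow> i = j" unfolding forall_4 nat_index_simps by simp
  then show "nat_index i = nat_index j \<Longrightarrow> i = j" by blast
qed

text \<open>
  The automorphisms that permute the basis \<open>f\<^sub>1, ..., f\<^sub>4\<close> by a permutation in \<open>Q\<close>. Both \<open>H\<close> and the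
  images of \<open>H1\<close> and \<open>H2\<close> have this form, for different bases.
\<close>

definition perm_maps ::
    "('a, 'm) monoid_scheme \<Rightarrow> 'a set \<Rightarrow> (nat \<Rightarrow> 'a) \<Rightarrow> (nat \<Rightarrow> nat) set \<Rightarrow> ('a \<Rightarrow> 'a) set" where
  "perm_maps G V f Q =
     {k \<in> carrier (GL_group G V). \<exists>\<sigma>\<in>Q. \<forall>i\<in>{1..4}. k (f i) = f (\<sigma> i)}"

abbreviation frame :: "('a, 'm) monoid_scheme \<Rightarrow> (4 \<Rightarrow> 'a) \<Rightarrow> nat \<Rightarrow> 'a" where
  "frame G e i \<equiv> F2_comb G e (frame_vec i)"

context binary_space
begin

lemma comb_ix:
  "F2_comb G (f \<circ> nat_index) x = F2_smult G (x $ 1) (f 1) \<otimes> F2_smult G (x $ 2) (f 2) \<otimes>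
     F2_smult G (x $ 3) (f 3) \<otimes> F2_smult G (x $ 4) (f 4)"
  by (simp add: F2_comb_def nat_index_simps)

lemma exists_GL_frames:
  assumes f: "F2_basis G V (f \<circ> nat_index)" and g: "F2_basis G V (g \<circ> nat_index)"
  obtains k where "k \<in> carrier (GLV)" "\<And>i. i \<in> {1..4} \<Longrightarrow> k (f i) = g i"
proof -
  obtain k where k: "k \<in> carrier (GLV)" "\<And>x. k (F2_comb G (f \<circ> nat_index) x) = F2_comb G (g \<circ> nat_index) x"
    by (rule exists_GL[OF f g]) blast
  have "k (f i) = g i" if i: "i \<in> {1..4}" for i
  proof -
    obtain j where "i = nat_index j" by (rule nat_index_surj[OF i])
    then show ?thesis
      using k(2)[of "axis j 1"] basis_axis[OF F2_basisD(1)[OF f], of j] basis_axis[OF F2_basisD(1)[OF g], of j]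
      by simp
  qed
  with k(1) show thesis using that by blast
qed

text \<open>
  The change of coordinates \<open>T\<close> is inverted explicitly by \<open>frame_vec_comb\<close>.
\<close>

lemma frame_basis:
  assumes e: "F2_basis G V e"
  shows "F2_basis G V (frame G e \<circ> nat_index)"
proof -
  note eV = F2_basisD(1)[OF e]
  define T :: "bit^4 \<Rightarrow> bit^4" where
    "T c = c $ 1 *s frame_vec 1 + c $ 2 *s frame_vec 2 + c $ 3 *s frame_vec 3 + c $ 4 *s frame_vec 4" for c
  have comb: "F2_comb G (frame G e \<circ> nat_index) c = F2_comb G e (T c)" for c
    unfolding T_def comb_ix by (rule additive_comb[symmetric, OF comb_add[OF eV] comb_closed[OF eV]])
  show ?thesis
  proof (rule F2_basisI)
    show "range (frame G e \<circ> nat_index) \<subseteq> V" using comb_closed[OF eV] by auto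
  next
    fix v assume "v \<in> V"
    then obtain x where x: "v = F2_comb G e x" using F2_basisD(2)[OF e] by blast
    have "T (vector [x $ 1 + x $ 2, x $ 1 + x $ 4, x $ 4, x $ 3]) = x"
      unfolding T_def vec4_nth by (rule frame_vec_comb[symmetric])
    then show "\<exists>c. v = F2_comb G (frame G e \<circ> nat_index) c" unfolding comb x by metis
  next
    fix c assume "F2_comb G (frame G e \<circ> nat_index) c = \<one>"
    then have "F2_comb G e (T c) = F2_comb G e 0" by (simp only: comb comb_0)
    then have "T c = 0" by (rule F2_basisD(3)[OF e])
    then have t: "T c $ j = 0" for j by simp
    have "c $ 3 = 0" "c $ 4 = 0" "c $ 2 + c $ 3 = 0" "c $ 1 + c $ 2 + c $ 3 = 0"
      using t[of 4] t[of 3] t[of 1] t[of 2] unfolding T_def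
      by (simp_all only: vector_add_component vector_smult_component frame_vec_simps vec4_nth
          mult_zero_right mult_1_right add_0_left add_0_right)
    then show "c = 0" unfolding vec_eq_iff forall_4 zero_index by (simp only: add_0_right simp_thms)
  qed
qed

lemma frame_generates:
  assumes "range e \<subseteq> V"
  shows "frame G e 1 = e 2" "frame G e 2 = e 1 \<otimes> e 2"
proof -
  have "e j \<in> carrier G" for j using assms V_car by auto
  then show "frame G e 1 = e 2" "frame G e 2 = e 1 \<otimes> e 2"
    unfolding frame_vec_simps F2_comb_def vec4_nth by (simp_all add: F2_smult_def)
qed

text \<open>
  This removes the matrices from the argument: membership in \<open>H1\<close> or \<open>H2\<close> becomes a statement about
  the images of four vectors.
\<close>

lemma maps_of_permmat:
  assumes e: "F2_basis G V e"
  shows "maps_of_matrices G V e (permmat ` Q) = perm_maps G V (frame G e) Q"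
proof
  note eV = F2_basisD(1)[OF e]
  show "maps_of_matrices G V e (permmat ` Q) \<subseteq> perm_maps G V (frame G e) Q"
  proof
    fix k assume "k \<in> maps_of_matrices G V e (permmat ` Q)"
    then obtain \<sigma> where k: "k \<in> carrier (GLV)" "\<sigma> \<in> Q"
      "\<And>x. k (F2_comb G e x) = F2_comb G e (x v* permmat \<sigma>)" by (auto simp: maps_of_matrices_def)
    then show "k \<in> perm_maps G V (frame G e) Q"
      unfolding perm_maps_def by (auto simp: frame_vec_permmat)
  qed
  show "perm_maps G V (frame G e) Q \<subseteq> maps_of_matrices G V e (permmat ` Q)"
  proof
    fix k assume "k \<in> perm_maps G V (frame G e) Q"
    then obtain \<sigma> where k: "k \<in> carrier (GLV)" "\<sigma> \<in> Q"
      "\<And>i. i \<in> {1..4} \<Longrightarrow> k (frame G e i) = frame G e (\<sigma> i)" by (auto simp: perm_maps_def)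
    have "k (F2_comb G e x) = F2_comb G e (x v* permmat \<sigma>)" for x
    proof (rule additive_eq_on_frame[where P = "\<lambda>x. k (F2_comb G e x)" and R = "\<lambda>x. F2_comb G e (x v* permmat \<sigma>)"])
      show "k (F2_comb G e (x + y)) = k (F2_comb G e x) \<otimes> k (F2_comb G e y)" for x y
        by (simp only: comb_add[OF eV] GL_hom[OF k(1)] comb_closed[OF eV])
      show "k (F2_comb G e x) \<in> V" for x by (rule GL_closed[OF k(1) comb_closed[OF eV]])
      show "F2_comb G e ((x + y) v* permmat \<sigma>) = F2_comb G e (x v* permmat \<sigma>) \<otimes> F2_comb G e (y v* permmat \<sigma>)" for x y
        by (simp only: vector_matrix_left_distrib comb_add[OF eV])
      show "F2_comb G e (x v* permmat \<sigma>) \<in> V" for x by (rule comb_closed[OF eV])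
      show "k (F2_comb G e (frame_vec i)) = F2_comb G e (frame_vec i v* permmat \<sigma>)" if "i \<in> {1..4}" for i
        using k(3)[OF that] by (simp only: frame_vec_permmat[OF that])
    qed
    then show "k \<in> maps_of_matrices G V e (permmat ` Q)"
      unfolding maps_of_matrices_def using k(1,2) by blast
  qed
qed

text \<open>
  Conjugation by \<open>k\<close> carries the basis \<open>f\<close> to \<open>k f\<close> and leaves the permutation unchanged. The other
  inclusion is the same fact for the inverse of \<open>k\<close>.
\<close>

lemma conj_perm_maps:
  assumes k: "k \<in> carrier (GLV)" and f: "\<And>i. i \<in> {1..4} \<Longrightarrow> f i \<in> V"
    and Q: "\<And>\<sigma> i. \<sigma> \<in> Q \<Longrightarrow> i \<in> {1..4} \<Longrightarrow> \<sigma> i \<in> {1..4}"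
  shows "(\<lambda>h. inv\<^bsub>GLV\<^esub> k \<otimes>\<^bsub>GLV\<^esub> h \<otimes>\<^bsub>GLV\<^esub> k) ` perm_maps G V f Q
    = perm_maps G V (\<lambda>i. k (f i)) Q"
proof -
  interpret GL: group "GLV" by (rule group_GL)
  have conj: "inv\<^bsub>GLV\<^esub> k \<otimes>\<^bsub>GLV\<^esub> h \<otimes>\<^bsub>GLV\<^esub> k \<in> perm_maps G V (\<lambda>i. k (f i)) Q"
    if h: "h \<in> perm_maps G V f Q" and k: "k \<in> carrier (GLV)" and f: "\<And>i. i \<in> {1..4} \<Longrightarrow> f i \<in> V" for h k f
  proof -
    obtain \<sigma> where h: "h \<in> carrier (GLV)" "\<sigma> \<in> Q"
      "\<And>i. i \<in> {1..4} \<Longrightarrow> h (f i) = f (\<sigma> i)" using h by (auto simp: perm_maps_def)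
    have "(inv\<^bsub>GLV\<^esub> k \<otimes>\<^bsub>GLV\<^esub> h \<otimes>\<^bsub>GLV\<^esub> k) (k (f i)) = k (f (\<sigma> i))"
      if i: "i \<in> {1..4}" for i
      using GL_closed[OF k f[OF i]] GL_inv_apply(1)[OF k f[OF i]] h(3)[OF i] by (simp add: GL_mult_apply)
    then show ?thesis unfolding perm_maps_def using h(1,2) k by auto
  qed
  show ?thesis
  proof
    show "(\<lambda>h. inv\<^bsub>GLV\<^esub> k \<otimes>\<^bsub>GLV\<^esub> h \<otimes>\<^bsub>GLV\<^esub> k) ` perm_maps G V f Q
        \<subseteq> perm_maps G V (\<lambda>i. k (f i)) Q"
      by (intro image_subsetI conj k f)
    show "perm_maps G V (\<lambda>i. k (f i)) Q \<subseteq>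
        (\<lambda>h. inv\<^bsub>GLV\<^esub> k \<otimes>\<^bsub>GLV\<^esub> h \<otimes>\<^bsub>GLV\<^esub> k) ` perm_maps G V f Q"
    proof
      fix h assume h: "h \<in> perm_maps G V (\<lambda>i. k (f i)) Q"
      then have hG: "h \<in> carrier (GLV)" by (simp add: perm_maps_def)
      let ?h = "k \<otimes>\<^bsub>GLV\<^esub> h \<otimes>\<^bsub>GLV\<^esub> inv\<^bsub>GLV\<^esub> k"
      have "?h \<in> perm_maps G V (\<lambda>i. (inv\<^bsub>GLV\<^esub> k) (k (f i))) Q"
        using conj[OF h, of "inv\<^bsub>GLV\<^esub> k"] k GL_closed[OF k f] by simp
      moreover have "perm_maps G V (\<lambda>i. (inv\<^bsub>GLV\<^esub> k) (k (f i))) Q = perm_maps G V f Q"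
        unfolding perm_maps_def using GL_inv_apply(1)[OF k f] Q by (auto simp del: atLeastAtMost_iff)
      ultimately have "?h \<in> perm_maps G V f Q" by simp
      moreover have "h = inv\<^bsub>GLV\<^esub> k \<otimes>\<^bsub>GLV\<^esub> ?h \<otimes>\<^bsub>GLV\<^esub> k"
        using k hG by (simp add: GL.m_assoc)
      ultimately show "h \<in> (\<lambda>h. inv\<^bsub>GLV\<^esub> k \<otimes>\<^bsub>GLV\<^esub> h \<otimes>\<^bsub>GLV\<^esub> k) ` perm_maps G V f Q"
        by blast
    qed
  qed
qed

end

section \<open>Short suborbits and point stabilizers\<close>

text \<open>
  Used for the map that sends a point to its stabilizer, whose fibres all have the same size.
\<close>

lemma card_fibres:
  assumes fin: "finite A" and fib: "\<And>y. y \<in> f ` A \<Longrightarrow> card {x \<in> A. f x = y} = c"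
  shows "card {x \<in> A. P (f x)} = c * card {y \<in> f ` A. P y}"
proof -
  have "{x \<in> A. P (f x)} = (\<Union>y\<in>{y \<in> f ` A. P y}. {x \<in> A. f x = y})" by auto
  also have "card \<dots> = (\<Sum>y\<in>{y \<in> f ` A. P y}. card {x \<in> A. f x = y})"
    by (rule card_UN_disjoint) (use fin in auto)
  also have "\<dots> = (\<Sum>y\<in>{y \<in> f ` A. P y}. c)" by (rule sum.cong) (use fib in auto)
  finally show ?thesis by (simp add: mult.commute)
qed

context group_action
begin

lemma group_G: "group G"
  using group_hom by (simp add: group_hom_def)

lemma act_closed: "g \<in> carrier G \<Longrightarrow> x \<in> E \<Longrightarrow> \<phi> g x \<in> E"
  using surj_prop by blast

lemma act_inv: "g \<in> carrier G \<Longrightarrow> x \<in> E \<Longrightarrow> \<phi> (inv g) (\<phi> g x) = x"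
  using orbit_sym_aux by blast

lemma stabilizer_conj:
  assumes g: "g \<in> carrier G" and x: "x \<in> E"
  shows "stabilizer G \<phi> (\<phi> g x) = group.conj_set G g (stabilizer G \<phi> x)"
proof -
  interpret G: group G by (rule group_G)
  show ?thesis
  proof
    show "G.conj_set g (stabilizer G \<phi> x) \<subseteq> stabilizer G \<phi> (\<phi> g x)"
    proof
      fix h assume "h \<in> G.conj_set g (stabilizer G \<phi> x)"
      then obtain s where s: "s \<in> carrier G" "\<phi> s x = x" "h = g \<otimes> s \<otimes> inv g"
        by (auto simp: G.conj_set_def stabilizer_def)
      then show "h \<in> stabilizer G \<phi> (\<phi> g x)"
        using g x by (simp add: stabilizer_def composition_rule act_closed act_inv)
    qed
    show "stabilizer G \<phi> (\<phi> g x) \<subseteq> G.conj_set g (stabilizer G \<phi> x)"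
    proof
      fix h assume "h \<in> stabilizer G \<phi> (\<phi> g x)"
      then have h: "h \<in> carrier G" "\<phi> h (\<phi> g x) = \<phi> g x" by (auto simp: stabilizer_def)
      have "inv g \<otimes> h \<otimes> g \<in> stabilizer G \<phi> x"
        using h g x by (simp add: stabilizer_def composition_rule act_closed act_inv)
      moreover have "h = g \<otimes> (inv g \<otimes> h \<otimes> g) \<otimes> inv g" using h g by (simp add: G.m_assoc)
      ultimately show "h \<in> G.conj_set g (stabilizer G \<phi> x)" unfolding G.conj_set_def by (rule rev_image_eqI)
    qed
  qed
qed

text \<open>
  The orbit-stabilizer theorem for the action of \<open>G\<^sub>\<alpha>\<close>.
\<close>

lemma short_suborbit_iff:
  assumes \<alpha>: "\<alpha> \<in> E" and \<omega>: "\<omega> \<in> E" and fin: "finite (stabilizer G \<phi> \<alpha>)"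
  shows "(\<exists>\<Delta>\<in>orbits (G\<lparr>carrier := stabilizer G \<phi> \<alpha>\<rparr>) E \<phi>. \<omega> \<in> \<Delta> \<and> card \<Delta> \<le> 2)
    \<longleftrightarrow> near (stabilizer G \<phi> \<alpha>) (stabilizer G \<phi> \<omega>)"
proof -
  let ?W = "stabilizer G \<phi> \<alpha>"
  let ?GW = "G\<lparr>carrier := ?W\<rparr>"
  have sub: "subgroup ?W G" by (rule stabilizer_subgroup[OF \<alpha>])
  interpret A: group_action ?GW E \<phi> by (rule induced_action[OF sub])
  have "stabilizer ?GW \<phi> \<omega> = ?W \<inter> stabilizer G \<phi> \<omega>" by (auto simp: stabilizer_def)
  then have os: "card (orbit ?GW \<phi> \<omega>) * card (?W \<inter> stabilizer G \<phi> \<omega>) = card ?W"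
    using A.orbit_stabilizer_theorem[OF \<omega>] by (simp add: order_def)
  have "card ?W > 0" using fin subgroup.one_closed[OF sub] by (auto simp: card_gt_0_iff)
  then have pos: "card (?W \<inter> stabilizer G \<phi> \<omega>) > 0" using os by (metis mult_0_right neq0_conv)
  have "card (orbit ?GW \<phi> \<omega>) \<le> 2 \<longleftrightarrow> near ?W (stabilizer G \<phi> \<omega>)"
    unfolding near_def os[symmetric] using pos by simp
  moreover have "\<Delta> = orbit ?GW \<phi> \<omega>" if \<Delta>: "\<Delta> \<in> orbits ?GW E \<phi>" "\<omega> \<in> \<Delta>" for \<Delta>
  proof -
    obtain x where x: "x \<in> E" "\<Delta> = orbit ?GW \<phi> x" using \<Delta>(1) by (auto simp: orbits_def)
    have E: "orbit ?GW \<phi> y \<subseteq> E" if "y \<in> E" for y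
      using that A.element_image by (auto simp: orbit_def)
    have wx: "\<omega> \<in> orbit ?GW \<phi> x" using \<Delta>(2) x(2) by simp
    have xw: "x \<in> orbit ?GW \<phi> \<omega>" by (rule A.orbit_sym[OF x(1) \<omega> wx])
    have "orbit ?GW \<phi> x \<subseteq> orbit ?GW \<phi> \<omega>"
    proof
      fix y assume y: "y \<in> orbit ?GW \<phi> x"
      then show "y \<in> orbit ?GW \<phi> \<omega>" using A.orbit_trans[OF \<omega> x(1) _ xw y] E[OF x(1)] by blast
    qed
    moreover have "orbit ?GW \<phi> \<omega> \<subseteq> orbit ?GW \<phi> x"
    proof
      fix y assume y: "y \<in> orbit ?GW \<phi> \<omega>"
      then show "y \<in> orbit ?GW \<phi> x" using A.orbit_trans[OF x(1) \<omega> _ wx y] E[OF \<omega>] by blast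
    qed
    ultimately show ?thesis using x(2) by simp
  qed
  moreover have "orbit ?GW \<phi> \<omega> \<in> orbits ?GW E \<phi>" "\<omega> \<in> orbit ?GW \<phi> \<omega>"
    using \<omega> A.orbit_refl[OF \<omega>] by (auto simp: orbits_def)
  ultimately show ?thesis by metis
qed

end

text \<open>
  The length of the suborbit of \<open>\<omega>\<close> depends on the stabilizer of \<open>\<omega>\<close> only, and each stabilizer
  occurs for the same number of points.
\<close>

lemma I_ratio_eq:
  fixes G (structure)
  assumes tr: "transitive_action G \<Omega> \<phi>" and fin: "finite \<Omega>" and \<alpha>: "\<alpha> \<in> \<Omega>"
    and finW: "finite (stabilizer G \<phi> \<alpha>)"
  shows "I_ratio G \<Omega> \<phi> \<alpha> =
    real (card {X \<in> stabilizer G \<phi> ` \<Omega>. near (stabilizer G \<phi> \<alpha>) X}) / real (card (stabilizer G \<phi> ` \<Omega>))"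
proof -
  interpret transitive_action G \<Omega> \<phi> by (rule tr)
  interpret G: group G by (rule group_G)
  let ?s = "stabilizer G \<phi>"
  define c where "c = card {\<omega> \<in> \<Omega>. ?s \<omega> = ?s \<alpha>}"
  have sub: "?s \<omega> \<subseteq> carrier G" for \<omega> by (rule stabilizer_subset)
  have fib: "card {\<omega> \<in> \<Omega>. ?s \<omega> = X} = c" if "X \<in> ?s ` \<Omega>" for X
  proof -
    obtain \<beta> where \<beta>: "\<beta> \<in> \<Omega>" "X = ?s \<beta>" using \<open>X \<in> ?s ` \<Omega>\<close> by auto
    obtain g where g: "g \<in> carrier G" "\<phi> g \<alpha> = \<beta>" using unique_orbit[OF \<alpha> \<beta>(1)] by auto
    have X: "X = G.conj_set g (?s \<alpha>)" using stabilizer_conj[OF g(1) \<alpha>] g(2) \<beta>(2) by simp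
    have bij: "bij_betw (\<phi> g) \<Omega> \<Omega>" using inj_prop[OF g(1)] surj_prop[OF g(1)] by (simp add: bij_betw_def)
    have "?s (\<phi> g \<omega>) = X \<longleftrightarrow> ?s \<omega> = ?s \<alpha>" if "\<omega> \<in> \<Omega>" for \<omega>
      unfolding X stabilizer_conj[OF g(1) that] by (metis G.conj_set_inv[OF g(1) sub])
    from card_filter_bij[where Q = "\<lambda>\<omega>. ?s \<omega> = X" and P = "\<lambda>\<omega>. ?s \<omega> = ?s \<alpha>", OF bij this]
    show ?thesis by (simp only: c_def)
  qed
  have "\<alpha> \<in> {\<omega> \<in> \<Omega>. ?s \<omega> = ?s \<alpha>}" using \<alpha> by simp
  then have c: "c > 0" using fin unfolding c_def by (auto simp: card_gt_0_iff)
  have "I_ratio G \<Omega> \<phi> \<alpha> = real (card {\<omega> \<in> \<Omega>. near (?s \<alpha>) (?s \<omega>)}) / real (card \<Omega>)"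
    unfolding I_ratio_def by (simp only: short_suborbit_iff[OF \<alpha> _ finW] cong: conj_cong)
  also have "card {\<omega> \<in> \<Omega>. near (?s \<alpha>) (?s \<omega>)} = c * card {X \<in> ?s ` \<Omega>. near (?s \<alpha>) X}"
    by (rule card_fibres[OF fin fib])
  also have "card \<Omega> = c * card (?s ` \<Omega>)"
    using card_fibres[OF fin fib, of "\<lambda>_. True"] by (simp only: simp_thms Collect_mem_eq)
  finally show ?thesis using c by simp
qed

lemma finite_group_of_faithful:
  assumes "faithful_action G \<Omega> \<phi>" "finite \<Omega>"
  shows "finite (carrier G)"
proof -
  interpret faithful_action G \<Omega> \<phi> by (rule assms)
  have "Bij \<Omega> \<subseteq> PiE \<Omega> (\<lambda>_. \<Omega>)"
    by (auto simp: Bij_def bij_betw_def PiE_def)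
  then have "finite (Bij \<Omega>)" using finite_PiE[OF assms(2)] assms(2) by (meson finite_subset)
  moreover have "\<phi> ` carrier G \<subseteq> Bij \<Omega>" using bij_prop0 by auto
  ultimately show ?thesis using faithful by (meson finite_imageD finite_subset)
qed

lemma stabilizer_family:
  fixes G (structure)
  assumes P: "finite_transitive_permutation_group G \<Omega> \<phi>" and \<alpha>: "\<alpha> \<in> \<Omega>"
    and I: "I_ratio G \<Omega> \<phi> \<alpha> = 5 / 6"
  shows "\<exists>m. conjugate_family G (stabilizer G \<phi> ` \<Omega>) m"
proof -
  have fin: "finite \<Omega>" and faith: "faithful_action G \<Omega> \<phi>" and tr: "transitive_action G \<Omega> \<phi>"
    using P by (auto simp: finite_transitive_permutation_group_def)
  interpret transitive_action G \<Omega> \<phi> by (rule tr)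
  interpret F: faithful_action G \<Omega> \<phi> by (rule faith)
  interpret G: group G by (rule group_G)
  let ?s = "stabilizer G \<phi>" and ?C = "stabilizer G \<phi> ` \<Omega>"
  have finG: "finite (carrier G)" by (rule finite_group_of_faithful[OF faith fin])
  have sub: "subgroup (?s \<omega>) G" if "\<omega> \<in> \<Omega>" for \<omega> by (rule stabilizer_subgroup[OF that])
  have car: "?s \<omega> \<subseteq> carrier G" for \<omega> by (rule stabilizer_subset)
  have finS: "finite (?s \<omega>)" for \<omega> by (rule finite_subset[OF car finG])
  have closed: "G.conj_set g X \<in> ?C" if g: "g \<in> carrier G" and X: "X \<in> ?C" for g X
  proof -
    obtain x where x: "x \<in> \<Omega>" "X = ?s x" using X by blast
    show ?thesis unfolding x(2) stabilizer_conj[OF g x(1), symmetric] by (rule imageI[OF act_closed[OF g x(1)]])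
  qed
  have trans: "\<exists>g\<in>carrier G. Y = G.conj_set g X" if XY: "X \<in> ?C" "Y \<in> ?C" for X Y
  proof -
    obtain x y where xy: "x \<in> \<Omega>" "y \<in> \<Omega>" "X = ?s x" "Y = ?s y" using XY by auto
    obtain g where "g \<in> carrier G" "\<phi> g x = y" using unique_orbit[OF xy(1,2)] by auto
    then show ?thesis using stabilizer_conj[of g x] xy by auto
  qed
  have finC: "finite ?C" using fin by simp
  define m where "m = card {X \<in> ?C. \<not> near (?s \<alpha>) X}"
  have "card ?C = card {X \<in> ?C. near (?s \<alpha>) X} + m"
  proof -
    have "?C = {X \<in> ?C. near (?s \<alpha>) X} \<union> {X \<in> ?C. \<not> near (?s \<alpha>) X}" by auto
    moreover have "card ({X \<in> ?C. near (?s \<alpha>) X} \<union> {X \<in> ?C. \<not> near (?s \<alpha>) X})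
        = card {X \<in> ?C. near (?s \<alpha>) X} + m"
      unfolding m_def by (rule card_Un_disjoint) (use finC in auto)
    ultimately show ?thesis by simp
  qed
  moreover have "real (card {X \<in> ?C. near (?s \<alpha>) X}) / real (card ?C) = 5 / 6"
    using I_ratio_eq[OF tr fin \<alpha> finS] I by simp
  moreover have pos: "card ?C > 0" using \<alpha> finC by (auto simp: card_gt_0_iff)
  ultimately have "real (card ?C) = 6 * real m" by (simp add: field_simps)
  then have card6: "card ?C = 6 * m" by linarith
  have far: "card {Y \<in> ?C. \<not> near X Y} = m" if X: "X \<in> ?C" for X
  proof -
    have "?s \<alpha> \<in> ?C" using \<alpha> by simp
    then obtain g where g: "g \<in> carrier G" "X = G.conj_set g (?s \<alpha>)" using trans X by blast
    have Csub: "Y \<subseteq> carrier G" if "Y \<in> ?C" for Y using that car by auto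
    have near: "near X (G.conj_set g Y) \<longleftrightarrow> near (?s \<alpha>) Y" if "Y \<in> ?C" for Y
    proof -
      have "card (X \<inter> G.conj_set g Y) = card (?s \<alpha> \<inter> Y)"
        unfolding g(2) G.conj_set_Int[OF g(1) car Csub[OF that], symmetric]
        by (rule G.card_conj_set[OF g(1)]) (use car in blast)
      moreover have "card X = card (?s \<alpha>)" unfolding g(2) by (rule G.card_conj_set[OF g(1) car])
      ultimately show ?thesis by (simp add: near_def)
    qed
    have bij: "bij_betw (G.conj_set g) ?C ?C"
    proof (rule bij_betw_byWitness[of _ "G.conj_set (inv g)"])
      show "\<forall>Y\<in>?C. G.conj_set (inv g) (G.conj_set g Y) = Y" using G.conj_set_inv[OF g(1) Csub] by blast
      show "\<forall>Y\<in>?C. G.conj_set g (G.conj_set (inv g) Y) = Y" using G.conj_set_inv'[OF g(1) Csub] by blast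
      show "G.conj_set g ` ?C \<subseteq> ?C" by (rule image_subsetI) (rule closed[OF g(1)])
      show "G.conj_set (inv g) ` ?C \<subseteq> ?C" by (rule image_subsetI) (rule closed[OF G.inv_closed[OF g(1)]])
    qed
    show ?thesis
      unfolding m_def by (rule card_filter_bij[OF bij]) (simp only: near)
  qed
  have core: "\<Inter>?C = {\<one>\<^bsub>G\<^esub>}"
  proof
    show "{\<one>\<^bsub>G\<^esub>} \<subseteq> \<Inter>?C" using subgroup.one_closed[OF sub] by auto
    show "\<Inter>?C \<subseteq> {\<one>\<^bsub>G\<^esub>}"
    proof
      fix g assume "g \<in> \<Inter>?C"
      then have g: "g \<in> carrier G" "\<And>\<omega>. \<omega> \<in> \<Omega> \<Longrightarrow> \<phi> g \<omega> = \<omega>"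
        using \<alpha> by (auto simp: stabilizer_def)
      have "\<phi> g \<omega> = \<phi> \<one>\<^bsub>G\<^esub> \<omega>" for \<omega>
      proof (cases "\<omega> \<in> \<Omega>")
        case True
        then show ?thesis using g(2) id_eq_one by (metis restrict_apply')
      next
        case False
        then show ?thesis using bij_prop0[OF g(1)] bij_prop0[OF G.one_closed]
          by (auto simp: Bij_def extensional_def)
      qed
      then have "g = \<one>\<^bsub>G\<^esub>" using inj_onD[OF F.faithful _ g(1) G.one_closed] by blast
      then show "g \<in> {\<one>\<^bsub>G\<^esub>}" by simp
    qed
  qed
  have "conjugate_family G ?C m"
  proof (intro conjugate_family.intro conjugate_family_axioms.intro)
    show "group G" by (rule group_G)
    show "subgroup X G" if "X \<in> ?C" for X using that sub by auto
    show "finite X" if "X \<in> ?C" for X using that finS by auto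
    show "?C \<noteq> {}" using \<alpha> by auto
  qed (fact finC closed trans core card6 far)+
  then show ?thesis by blast
qed

section \<open>Coordinate planes\<close>

lemma card_bit: "CARD(bit) = 2"
proof -
  have "(UNIV :: bit set) = {0, 1}"
  proof (intro equalityI subsetI)
    fix x :: bit show "x \<in> {0, 1}" by (cases x) simp_all
  qed simp
  moreover have "card {0, 1 :: bit} = 2" by simp
  ultimately show ?thesis by (simp only:)
qed

text \<open>
  For \<open>T = {i, j}\<close> this is the plane spanned by \<open>f i\<close> and \<open>f j\<close>; the products with \<open>i = j\<close> only
  contribute the identity. The form is chosen to make images under homomorphisms immediate.
\<close>

definition coord_plane :: "('a, 'm) monoid_scheme \<Rightarrow> (nat \<Rightarrow> 'a) \<Rightarrow> nat set \<Rightarrow> 'a set" where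
  "coord_plane G f T = insert \<one>\<^bsub>G\<^esub> (f ` T \<union> {f i \<otimes>\<^bsub>G\<^esub> f j | i j. i \<in> T \<and> j \<in> T})"

text \<open>
  The eight factors on the right are sorted with the commutation relations; the \<open>i\<close>-th pair is then
  contracted by \<open>f i \<otimes> f i = \<one>\<close>.
\<close>

lemma (in group) comb_mult:
  fixes f :: "4 \<Rightarrow> 'a"
  assumes car: "\<And>i. f i \<in> carrier G" and comm: "\<And>i j. f i \<otimes> f j = f j \<otimes> f i" and sq: "\<And>i. f i \<otimes> f i = \<one>"
  shows "F2_comb G f (x + y) = F2_comb G f x \<otimes> F2_comb G f y"
proof -
  define p where "p i = F2_smult G (x $ i) (f i)" for i
  define q where "q i = F2_smult G (y $ i) (f i)" for i
  have pq: "p i \<in> carrier G" "q i \<in> carrier G" for i using car by (simp_all add: p_def q_def F2_smult_def)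
  have s: "F2_smult G (x $ i + y $ i) (f i) = p i \<otimes> q i" for i
    using car sq by (cases "x $ i"; cases "y $ i") (simp_all add: p_def q_def F2_smult_def)
  have c: "p i \<otimes> q j = q j \<otimes> p i" for i j
    using car comm[of i j] by (simp add: p_def q_def F2_smult_def)
  have lc: "p i \<otimes> (q j \<otimes> z) = q j \<otimes> (p i \<otimes> z)" if "z \<in> carrier G" for i j z
    using c[of i j] pq that by (metis m_assoc)
  show ?thesis
    unfolding F2_comb_def vector_add_component s p_def[symmetric] q_def[symmetric]
    by (simp add: m_assoc pq lc[of _ 4 1] lc[of _ 4 2] lc[of _ 4 3] lc[of _ 3 1] lc[of _ 3 2] lc[of _ 2 1]
        c[of 4 1] c[of 4 2] c[of 4 3] c[of 3 1] c[of 3 2] c[of 2 1])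
qed

lemma (in group) comb_range_subgroup:
  fixes f :: "4 \<Rightarrow> 'a"
  assumes car: "\<And>i. f i \<in> carrier G" and comm: "\<And>i j. f i \<otimes> f j = f j \<otimes> f i" and sq: "\<And>i. f i \<otimes> f i = \<one>"
  shows "binary_space G (range (F2_comb G f))"
proof -
  have add: "F2_comb G f (x + y) = F2_comb G f x \<otimes> F2_comb G f y" for x y
    by (rule comb_mult[OF assms])
  have 0: "F2_comb G f 0 = \<one>" by (simp add: F2_comb_def F2_smult_def)
  have dbl: "x + x = 0" for x :: "bit^4"
    unfolding vec_eq_iff vector_add_component zero_index by (simp only: bit_double simp_thms)
  have fin: "finite (UNIV :: (bit^4) set)"
    by (rule card_ge_0_finite) (simp add: card_bit)
  have "subgroup (range (F2_comb G f)) G"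
  proof (rule subgroup_finiteI)
    show "finite (range (F2_comb G f))" using fin by simp
    show "range (F2_comb G f) \<subseteq> carrier G" using car by (auto simp: F2_comb_def F2_smult_def)
    show "\<one> \<in> range (F2_comb G f)" using 0 by (metis rangeI)
    show "u \<otimes> v \<in> range (F2_comb G f)" if "u \<in> range (F2_comb G f)" "v \<in> range (F2_comb G f)" for u v
    proof -
      from that obtain x y where "u = F2_comb G f x" "v = F2_comb G f y" by blast
      then show ?thesis using add[of x y] by (metis rangeI)
    qed
  qed
  moreover have "u \<otimes> v = v \<otimes> u" if "u \<in> range (F2_comb G f)" "v \<in> range (F2_comb G f)" for u v
  proof -
    from that obtain x y where "u = F2_comb G f x" "v = F2_comb G f y" by blast
    then show ?thesis using add[of x y] add[of y x] by (simp add: add.commute)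
  qed
  moreover have "v \<otimes> v = \<one>" if "v \<in> range (F2_comb G f)" for v
  proof -
    from that obtain x where "v = F2_comb G f x" by blast
    then show ?thesis using add[of x x] 0 dbl[of x] by simp
  qed
  ultimately show ?thesis
    by (intro binary_space.intro binary_space_axioms.intro) (rule is_group, blast+)
qed

lemma elementary_abelian_iff:
  assumes "group G" "subgroup V G"
  shows "elementary_abelian_2_group (G\<lparr>carrier := V\<rparr>) \<longleftrightarrow> binary_space G V"
proof -
  interpret G: group G by (rule assms)
  interpret VG: group "G\<lparr>carrier := V\<rparr>" by (rule G.subgroup_imp_group[OF assms(2)])
  have car: "v \<in> carrier G" if "v \<in> V" for v using subgroup.mem_carrier[OF assms(2) that] .
  have "comm_group (G\<lparr>carrier := V\<rparr>) \<longleftrightarrow> (\<forall>u\<in>V. \<forall>v\<in>V. u \<otimes>\<^bsub>G\<^esub> v = v \<otimes>\<^bsub>G\<^esub> u)"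
  proof
    assume "comm_group (G\<lparr>carrier := V\<rparr>)"
    then interpret comm_group "G\<lparr>carrier := V\<rparr>" .
    show "\<forall>u\<in>V. \<forall>v\<in>V. u \<otimes>\<^bsub>G\<^esub> v = v \<otimes>\<^bsub>G\<^esub> u" using m_comm by simp
  next
    assume "\<forall>u\<in>V. \<forall>v\<in>V. u \<otimes>\<^bsub>G\<^esub> v = v \<otimes>\<^bsub>G\<^esub> u"
    then show "comm_group (G\<lparr>carrier := V\<rparr>)" by (intro VG.group_comm_groupI) simp
  qed
  moreover have "v [^]\<^bsub>G\<lparr>carrier := V\<rparr>\<^esub> (2::nat) = v \<otimes>\<^bsub>G\<^esub> v" if "v \<in> V" for v
    using that car by (simp add: numeral_2_eq_2)
  ultimately show ?thesis
    using assms by (auto simp: elementary_abelian_2_group_def binary_space_def binary_space_axioms_def)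
qed

context binary_space
begin

lemma comb_range_binary:
  assumes "range e \<subseteq> V"
  shows "subgroup (range (F2_comb G e)) G"
proof -
  have "e j \<in> V" for j using assms by auto
  then have "binary_space G (range (F2_comb G e))"
    using V_car V_comm V_sq by (intro comb_range_subgroup) auto
  then show ?thesis by (rule binary_space.V_subgroup)
qed

lemma basis_in_range: "range e \<subseteq> V \<Longrightarrow> e j \<in> range (F2_comb G e)"
  using basis_axis[of e j] by (metis rangeI)

lemma card_V:
  assumes "F2_basis G V e"
  shows "card V = 16"
proof -
  have "V = range (F2_comb G e)" using F2_basisD(2)[OF assms] comb_closed[OF F2_basisD(1)[OF assms]] by blast
  moreover have "inj (F2_comb G e)" using F2_basisD(3)[OF assms] by (rule injI)
  ultimately show ?thesis by (simp add: card_image card_bit)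
qed

lemma spanning_basis:
  assumes e: "range e \<subseteq> V" and span: "V \<subseteq> range (F2_comb G e)" and card: "card V = 16"
  shows "F2_basis G V e"
proof -
  have fin: "finite (UNIV :: (bit^4) set)"
    by (rule card_ge_0_finite) (simp add: card_bit)
  have "V = range (F2_comb G e)" using span comb_closed[OF e] by blast
  then have inj: "inj (F2_comb G e)"
    using card by (intro eq_card_imp_inj_on[OF fin]) (simp add: card_bit)
  show ?thesis
  proof (rule F2_basisI[OF e])
    show "\<exists>x. v = F2_comb G e x" if "v \<in> V" for v using that span by blast
    show "x = 0" if "F2_comb G e x = \<one>" for x using that injD[OF inj, of x 0] comb_0 by simp
  qed
qed

lemma permuted_basis:
  assumes f: "F2_basis G V (f \<circ> nat_index)" and \<sigma>: "\<sigma> permutes {1..4}"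
  shows "F2_basis G V ((f \<circ> \<sigma>) \<circ> nat_index)"
proof (rule spanning_basis)
  have fV: "f i \<in> V" if i: "i \<in> {1..4}" for i
  proof -
    obtain j where "i = nat_index j" by (rule nat_index_surj[OF i])
    then show ?thesis using F2_basisD(1)[OF f] by auto
  qed
  show range: "range ((f \<circ> \<sigma>) \<circ> nat_index) \<subseteq> V"
  proof
    fix v assume "v \<in> range ((f \<circ> \<sigma>) \<circ> nat_index)"
    then obtain j where "v = f (\<sigma> (nat_index j))" by auto
    then show "v \<in> V" using fV permutes_in_image[OF \<sigma>] nat_index_range by metis
  qed
  let ?R = "range (F2_comb G ((f \<circ> \<sigma>) \<circ> nat_index))"
  have sg: "subgroup ?R G" by (rule comb_range_binary[OF range])
  have in_R: "f (\<sigma> i) \<in> ?R" if i: "i \<in> {1..4}" for i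
  proof -
    obtain j where "i = nat_index j" by (rule nat_index_surj[OF i])
    then show ?thesis using basis_in_range[OF range, of j] by simp
  qed
  have f_R: "f i \<in> ?R" if i: "i \<in> {1..4}" for i
    using in_R[of "inv' \<sigma> i"] i permutes_in_image[OF permutes_inv[OF \<sigma>]] permutes_inverses(1)[OF \<sigma>] by metis
  have sm: "F2_smult G c (f i) \<in> ?R" if "i \<in> {1..4}" for c i
    using f_R[OF that] subgroup.one_closed[OF sg] by (simp add: F2_smult_def)
  show "V \<subseteq> ?R"
  proof
    fix v assume "v \<in> V"
    then obtain x where x: "v = F2_comb G (f \<circ> nat_index) x" using F2_basisD(2)[OF f] by blast
    show "v \<in> ?R"
      unfolding x comb_ix[of f x] by (intro subgroup.m_closed[OF sg] sm) simp_all
  qed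
  show "card V = 16" by (rule card_V[OF f])
qed

lemma GL_basis:
  assumes k: "k \<in> carrier (GL_group G V)" and e: "F2_basis G V e"
  shows "F2_basis G V (\<lambda>j. k (e j))"
proof (rule F2_basisI)
  note eV = F2_basisD(1)[OF e]
  show "range (\<lambda>j. k (e j)) \<subseteq> V" using GL_closed[OF k] eV by auto
  show "\<exists>x. v = F2_comb G (\<lambda>j. k (e j)) x" if v: "v \<in> V" for v
  proof -
    have "(inv\<^bsub>GL_group G V\<^esub> k) v \<in> V"
      by (rule GL_closed[OF group.inv_closed[OF group_GL k] v])
    then obtain x where "(inv\<^bsub>GL_group G V\<^esub> k) v = F2_comb G e x" using F2_basisD(2)[OF e] by blast
    then show ?thesis using GL_inv_apply(2)[OF k v] GL_comb[OF k eV, of x] by metis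
  qed
  show "x = 0" if "F2_comb G (\<lambda>j. k (e j)) x = \<one>" for x
  proof -
    have "k (F2_comb G e x) = k \<one>" using that GL_comb[OF k eV] GL_one[OF k] by simp
    then have "F2_comb G e x = \<one>"
      using GL_inv_apply(1)[OF k comb_closed[OF eV]] GL_inv_apply(1)[OF k V_one] by metis
    then have "F2_comb G e x = F2_comb G e 0" by (simp only: comb_0)
    then show "x = 0" by (rule F2_basisD(3)[OF e])
  qed
qed

lemma frame_mem:
  assumes "F2_basis G V (f \<circ> nat_index)" "i \<in> {1..4}"
  shows "f i \<in> V"
proof -
  obtain j where "i = nat_index j" by (rule nat_index_surj[OF assms(2)])
  then show ?thesis using F2_basisD(1)[OF assms(1)] by auto
qed

text \<open>
  These elements have distinct coordinate vectors.
\<close>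

lemma frame_distinct:
  assumes f: "F2_basis G V (f \<circ> nat_index)"
  shows "distinct [\<one>, f 1, f 2, f 3, f 4, f 1 \<otimes> f 2, f 1 \<otimes> f 3, f 1 \<otimes> f 4, f 2 \<otimes> f 3, f 2 \<otimes> f 4, f 3 \<otimes> f 4]"
proof -
  define vs :: "(bit^4) list" where
    "vs = [0, vector [1, 0, 0, 0], vector [0, 1, 0, 0], vector [0, 0, 1, 0], vector [0, 0, 0, 1],
      vector [1, 1, 0, 0], vector [1, 0, 1, 0], vector [1, 0, 0, 1],
      vector [0, 1, 1, 0], vector [0, 1, 0, 1], vector [0, 0, 1, 1]]"
  have car: "f 1 \<in> carrier G" "f 2 \<in> carrier G" "f 3 \<in> carrier G" "f 4 \<in> carrier G"
    using frame_mem[OF f] V_car by simp_all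
  have "inj (F2_comb G (f \<circ> nat_index))" using F2_basisD(3)[OF f] by (rule injI)
  moreover have "distinct vs"
    unfolding vs_def vec_eq_iff distinct.simps list.set by (simp add: vec_eq_iff forall_4)
  ultimately have "distinct (map (F2_comb G (f \<circ> nat_index)) vs)"
    by (simp only: distinct_map) (blast intro: inj_on_subset)
  moreover have "map (F2_comb G (f \<circ> nat_index)) vs = [\<one>, f 1, f 2, f 3, f 4, f 1 \<otimes> f 2, f 1 \<otimes> f 3, f 1 \<otimes> f 4, f 2 \<otimes> f 3, f 2 \<otimes> f 4, f 3 \<otimes> f 4]"
    unfolding vs_def using car by (simp add: comb_0 comb_ix F2_smult_def)
  ultimately show ?thesis by (simp only:)
qed

lemma coord_plane_pair:
  assumes "f i \<in> V" "f j \<in> V"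
  shows "coord_plane G f {i, j} = {\<one>, f i, f j, f i \<otimes> f j}"
proof -
  have "{f a \<otimes> f b | a b. a \<in> {i, j} \<and> b \<in> {i, j}} = {f i \<otimes> f i, f i \<otimes> f j, f j \<otimes> f i, f j \<otimes> f j}"
    by blast
  also have "\<dots> = {\<one>, f i \<otimes> f j}" using V_comm[OF assms] V_sq[OF assms(1)] V_sq[OF assms(2)] by auto
  finally show ?thesis unfolding coord_plane_def by auto
qed

lemma coord_plane_list:
  assumes f: "F2_basis G V (f \<circ> nat_index)"
  shows "coord_plane G f {1, 2} = {\<one>, f 1, f 2, f 1 \<otimes> f 2}" "coord_plane G f {1, 3} = {\<one>, f 1, f 3, f 1 \<otimes> f 3}"
    "coord_plane G f {1, 4} = {\<one>, f 1, f 4, f 1 \<otimes> f 4}" "coord_plane G f {2, 3} = {\<one>, f 2, f 3, f 2 \<otimes> f 3}"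
    "coord_plane G f {2, 4} = {\<one>, f 2, f 4, f 2 \<otimes> f 4}" "coord_plane G f {3, 4} = {\<one>, f 3, f 4, f 3 \<otimes> f 4}"
  using frame_mem[OF f] by (simp_all add: coord_plane_pair)

lemma coord_plane_card:
  assumes f: "F2_basis G V (f \<circ> nat_index)" and S: "S \<in> pairs"
  shows "card (coord_plane G f S) = 4"
proof -
  have "S = {1, 2} \<or> S = {1, 3} \<or> S = {1, 4} \<or> S = {2, 3} \<or> S = {2, 4} \<or> S = {3, 4}"
    using S by (simp add: pairs_eq)
  then show ?thesis
    using frame_distinct[OF f] by (elim disjE) (simp_all add: coord_plane_list[OF f] del: One_nat_def)
qed

lemma coord_plane_support:
  assumes f: "F2_basis G V (f \<circ> nat_index)" and S: "S \<subseteq> {1..4}" and y: "y \<in> coord_plane G f S"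
  shows "\<exists>x. y = F2_comb G (f \<circ> nat_index) x \<and> (\<forall>j. nat_index j \<notin> S \<longrightarrow> x $ j = 0)"
proof -
  note fV = F2_basisD(1)[OF f]
  have one: "\<exists>x. f i = F2_comb G (f \<circ> nat_index) x \<and> (\<forall>j. nat_index j \<notin> S \<longrightarrow> x $ j = 0)" if i: "i \<in> S" for i
  proof -
    have "i \<in> {1..4}" using i S by blast
    then obtain j where j: "i = nat_index j" by (rule nat_index_surj)
    have "f i = F2_comb G (f \<circ> nat_index) (axis j 1)" using basis_axis[OF fV, of j] j by simp
    moreover have "\<forall>l. nat_index l \<notin> S \<longrightarrow> axis j (1::bit) $ l = 0" using i j by (auto simp: axis_def)
    ultimately show ?thesis by blast
  qed
  have "y = \<one> \<or> (\<exists>i\<in>S. y = f i) \<or> (\<exists>i\<in>S. \<exists>j\<in>S. y = f i \<otimes> f j)"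
    using y unfolding coord_plane_def by blast
  then show ?thesis
  proof (elim disjE bexE)
    assume "y = \<one>"
    then show ?thesis by (intro exI[of _ 0]) (simp add: comb_0)
  next
    fix i assume "i \<in> S" "y = f i"
    then show ?thesis using one by simp
  next
    fix i j assume i: "i \<in> S" and j: "j \<in> S" and y: "y = f i \<otimes> f j"
    obtain u where u: "f i = F2_comb G (f \<circ> nat_index) u" "\<forall>j. nat_index j \<notin> S \<longrightarrow> u $ j = 0" using one[OF i] by blast
    obtain v where v: "f j = F2_comb G (f \<circ> nat_index) v" "\<forall>j. nat_index j \<notin> S \<longrightarrow> v $ j = 0" using one[OF j] by blast
    have "y = F2_comb G (f \<circ> nat_index) (u + v)" unfolding y u(1) v(1) comb_add[OF fV] ..
    moreover have "\<forall>j. nat_index j \<notin> S \<longrightarrow> (u + v) $ j = 0" using u(2) v(2) by simp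
    ultimately show ?thesis by blast
  qed
qed

text \<open>
  The coordinate vector of \<open>y\<close> is supported on \<open>S \<inter> T\<close>, which has at most one element.
\<close>

lemma coord_plane_Int:
  assumes f: "F2_basis G V (f \<circ> nat_index)" and S: "S \<in> pairs" and T: "T \<in> pairs" and ne: "S \<noteq> T"
    and y: "y \<in> coord_plane G f S" "y \<in> coord_plane G f T" "y \<noteq> \<one>"
  shows "\<exists>j\<in>S \<inter> T. y = f j"
proof -
  note fV = F2_basisD(1)[OF f]
  have ST: "S \<subseteq> {1..4}" "T \<subseteq> {1..4}" "card S = 2" "card T = 2" using S T by (auto simp: pairs_def)
  obtain x where x: "y = F2_comb G (f \<circ> nat_index) x" "\<forall>j. nat_index j \<notin> S \<longrightarrow> x $ j = 0"
    using coord_plane_support[OF f ST(1) y(1)] by blast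
  obtain x' where x': "y = F2_comb G (f \<circ> nat_index) x'" "\<forall>j. nat_index j \<notin> T \<longrightarrow> x' $ j = 0"
    using coord_plane_support[OF f ST(2) y(2)] by blast
  have "x' = x" using F2_basisD(3)[OF f] x(1) x'(1) by metis
  then have supp: "nat_index j \<in> S \<inter> T" if "x $ j \<noteq> 0" for j using x(2) x'(2) that by blast
  have "x \<noteq> 0" using x(1) y(3) comb_0 by metis
  then obtain j where j: "x $ j \<noteq> 0" unfolding vec_eq_iff zero_index by blast
  have "x $ l = axis j 1 $ l" for l
  proof (cases "x $ l = 0")
    case True
    then show ?thesis using j by (auto simp: axis_def)
  next
    case False
    have "card (S \<inter> T) \<le> Suc 0"
    proof (rule ccontr)
      assume "\<not> ?thesis"
      moreover have fin: "finite S" "finite T" using ST finite_subset by blast+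
      moreover have "card (S \<inter> T) \<le> 2" using card_mono[of S "S \<inter> T"] fin ST(3) by simp
      ultimately have "card (S \<inter> T) = card S" "card (S \<inter> T) = card T" using ST by simp_all
      then have "S \<inter> T = S" "S \<inter> T = T" using fin by (simp_all add: card_subset_eq)
      then show False using ne by simp
    qed
    moreover have "finite (S \<inter> T)" using ST finite_subset by blast
    ultimately have "nat_index l = nat_index j" using supp[OF False] supp[OF j] by (metis card_le_Suc0_iff_eq)
    then have "l = j" by (rule nat_index_inj)
    then show ?thesis using False by (simp add: axis_def)
  qed
  then have "x = axis j 1" unfolding vec_eq_iff by blast
  then have "y = f (nat_index j)" using x(1) basis_axis[OF fV, of j] by simp
  then show ?thesis using supp[OF j] by blast
qed

lemma frame_neq:
  assumes f: "F2_basis G V (f \<circ> nat_index)" and i: "i \<in> {1..4}" and j: "j \<in> {1..4}"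
  shows "f i \<noteq> \<one>" "f i = f j \<Longrightarrow> i = j"
  using i j frame_distinct[OF f] unfolding interval_4 by auto

lemma coord_plane_inj:
  assumes f: "F2_basis G V (f \<circ> nat_index)" and S: "S \<in> pairs" and T: "T \<in> pairs" and eq: "coord_plane G f S = coord_plane G f T"
  shows "S = T"
proof (rule ccontr)
  assume ne: "S \<noteq> T"
  note d = frame_neq[OF f]
  have "S \<subseteq> T"
  proof
    fix i assume i: "i \<in> S"
    have S4: "S \<subseteq> {1..4}" using S by (simp add: pairs_def)
    have "f i \<in> coord_plane G f S" using i by (simp add: coord_plane_def)
    then obtain j where "j \<in> S \<inter> T" "f i = f j"
      using coord_plane_Int[OF f S T ne, of "f i"] eq d(1)[of i i] i S4 by blast
    then show "i \<in> T" using d(2)[of i j] i S4 by blast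
  qed
  moreover have "card S = card T" "finite T" using S T by (auto simp: pairs_def intro: finite_subset)
  ultimately show False using ne card_subset_eq by metis
qed

lemma near_coord_plane:
  assumes f: "F2_basis G V (f \<circ> nat_index)" and S: "S \<in> pairs" and T: "T \<in> pairs"
  shows "near (coord_plane G f S) (coord_plane G f T) \<longleftrightarrow> S \<inter> T \<noteq> {}"
proof (cases "S = T")
  case True
  then show ?thesis using S by (auto simp: near_def pairs_def)
next
  case ne: False
  have fin: "finite (coord_plane G f S)" by (rule card_ge_0_finite) (simp add: coord_plane_card[OF f S])
  have "card (coord_plane G f S \<inter> coord_plane G f T) \<ge> 2" if i: "i \<in> S" "i \<in> T" for i
  proof -
    have "i \<in> {1..4}" using i S by (auto simp: pairs_def)
    then have "\<one> \<noteq> f i" using frame_distinct[OF f] unfolding interval_4 by auto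
    then have "card {\<one>, f i} = 2" by simp
    moreover have "{\<one>, f i} \<subseteq> coord_plane G f S \<inter> coord_plane G f T" using i by (simp add: coord_plane_def)
    ultimately show ?thesis using card_mono[of "coord_plane G f S \<inter> coord_plane G f T" "{\<one>, f i}"] fin by simp
  qed
  moreover have "card (coord_plane G f S \<inter> coord_plane G f T) \<le> 1" if "S \<inter> T = {}"
  proof -
    have "coord_plane G f S \<inter> coord_plane G f T \<subseteq> {\<one>}" using coord_plane_Int[OF f S T ne] that by blast
    then show ?thesis using card_mono[of "{\<one>}"] by fastforce
  qed
  ultimately show ?thesis unfolding near_def coord_plane_card[OF f S] by fastforce
qed

lemma coord_plane_image:
  assumes k: "\<And>u v. u \<in> V \<Longrightarrow> v \<in> V \<Longrightarrow> k (u \<otimes> v) = k u \<otimes> k v" "k \<one> = \<one>"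
    and f: "\<And>i. i \<in> T \<Longrightarrow> f i \<in> V"
  shows "k ` coord_plane G f T = coord_plane G (\<lambda>i. k (f i)) T"
proof -
  have "k ` {f i \<otimes> f j | i j. i \<in> T \<and> j \<in> T} = {k (f i) \<otimes> k (f j) | i j. i \<in> T \<and> j \<in> T}"
  proof (intro equalityI subsetI)
    fix y assume "y \<in> k ` {f i \<otimes> f j | i j. i \<in> T \<and> j \<in> T}"
    then obtain i j where "i \<in> T" "j \<in> T" "y = k (f i \<otimes> f j)" by blast
    then show "y \<in> {k (f i) \<otimes> k (f j) | i j. i \<in> T \<and> j \<in> T}" using k(1) f by blast
  next
    fix y assume "y \<in> {k (f i) \<otimes> k (f j) | i j. i \<in> T \<and> j \<in> T}"
    then obtain i j where "i \<in> T" "j \<in> T" "y = k (f i) \<otimes> k (f j)" by blast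
    then have "y = k (f i \<otimes> f j)" using k(1) f by simp
    then show "y \<in> k ` {f i \<otimes> f j | i j. i \<in> T \<and> j \<in> T}" using \<open>i \<in> T\<close> \<open>j \<in> T\<close> by blast
  qed
  then show ?thesis unfolding coord_plane_def image_insert image_Un image_image k(2) by simp
qed

lemma coord_plane_reindex:
  assumes "\<And>i. i \<in> T \<Longrightarrow> h i = f (\<sigma> i)"
  shows "coord_plane G h T = coord_plane G f (\<sigma> ` T)"
proof -
  have "{h i \<otimes> h j | i j. i \<in> T \<and> j \<in> T} = {f i \<otimes> f j | i j. i \<in> \<sigma> ` T \<and> j \<in> \<sigma> ` T}"
  proof (intro equalityI subsetI)
    fix y assume "y \<in> {h i \<otimes> h j | i j. i \<in> T \<and> j \<in> T}"
    then obtain i j where "i \<in> T" "j \<in> T" "y = h i \<otimes> h j" by blast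
    then have "y = f (\<sigma> i) \<otimes> f (\<sigma> j)" using assms by simp
    then show "y \<in> {f i \<otimes> f j | i j. i \<in> \<sigma> ` T \<and> j \<in> \<sigma> ` T}" using \<open>i \<in> T\<close> \<open>j \<in> T\<close> by blast
  next
    fix y assume "y \<in> {f i \<otimes> f j | i j. i \<in> \<sigma> ` T \<and> j \<in> \<sigma> ` T}"
    then obtain i j where "i \<in> T" "j \<in> T" "y = f (\<sigma> i) \<otimes> f (\<sigma> j)" by blast
    then show "y \<in> {h i \<otimes> h j | i j. i \<in> T \<and> j \<in> T}"
      unfolding assms[OF \<open>i \<in> T\<close>, symmetric] assms[OF \<open>j \<in> T\<close>, symmetric] by blast
  qed
  moreover have "h ` T = f ` \<sigma> ` T" using assms by (simp add: image_image cong: image_cong_simp)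
  ultimately show ?thesis by (simp add: coord_plane_def)
qed

lemma generate_two:
  assumes u: "u \<in> V" and v: "v \<in> V"
  shows "generate G {u, v} = {\<one>, u, v, u \<otimes> v}"
proof
  have car: "u \<in> carrier G" "v \<in> carrier G" using u v V_car by auto
  have vu: "v \<otimes> u = u \<otimes> v" by (rule V_comm[OF v u])
  have uv: "u \<otimes> (u \<otimes> v) = v" "v \<otimes> (u \<otimes> v) = u" "u \<otimes> v \<otimes> u = v" "u \<otimes> v \<otimes> v = u" "u \<otimes> v \<otimes> (u \<otimes> v) = \<one>"
    using V_sq[OF u] V_sq[OF v] V_sq[OF V_mult[OF u v]] car vu
    by (metis m_assoc l_one r_one, metis m_assoc l_one r_one, metis m_assoc l_one r_one, metis m_assoc l_one r_one, simp)
  have "subgroup {\<one>, u, v, u \<otimes> v} G"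
  proof (rule subgroup_finiteI)
    show "x \<otimes> y \<in> {\<one>, u, v, u \<otimes> v}" if "x \<in> {\<one>, u, v, u \<otimes> v}" "y \<in> {\<one>, u, v, u \<otimes> v}" for x y
      using that uv vu V_sq[OF u] V_sq[OF v] car by auto
  qed (use car in auto)
  then show "generate G {u, v} \<subseteq> {\<one>, u, v, u \<otimes> v}" by (rule generate_subgroup_incl[rotated]) simp
  have "u \<in> generate G {u, v}" "v \<in> generate G {u, v}" by (auto intro: generate.incl)
  then show "{\<one>, u, v, u \<otimes> v} \<subseteq> generate G {u, v}" by (auto intro: generate.one generate.eng)
qed

text \<open>
  Both \<open>e\<^sub>1, e\<^sub>2\<close> and the first two vectors \<open>e\<^sub>2, e\<^sub>1 + e\<^sub>2\<close> of the frame span the same plane.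
  Therefore the change of basis from a coordinate plane \<open>W\<close> lies in the stabilizer \<open>K\<close> of \<open>W\<close>.
\<close>

lemma generate_frame:
  assumes "range e \<subseteq> V"
  shows "generate G {e 1, e 2} = coord_plane G (frame G e) {1, 2}"
proof -
  have e: "e 1 \<in> V" "e 2 \<in> V" using assms by auto
  have "e 2 \<otimes> (e 1 \<otimes> e 2) = e 1"
    using e V_sq V_comm V_left_comm V_car by simp
  moreover have "coord_plane G (frame G e) {1, 2} = {\<one>, e 2, e 1 \<otimes> e 2, e 2 \<otimes> (e 1 \<otimes> e 2)}"
    unfolding coord_plane_pair[OF comb_closed[OF assms] comb_closed[OF assms]] frame_generates[OF assms] ..
  ultimately show ?thesis unfolding generate_two[OF e] by auto
qed

end

section \<open>Conjugation on the coordinate planes\<close>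

text \<open>
  Elements of one coset of the centralizer induce the same map, so the quotient disappears.
\<close>

lemma (in group) conj_quotient_eq:
  assumes V: "V \<subseteq> carrier G"
  shows "conj_quotient G V = conj_map G V ` carrier G"
proof -
  let ?Z = "centralizer G V"
  have single: "the_elem (conj_map G V ` (?Z #> g)) = conj_map G V g" if g: "g \<in> carrier G" for g
  proof -
    have "conj_map G V h = conj_map G V g" if h: "h \<in> ?Z #> g" for h
    proof -
      obtain z where z: "z \<in> carrier G" "\<And>v. v \<in> V \<Longrightarrow> z \<otimes> v = v \<otimes> z" "h = z \<otimes> g"
        using h by (auto simp: r_coset_def centralizer_def)
      show ?thesis unfolding conj_map_def
      proof (rule restrict_ext)
        fix v assume v: "v \<in> V"
        then have vG: "v \<in> carrier G" using V by blast
        have "inv h \<otimes> v \<otimes> h = inv g \<otimes> (inv z \<otimes> (v \<otimes> z)) \<otimes> g"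
          using g z(1,3) vG by (simp add: inv_mult_group m_assoc)
        also have "inv z \<otimes> (v \<otimes> z) = v" using z(1) z(2)[OF v, symmetric] vG by simp
        finally show "inv h \<otimes> v \<otimes> h = inv g \<otimes> v \<otimes> g" .
      qed
    qed
    moreover have "g \<in> ?Z #> g"
      using g V by (auto simp: r_coset_def centralizer_def intro!: bexI[of _ \<one>])
    ultimately have "conj_map G V ` (?Z #> g) = {conj_map G V g}" by blast
    then show ?thesis by simp
  qed
  have "carrier (G Mod ?Z) = (\<lambda>g. ?Z #> g) ` carrier G"
    by (auto simp: FactGroup_def RCOSETS_def)
  then show ?thesis
    unfolding conj_quotient_def using single by (simp add: image_image cong: image_cong_simp)
qed

lemma permutes_pairs:
  assumes "\<sigma> permutes {1..4}" "T \<in> pairs"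
  shows "\<sigma> ` T \<in> pairs"
proof -
  have "card (\<sigma> ` T) = card T" using permutes_inj[OF assms(1)] by (intro card_image) (rule inj_on_subset, auto)
  moreover have "\<sigma> ` T \<subseteq> {1..4}"
    using permutes_image[OF assms(1)] assms(2) by (auto simp only: pairs_def mem_Collect_eq)
  ultimately show ?thesis using assms(2) by (simp add: pairs_def)
qed

context binary_space
begin

lemma conj_map_GL:
  assumes N: "V \<lhd> G" and g: "g \<in> carrier G"
  shows "conj_map G V g \<in> carrier (GLV)"
  unfolding GL_carrier
proof
  have cl: "inv x \<otimes> v \<otimes> x \<in> V" if "x \<in> carrier G" "v \<in> V" for x v
    by (rule normal.inv_op_closed1[OF N that])
  have cl': "x \<otimes> v \<otimes> inv x \<in> V" if "x \<in> carrier G" "v \<in> V" for x v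
    by (rule normal.inv_op_closed2[OF N that])
  have "bij_betw (conj_map G V g) V V"
    by (rule bij_betw_byWitness[of _ "\<lambda>v. g \<otimes> v \<otimes> inv g"])
       (use g V_car cl cl' in \<open>auto simp: conj_map_def m_assoc\<close>)
  then show "conj_map G V g \<in> Bij V" by (simp add: Bij_def conj_map_def)
  show "\<forall>u\<in>V. \<forall>v\<in>V. conj_map G V g (u \<otimes> v) = conj_map G V g u \<otimes> conj_map G V g v"
    using g V_car by (simp add: conj_map_def V_mult m_assoc)
qed

lemma conj_map_mult:
  assumes N: "V \<lhd> G" and g: "g \<in> carrier G" and h: "h \<in> carrier G" and v: "v \<in> V"
  shows "conj_map G V (g \<otimes> h) v = conj_map G V h (conj_map G V g v)"
proof -
  have "inv g \<otimes> v \<otimes> g \<in> V" by (rule normal.inv_op_closed1[OF N g v])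
  then show ?thesis using g h v V_car[OF v] by (simp add: conj_map_def inv_mult_group m_assoc)
qed

lemma conj_map_image:
  assumes "X \<subseteq> V" "g \<in> carrier G"
  shows "conj_map G V g ` X = conj_set (inv g) X"
  unfolding conj_set_def using assms by (intro image_cong) (auto simp: conj_map_def)

lemma coord_plane_subset:
  assumes f: "F2_basis G V (f \<circ> nat_index)" and T: "T \<in> pairs"
  shows "coord_plane G f T \<subseteq> V"
proof -
  have "f i \<in> V" if "i \<in> T" for i using frame_mem[OF f] T that by (auto simp: pairs_def)
  then show ?thesis unfolding coord_plane_def using V_one V_mult by blast
qed

lemma two_pairs:
  assumes "i \<in> {1..4}"
  obtains S T where "S \<in> pairs" "T \<in> pairs" "S \<noteq> T" "i \<in> S" "i \<in> T"
proof -
  have "i = 1 \<or> i = 2 \<or> i = 3 \<or> i = 4" using assms by auto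
  then show thesis
  proof (elim disjE)
    assume "i = 1" then show thesis using that[of "{1, 2}" "{1, 3}"] by (simp add: pairs_eq doubleton_eq_iff)
  next
    assume "i = 2" then show thesis using that[of "{1, 2}" "{2, 3}"] by (simp add: pairs_eq doubleton_eq_iff)
  next
    assume "i = 3" then show thesis using that[of "{1, 3}" "{2, 3}"] by (simp add: pairs_eq doubleton_eq_iff)
  next
    assume "i = 4" then show thesis using that[of "{1, 4}" "{2, 4}"] by (simp add: pairs_eq doubleton_eq_iff)
  qed
qed

text \<open>
  Every \<open>f i\<close> is the non-trivial element in the intersection of two coordinate planes. Their images are
  two different coordinate planes, whose intersection contains only some \<open>f j\<close> besides the identity.
\<close>

lemma frame_permuted:
  assumes f: "F2_basis G V (f \<circ> nat_index)" and k: "k \<in> carrier (GLV)"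
    and pres: "\<And>T. T \<in> pairs \<Longrightarrow> \<exists>S\<in>pairs. k ` coord_plane G f T = coord_plane G f S"
  shows "\<exists>\<sigma>. \<sigma> permutes {1..4} \<and> (\<forall>i\<in>{1..4}. k (f i) = f (\<sigma> i))"
proof -
  have injk: "inj_on k V" using k by (simp add: GL_carrier Bij_def bij_betw_def)
  have fV: "f i \<in> V" if "i \<in> {1..4}" for i by (rule frame_mem[OF f that])
  have "\<exists>j\<in>{1..4}. k (f i) = f j" if i: "i \<in> {1..4}" for i
  proof -
    obtain T T' where T: "T \<in> pairs" "T' \<in> pairs" "T \<noteq> T'" "i \<in> T" "i \<in> T'" by (rule two_pairs[OF i])
    obtain S where S: "S \<in> pairs" "k ` coord_plane G f T = coord_plane G f S" using pres[OF T(1)] by blast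
    obtain S' where S': "S' \<in> pairs" "k ` coord_plane G f T' = coord_plane G f S'" using pres[OF T(2)] by blast
    have "S \<noteq> S'"
    proof
      assume "S = S'"
      then have "k ` coord_plane G f T = k ` coord_plane G f T'" using S S' by simp
      then have "coord_plane G f T = coord_plane G f T'"
        using inj_on_image_eq_iff[OF injk coord_plane_subset[OF f T(1)] coord_plane_subset[OF f T(2)]] by simp
      then show False using coord_plane_inj[OF f T(1,2)] T(3) by simp
    qed
    moreover have "k (f i) \<in> coord_plane G f S" "k (f i) \<in> coord_plane G f S'"
      unfolding S(2)[symmetric] S'(2)[symmetric] using T(4,5) by (simp_all add: coord_plane_def)
    moreover have "k (f i) \<noteq> \<one>"
    proof
      assume "k (f i) = \<one>"
      then have "k (f i) = k \<one>" using GL_one[OF k] by simp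
      then show False using inj_onD[OF injk _ fV[OF i] V_one] frame_neq(1)[OF f i i] by blast
    qed
    ultimately obtain j where "j \<in> S \<inter> S'" "k (f i) = f j" using coord_plane_Int[OF f S(1) S'(1)] by blast
    then show ?thesis using S(1) by (auto simp: pairs_def)
  qed
  then obtain h where h: "\<And>i. i \<in> {1..4} \<Longrightarrow> h i \<in> {1..4} \<and> k (f i) = f (h i)" by metis
  define \<sigma> where "\<sigma> i = (if i \<in> {1..4} then h i else i)" for i
  have \<sigma>: "\<sigma> i \<in> {1..4}" "k (f i) = f (\<sigma> i)" if "i \<in> {1..4}" for i
    using h[OF that] that by (simp_all add: \<sigma>_def)
  have "inj_on \<sigma> {1..4}"
  proof (rule inj_onI)
    fix i j assume ij: "i \<in> {1..4}" "j \<in> {1..4}" "\<sigma> i = \<sigma> j"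
    then have "k (f i) = k (f j)" using \<sigma>(2) by simp
    then have "f i = f j" by (rule inj_onD[OF injk _ fV[OF ij(1)] fV[OF ij(2)]])
    then show "i = j" by (rule frame_neq(2)[OF f ij(1,2)])
  qed
  moreover have "\<sigma> ` {1..4} \<subseteq> {1..4}" using \<sigma>(1) by blast
  ultimately have "bij_betw \<sigma> {1..4} {1..4}"
    by (simp only: bij_betw_def endo_inj_surj[OF finite_atLeastAtMost] simp_thms)
  then have "\<sigma> permutes {1..4}" by (rule bij_imp_permutes) (simp only: \<sigma>_def if_False)
  then show ?thesis using \<sigma>(2) by blast
qed

text \<open>
  The permutations of the \<open>f i\<close> that are induced by conjugation form a pair-transitive group \<open>Q\<close>, and
  \<open>H\<close> consists of all automorphisms that permute the \<open>f i\<close> by an element of \<open>Q\<close>. The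
  conjugating element is the change of basis from \<open>f\<close> to the frame of \<open>e\<close>.
\<close>

lemma K_conjugate_of_octahedron:
  assumes N: "V \<lhd> G" and f: "F2_basis G V (f \<circ> nat_index)"
    and closed: "\<And>g T. g \<in> carrier G \<Longrightarrow> T \<in> pairs \<Longrightarrow> \<exists>S\<in>pairs. conj_set g (coord_plane G f T) = coord_plane G f S"
    and trans: "\<And>T. T \<in> pairs \<Longrightarrow> \<exists>g\<in>carrier G. conj_set g (coord_plane G f {1, 2}) = coord_plane G f T"
    and e: "F2_basis G V e" and W: "coord_plane G f {1, 2} = generate G {e 1, e 2}"
  shows "K_conjugate_to_matrices G V e H1 \<or> K_conjugate_to_matrices G V e H2"
proof -
  have P12: "{1, 2} \<in> pairs" by (simp add: pairs_eq)
  have fV: "f i \<in> V" if "i \<in> {1..4}" for i by (rule frame_mem[OF f that])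
  define Q where "Q = {\<sigma>. \<sigma> permutes {1..4} \<and> (\<exists>g\<in>carrier G. \<forall>i\<in>{1..4}. conj_map G V g (f i) = f (\<sigma> i))}"
  have perm: "\<exists>\<sigma>. \<sigma> permutes {1..4} \<and> (\<forall>i\<in>{1..4}. conj_map G V g (f i) = f (\<sigma> i))"
    if g: "g \<in> carrier G" for g
  proof (rule frame_permuted[OF f conj_map_GL[OF N g]])
    fix T assume T: "T \<in> pairs"
    show "\<exists>S\<in>pairs. conj_map G V g ` coord_plane G f T = coord_plane G f S"
      unfolding conj_map_image[OF coord_plane_subset[OF f T] g] by (rule closed[OF inv_closed[OF g] T])
  qed
  have Q_in: "\<sigma> i \<in> {1..4}" if "\<sigma> \<in> Q" "i \<in> {1..4}" for \<sigma> i
  proof -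
    have "\<sigma> permutes {1..4}" using that(1) unfolding Q_def by blast
    then show ?thesis using permutes_in_image that(2) by metis
  qed
  have H: "conj_quotient G V = perm_maps G V f Q"
    unfolding conj_quotient_eq[OF subgroup.subset[OF V_subgroup]]
  proof
    show "conj_map G V ` carrier G \<subseteq> perm_maps G V f Q"
    proof (rule image_subsetI)
      fix g assume g: "g \<in> carrier G"
      obtain \<sigma> where "\<sigma> permutes {1..4}" "\<forall>i\<in>{1..4}. conj_map G V g (f i) = f (\<sigma> i)"
        using perm[OF g] by blast
      then show "conj_map G V g \<in> perm_maps G V f Q"
        using conj_map_GL[OF N g] g unfolding perm_maps_def Q_def by blast
    qed
    show "perm_maps G V f Q \<subseteq> conj_map G V ` carrier G"
    proof
      fix k assume "k \<in> perm_maps G V f Q"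
      then obtain \<sigma> where k: "k \<in> carrier (GLV)" "\<sigma> \<in> Q" "\<forall>i\<in>{1..4}. k (f i) = f (\<sigma> i)"
        unfolding perm_maps_def by blast
      then obtain g where g: "g \<in> carrier G" "\<forall>i\<in>{1..4}. conj_map G V g (f i) = f (\<sigma> i)"
        unfolding Q_def by blast
      have "k = conj_map G V g"
        by (rule GL_eq_on_basis[OF k(1) conj_map_GL[OF N g(1)] f]) (use k(3) g(2) nat_index_range in auto)
      then show "k \<in> conj_map G V ` carrier G" using g(1) by blast
    qed
  qed
  interpret S: group "sym_group 4" by (rule sym_group_is_group)
  have "subgroup Q (sym_group 4)"
  proof (rule S.subgroup_finiteI)
    show sub: "Q \<subseteq> carrier (sym_group 4)" by (auto simp: Q_def sym_group_carrier)
    show "finite Q"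
      using finite_subset[OF sub] finite_permutations[of "{1..4::nat}"] by (simp add: sym_group_def)
    have "\<forall>i\<in>{1..4}. conj_map G V \<one> (f i) = f (id i)"
      using fV V_car by (simp add: conj_map_def)
    then show "\<one>\<^bsub>sym_group 4\<^esub> \<in> Q"
      unfolding sym_group_one Q_def using permutes_id one_closed by blast
    fix \<sigma> \<tau> assume \<sigma>: "\<sigma> \<in> Q" and \<tau>: "\<tau> \<in> Q"
    obtain g where g: "g \<in> carrier G" "\<forall>i\<in>{1..4}. conj_map G V g (f i) = f (\<sigma> i)" using \<sigma> by (auto simp: Q_def)
    obtain h where h: "h \<in> carrier G" "\<forall>i\<in>{1..4}. conj_map G V h (f i) = f (\<tau> i)" using \<tau> by (auto simp: Q_def)
    have "conj_map G V (h \<otimes> g) (f i) = f ((\<sigma> \<circ> \<tau>) i)" if i: "i \<in> {1..4}" for i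
      using conj_map_mult[OF N h(1) g(1) fV[OF i]] h(2) g(2) i Q_in[OF \<tau> i] by simp
    then show "\<sigma> \<otimes>\<^bsub>sym_group 4\<^esub> \<tau> \<in> Q"
      unfolding sym_group_mult using \<sigma> \<tau> g(1) h(1) permutes_compose[of \<tau> "{1..4}" \<sigma>]
      by (auto simp: Q_def simp del: atLeastAtMost_iff)
  qed
  moreover have "\<exists>\<sigma>\<in>Q. \<sigma> ` {1, 2} = T" if T: "T \<in> pairs" for T
  proof -
    obtain g where g: "g \<in> carrier G" "conj_set g (coord_plane G f {1, 2}) = coord_plane G f T" using trans[OF T] by blast
    obtain \<sigma> where \<sigma>: "\<sigma> permutes {1..4}" "\<forall>i\<in>{1..4}. conj_map G V (inv g) (f i) = f (\<sigma> i)"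
      using perm[OF inv_closed[OF g(1)]] by blast
    have \<sigma>Q: "\<sigma> \<in> Q" unfolding Q_def using \<sigma> inv_closed[OF g(1)] by blast
    have "coord_plane G f T = conj_map G V (inv g) ` coord_plane G f {1, 2}"
      using conj_map_image[OF coord_plane_subset[OF f P12] inv_closed[OF g(1)]] g by simp
    also have "\<dots> = coord_plane G (\<lambda>i. conj_map G V (inv g) (f i)) {1, 2}"
      by (rule coord_plane_image) (use GL_hom[OF conj_map_GL[OF N]] GL_one[OF conj_map_GL[OF N]] g(1) fV in auto)
    also have "\<dots> = coord_plane G f (\<sigma> ` {1, 2})"
      by (rule coord_plane_reindex) (use \<sigma>(2) in auto)
    finally have eq: "coord_plane G f T = coord_plane G f (\<sigma> ` {1, 2})" .
    have "\<sigma> ` {1, 2} \<in> pairs" by (rule permutes_pairs[OF \<sigma>(1) P12])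
    then show ?thesis using coord_plane_inj[OF f T _ eq] \<sigma>Q by blast
  qed
  ultimately have "Q = carrier (alt_group 4) \<or> Q = carrier (sym_group 4)"
    by (rule pair_transitive_subgroup)
  then have M: "permmat ` Q = H1 \<or> permmat ` Q = H2" using H1_permmat H2_permmat by auto
  obtain k where k: "k \<in> carrier (GLV)" "\<And>i. i \<in> {1..4} \<Longrightarrow> k (f i) = frame G e i"
    by (rule exists_GL_frames[OF f frame_basis[OF e]]) blast
  have "k ` coord_plane G f {1, 2} = coord_plane G (\<lambda>i. k (f i)) {1, 2}"
    by (rule coord_plane_image) (use GL_hom[OF k(1)] GL_one[OF k(1)] fV in auto)
  also have "\<dots> = coord_plane G (frame G e) (id ` {1, 2})"
    by (rule coord_plane_reindex) (use k(2) in auto)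
  also have "\<dots> = coord_plane G (frame G e) {1, 2}" by (simp only: image_id id_apply)
  also have "\<dots> = coord_plane G f {1, 2}" unfolding W generate_frame[OF F2_basisD(1)[OF e]] ..
  finally have kW: "k \<in> subspace_stabilizer G V (generate G {e 1, e 2})"
    unfolding subspace_stabilizer_def W[symmetric] using k(1) by simp
  have "(\<lambda>h. inv\<^bsub>GLV\<^esub> k \<otimes>\<^bsub>GLV\<^esub> h \<otimes>\<^bsub>GLV\<^esub> k) ` perm_maps G V f Q
      = perm_maps G V (\<lambda>i. k (f i)) Q"
    by (rule conj_perm_maps[OF k(1)]) (erule fV, erule (1) Q_in)
  also have "\<dots> = perm_maps G V (frame G e) Q"
    unfolding perm_maps_def using k(2) Q_in by (intro Collect_cong conj_cong refl bex_cong ball_cong) simp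
  also have "\<dots> = maps_of_matrices G V e (permmat ` Q)" by (rule maps_of_permmat[OF e, symmetric])
  finally have "K_conjugate_to_matrices G V e (permmat ` Q)"
    unfolding K_conjugate_to_matrices_def conjugate_under_def H using kW by blast
  then show ?thesis using M by metis
qed

text \<open>
  The required basis is the image of the frame of \<open>e\<close> under the inverse of the conjugating
  element \<open>k\<close>. Since \<open>k\<close> stabilises \<open>W\<close>, the first two vectors still span \<open>W\<close>. All six planes occur as
  conjugates because the alternating group is transitive on pairs.
\<close>

lemma octahedron_of_K_conjugate:
  assumes N: "V \<lhd> G" and e: "F2_basis G V e"
    and M: "K_conjugate_to_matrices G V e H1 \<or> K_conjugate_to_matrices G V e H2"
  shows "\<exists>f. F2_basis G V (f \<circ> nat_index) \<and> generate G {e 1, e 2} = coord_plane G f {1, 2} \<and>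
    (\<lambda>g. conj_set g (generate G {e 1, e 2})) ` carrier G = coord_plane G f ` pairs"
proof -
  interpret GL: group "GLV" by (rule group_GL)
  have P12: "{1, 2} \<in> pairs" by (simp add: pairs_eq)
  define W where "W = generate G {e 1, e 2}"
  note eV = F2_basisD(1)[OF e]
  have We: "W = coord_plane G (frame G e) {1, 2}" unfolding W_def by (rule generate_frame[OF eV])
  obtain Q where Q: "Q \<subseteq> carrier (sym_group 4)" "\<And>T. T \<in> pairs \<Longrightarrow> \<exists>\<sigma>\<in>Q. \<sigma> ` {1, 2} = T"
    "K_conjugate_to_matrices G V e (permmat ` Q)"
  proof -
    have alt: "carrier (alt_group 4) \<subseteq> carrier (sym_group 4)"
      by (rule subgroup.subset[OF alt_group_is_subgroup])
    have "\<exists>\<sigma>\<in>carrier (alt_group 4). \<sigma> ` {1, 2} = T" if "T \<in> pairs" for T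
      using generate_pair_transitive[OF subset_refl that] unfolding generate_alt_4 .
    then show thesis using that[of "carrier (alt_group 4)"] that[of "carrier (sym_group 4)"] M alt
      unfolding H1_permmat H2_permmat by blast
  qed
  obtain k where k: "k \<in> carrier (GLV)" "k ` W = W"
    and conj: "(\<lambda>h. inv\<^bsub>GLV\<^esub> k \<otimes>\<^bsub>GLV\<^esub> h \<otimes>\<^bsub>GLV\<^esub> k) ` conj_quotient G V
      = perm_maps G V (frame G e) Q"
    using Q(3) unfolding K_conjugate_to_matrices_def conjugate_under_def subspace_stabilizer_def
      maps_of_permmat[OF e] W_def by blast
  define k' where "k' = inv\<^bsub>GLV\<^esub> k"
  have k': "k' \<in> carrier (GLV)" using k(1) by (simp add: k'_def)
  define f where "f i = k' (frame G e i)" for i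
  have Q_in: "\<sigma> i \<in> {1..4}" if "\<sigma> \<in> Q" "i \<in> {1..4}" for \<sigma> i
    using that Q(1) permutes_in_image[of \<sigma> "{1..4}" i] by (auto simp: sym_group_carrier simp del: atLeastAtMost_iff)
  have H: "conj_quotient G V = perm_maps G V f Q"
  proof -
    have sub: "conj_quotient G V \<subseteq> carrier (GLV)"
      unfolding conj_quotient_eq[OF subgroup.subset[OF V_subgroup]] using conj_map_GL[OF N] by blast
    have "(\<lambda>h. inv\<^bsub>GLV\<^esub> k' \<otimes>\<^bsub>GLV\<^esub> h \<otimes>\<^bsub>GLV\<^esub> k') ` perm_maps G V (frame G e) Q
        = perm_maps G V f Q"
      unfolding f_def by (rule conj_perm_maps[OF k']) (rule comb_closed[OF eV], erule (1) Q_in)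
    moreover have "inv\<^bsub>GLV\<^esub> k' \<otimes>\<^bsub>GLV\<^esub>
        (inv\<^bsub>GLV\<^esub> k \<otimes>\<^bsub>GLV\<^esub> h \<otimes>\<^bsub>GLV\<^esub> k) \<otimes>\<^bsub>GLV\<^esub> k' = h"
      if "h \<in> conj_quotient G V" for h
    proof -
      have "h \<in> carrier (GLV)" using that sub by blast
      then show ?thesis using k(1) by (simp add: k'_def GL.m_assoc)
    qed
    ultimately show ?thesis unfolding conj[symmetric] image_image by simp
  qed
  have fb: "F2_basis G V (f \<circ> nat_index)"
    using GL_basis[OF k' frame_basis[OF e]] by (simp add: f_def comp_def)
  have fV: "f i \<in> V" if "i \<in> {1..4}" for i by (rule frame_mem[OF fb that])
  have WV: "W \<subseteq> V" unfolding We by (rule coord_plane_subset[OF frame_basis[OF e] P12])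
  have Wf: "W = coord_plane G f {1, 2}"
  proof -
    have "k' ` W = k' ` k ` W" using k(2) by simp
    also have "\<dots> = W" unfolding image_image using GL_inv_apply(1)[OF k(1)] WV
      by (force simp: k'_def)
    finally have "W = k' ` coord_plane G (frame G e) {1, 2}" using We by simp
    also have "\<dots> = coord_plane G f {1, 2}" unfolding f_def
      by (rule coord_plane_image) (use GL_hom[OF k'] GL_one[OF k'] comb_closed[OF eV] in auto)
    finally show ?thesis .
  qed
  have moved: "k ` W = coord_plane G f (\<sigma> ` {1, 2})"
    if k: "k \<in> carrier (GLV)" and \<sigma>: "\<forall>i\<in>{1..4}. k (f i) = f (\<sigma> i)" for k \<sigma>
  proof -
    have "k ` W = coord_plane G (\<lambda>i. k (f i)) {1, 2}"
      unfolding Wf by (rule coord_plane_image) (use GL_hom[OF k] GL_one[OF k] fV in auto)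
    also have "\<dots> = coord_plane G f (\<sigma> ` {1, 2})" by (rule coord_plane_reindex) (use \<sigma> in auto)
    finally show ?thesis .
  qed
  have "(\<lambda>g. conj_set g W) ` carrier G = coord_plane G f ` pairs"
  proof
    show "(\<lambda>g. conj_set g W) ` carrier G \<subseteq> coord_plane G f ` pairs"
    proof (rule image_subsetI)
      fix g assume g: "g \<in> carrier G"
      have "conj_map G V (inv g) \<in> perm_maps G V f Q"
        unfolding H[symmetric] conj_quotient_eq[OF subgroup.subset[OF V_subgroup]] using g by simp
      then obtain \<sigma> where \<sigma>: "\<sigma> \<in> Q" "\<forall>i\<in>{1..4}. conj_map G V (inv g) (f i) = f (\<sigma> i)"
        unfolding perm_maps_def by blast
      have "conj_set g W = coord_plane G f (\<sigma> ` {1, 2})"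
        using moved[OF conj_map_GL[OF N inv_closed[OF g]] \<sigma>(2)] conj_map_image[OF WV inv_closed[OF g]] g by simp
      moreover have "\<sigma> ` {1, 2} \<in> pairs"
        using permutes_pairs[OF _ P12] \<sigma>(1) Q(1) by (auto simp: sym_group_carrier)
      ultimately show "conj_set g W \<in> coord_plane G f ` pairs" by blast
    qed
    show "coord_plane G f ` pairs \<subseteq> (\<lambda>g. conj_set g W) ` carrier G"
    proof (rule image_subsetI)
      fix T assume "T \<in> pairs"
      then obtain \<sigma> where \<sigma>: "\<sigma> \<in> Q" "\<sigma> ` {1, 2} = T" using Q(2) by blast
      have \<sigma>p: "\<sigma> permutes {1..4}" using \<sigma>(1) Q(1) by (auto simp: sym_group_carrier)
      obtain h where h: "h \<in> carrier (GLV)" "\<And>i. i \<in> {1..4} \<Longrightarrow> h (f i) = (f \<circ> \<sigma>) i"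
        by (rule exists_GL_frames[OF fb permuted_basis[OF fb \<sigma>p]]) blast
      then have "h \<in> conj_quotient G V" unfolding H perm_maps_def using \<sigma>(1) by auto
      then obtain g where g: "g \<in> carrier G" "h = conj_map G V g"
        unfolding conj_quotient_eq[OF subgroup.subset[OF V_subgroup]] by blast
      have "\<forall>i\<in>{1..4}. h (f i) = f (\<sigma> i)" using h(2) by simp
      from moved[OF h(1) this] have "coord_plane G f T = h ` W" by (simp only: \<sigma>(2))
      also have "\<dots> = conj_set (inv g) W" by (simp only: g(2) conj_map_image[OF WV g(1)])
      finally have "coord_plane G f T = conj_set (inv g) W" .
      then show "coord_plane G f T \<in> (\<lambda>g. conj_set g W) ` carrier G" using g(1) by blast
    qed
  qed
  then show ?thesis using fb Wf unfolding W_def by blast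
qed

end

section \<open>Groups of ratio five sixths\<close>

text \<open>
  Independence of the four involutions comes from the opposite planes: a relation equates an element
  of \<open>\<langle>f\<^sub>1, f\<^sub>2\<rangle>\<close> with one of \<open>\<langle>f\<^sub>3, f\<^sub>4\<rangle>\<close>, and these meet trivially. As \<open>V\<close> is the
  product of these two members of \<open>C\<close>, it is normal.
\<close>

lemma octahedron_frame:
  fixes G (structure)
  assumes CF: "conjugate_family G C m" and W: "W \<in> C"
  shows "\<exists>V f. binary_space G V \<and> F2_basis G V (f \<circ> nat_index) \<and> V \<lhd> G \<and> C = coord_plane G f ` pairs \<and>
    W = coord_plane G f {1, 2}"
proof -
  interpret conjugate_family G C m by (rule CF)
  obtain a b c d where C: "C = {{\<one>, a, b, a \<otimes> b}, {\<one>, a, c, a \<otimes> c}, {\<one>, a, d, a \<otimes> d},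
      {\<one>, b, c, b \<otimes> c}, {\<one>, b, d, b \<otimes> d}, {\<one>, c, d, c \<otimes> d}}"
    and W': "W = {\<one>, a, b, a \<otimes> b}" and dist: "distinct [\<one>, a, b, c, d]" and abcd: "{a, b, c, d} \<subseteq> carrier G"
    and sq: "a \<otimes> a = \<one>" "b \<otimes> b = \<one>" "c \<otimes> c = \<one>" "d \<otimes> d = \<one>"
    and comm: "a \<otimes> b = b \<otimes> a" "a \<otimes> c = c \<otimes> a" "a \<otimes> d = d \<otimes> a"
      "b \<otimes> c = c \<otimes> b" "b \<otimes> d = d \<otimes> b" "c \<otimes> d = d \<otimes> c"
    and meet: "{\<one>, a, b, a \<otimes> b} \<inter> {\<one>, c, d, c \<otimes> d} = {\<one>}"
    by (rule klein_cover[OF W]) blast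
  define f where "f i = (if i = 1 then a else if i = 2 then b else if i = 3 then c else d)" for i :: nat
  have f: "f 1 = a" "f 2 = b" "f 3 = c" "f 4 = d" by (simp_all add: f_def)
  have car4: "\<forall>j. (f \<circ> nat_index) j \<in> carrier G" unfolding forall_4 comp_apply nat_index_simps f using abcd by simp
  have comm4: "\<forall>i j. (f \<circ> nat_index) i \<otimes> (f \<circ> nat_index) j = (f \<circ> nat_index) j \<otimes> (f \<circ> nat_index) i"
    unfolding forall_4 comp_apply nat_index_simps f using comm by simp
  have sq4: "\<forall>i. (f \<circ> nat_index) i \<otimes> (f \<circ> nat_index) i = \<one>" unfolding forall_4 comp_apply nat_index_simps f using sq by simp
  define V where "V = range (F2_comb G (f \<circ> nat_index))"
  have BS: "binary_space G V"
    unfolding V_def by (rule comb_range_subgroup) (use car4 comm4 sq4 in blast)+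
  interpret B: binary_space G V by (rule BS)
  have fV: "range (f \<circ> nat_index) \<subseteq> V"
  proof (rule image_subsetI)
    fix j show "(f \<circ> nat_index) j \<in> V"
      unfolding V_def using comb_axis[of "f \<circ> nat_index" j] car4 by (metis rangeI)
  qed
  have V4: "a \<in> V" "b \<in> V" "c \<in> V" "d \<in> V"
    using range_subsetD[OF fV, of 1] range_subsetD[OF fV, of 2] range_subsetD[OF fV, of 3] range_subsetD[OF fV, of 4]
    unfolding comp_apply nat_index_simps f by simp_all
  \<comment> \<open>The components of a linear combination in two opposite planes.\<close>
  define s where "s x = F2_smult G (x $ 1) a \<otimes> F2_smult G (x $ 2) b" for x :: "bit^4"
  define t where "t x = F2_smult G (x $ 3) c \<otimes> F2_smult G (x $ 4) d" for x :: "bit^4"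
  have comb: "F2_comb G (f \<circ> nat_index) x = s x \<otimes> t x" for x
    unfolding B.comb_ix f s_def t_def by (simp add: m_assoc B.V_car B.smult_closed V4)
  have s_in: "s x \<in> {\<one>, a, b, a \<otimes> b}" and t_in: "t x \<in> {\<one>, c, d, c \<otimes> d}" for x
    using abcd by (simp_all add: s_def t_def F2_smult_def)
  have stV: "s x \<in> V" "t x \<in> V" for x
    unfolding s_def t_def by (simp_all add: B.V_mult B.smult_closed V4)
  have basis: "F2_basis G V (f \<circ> nat_index)"
  proof (rule B.F2_basisI[OF fV])
    show "\<exists>x. v = F2_comb G (f \<circ> nat_index) x" if "v \<in> V" for v using that unfolding V_def by blast
    show "x = 0" if "F2_comb G (f \<circ> nat_index) x = \<one>" for x
    proof -
      have "s x = t x" using that B.V_eq_iff[OF stV] unfolding comb by simp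
      then have "s x \<in> {\<one>, a, b, a \<otimes> b} \<inter> {\<one>, c, d, c \<otimes> d}" using s_in[of x] t_in[of x] by (metis IntI)
      then have st: "s x = \<one>" "t x = \<one>" using \<open>s x = t x\<close> unfolding meet by simp_all
      have "F2_smult G (x $ 1) a = F2_smult G (x $ 2) b" "F2_smult G (x $ 3) c = F2_smult G (x $ 4) d"
        using st B.V_eq_iff B.smult_closed V4 unfolding s_def t_def by simp_all
      then have "x $ 1 = 0 \<and> x $ 2 = 0 \<and> x $ 3 = 0 \<and> x $ 4 = 0"
        using dist by (auto simp: F2_smult_def split: if_splits)
      then show "x = 0" unfolding vec_eq_iff forall_4 zero_index .
    qed
  qed
  have CP: "C = coord_plane G f ` pairs"
    unfolding pairs_eq image_insert image_empty B.coord_plane_list[OF basis] f C ..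
  have "V \<lhd> G"
  proof (rule normal_invI[OF B.V_subgroup])
    fix g v assume g: "g \<in> carrier G" and v: "v \<in> V"
    have in_V: "g \<otimes> w \<otimes> inv g \<in> V" if "X \<in> C" "w \<in> X" for w X
    proof -
      have "conj_set g X \<in> coord_plane G f ` pairs" using conj_closed[OF g that(1)] CP by simp
      then have "conj_set g X \<subseteq> V" using B.coord_plane_subset[OF basis] by blast
      then show ?thesis using that(2) unfolding conj_set_def by blast
    qed
    obtain x where x: "v = s x \<otimes> t x" using v unfolding V_def comb[symmetric] by blast
    have "g \<otimes> s x \<otimes> inv g \<in> V" by (rule in_V[OF _ s_in]) (simp add: C)
    moreover have "g \<otimes> t x \<otimes> inv g \<in> V" by (rule in_V[OF _ t_in]) (simp add: C)
    ultimately have "(g \<otimes> s x \<otimes> inv g) \<otimes> (g \<otimes> t x \<otimes> inv g) \<in> V" by (rule B.V_mult)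
    also have "(g \<otimes> s x \<otimes> inv g) \<otimes> (g \<otimes> t x \<otimes> inv g) = g \<otimes> v \<otimes> inv g"
      using g B.V_car[OF stV(1)] B.V_car[OF stV(2)] by (simp add: x m_assoc)
    finally show "g \<otimes> v \<otimes> inv g \<in> V" .
  qed
  moreover have "W = coord_plane G f {1, 2}" unfolding B.coord_plane_list[OF basis] f W' ..
  ultimately show ?thesis using BS basis CP by blast
qed

lemma subgroup_index_card:
  assumes G: "group G" and V: "subgroup V G" and W: "subgroup W G" and sub: "W \<subseteq> V"
  shows "subgroup_index G V W * card W = card V"
proof -
  interpret VG: group "G\<lparr>carrier := V\<rparr>" by (rule group.subgroup_imp_group[OF G V])
  have "subgroup W (G\<lparr>carrier := V\<rparr>)" by (rule group.subgroup_incl[OF G W V sub])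
  from VG.lagrange[OF this] show ?thesis by (simp add: subgroup_index_def order_def)
qed

proposition structure_of_ratio_5_6:
  assumes P: "finite_transitive_permutation_group G \<Omega> \<phi>" and \<alpha>: "\<alpha> \<in> \<Omega>"
    and I: "I_ratio G \<Omega> \<phi> \<alpha> = 5 / 6"
  shows "\<exists>V. V \<lhd> G \<and> elementary_abelian_2_group (G\<lparr>carrier := V\<rparr>) \<and>
    stabilizer G \<phi> \<alpha> \<subseteq> V \<and>
    subgroup_index G V (stabilizer G \<phi> \<alpha>) = 4 \<and> card (stabilizer G \<phi> \<alpha>) = 4 \<and>
    (\<forall>e. F2_basis G V e \<and> stabilizer G \<phi> \<alpha> = generate G {e 1, e 2} \<longrightarrow>
       K_conjugate_to_matrices G V e H1 \<or> K_conjugate_to_matrices G V e H2)"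
proof -
  let ?C = "stabilizer G \<phi> ` \<Omega>" and ?W = "stabilizer G \<phi> \<alpha>"
  obtain m where CF: "conjugate_family G ?C m" using stabilizer_family[OF P \<alpha> I] by blast
  interpret conjugate_family G ?C m by (rule CF)
  have WC: "?W \<in> ?C" using \<alpha> by simp
  obtain V f where BS: "binary_space G V" and f: "F2_basis G V (f \<circ> nat_index)" and N: "V \<lhd> G"
    and C: "?C = coord_plane G f ` pairs" and W: "?W = coord_plane G f {1, 2}"
    using octahedron_frame[OF CF WC] by (elim exE conjE)
  interpret B: binary_space G V by (rule BS)
  have P12: "{1, 2} \<in> pairs" by (simp add: pairs_eq)
  have WV: "?W \<subseteq> V" unfolding W by (rule B.coord_plane_subset[OF f P12])
  have W4: "card ?W = 4" unfolding W by (rule B.coord_plane_card[OF f P12])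
  have ea: "elementary_abelian_2_group (G\<lparr>carrier := V\<rparr>)"
    using elementary_abelian_iff[OF is_group B.V_subgroup] BS by simp
  have index: "subgroup_index G V ?W = 4"
    using subgroup_index_card[OF is_group B.V_subgroup sub[OF WC] WV] W4 B.card_V[OF f] by simp
  have K: "K_conjugate_to_matrices G V e H1 \<or> K_conjugate_to_matrices G V e H2"
    if e: "F2_basis G V e" "?W = generate G {e 1, e 2}" for e
  proof (rule B.K_conjugate_of_octahedron[OF N f _ _ e(1)])
    show "\<exists>S\<in>pairs. conj_set g (coord_plane G f T) = coord_plane G f S" if "g \<in> carrier G" "T \<in> pairs" for g T
      using conj_closed[OF that(1), of "coord_plane G f T"] that(2) unfolding C by blast
    show "\<exists>g\<in>carrier G. conj_set g (coord_plane G f {1, 2}) = coord_plane G f T" if "T \<in> pairs" for T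
      using conj_trans[OF WC, of "coord_plane G f T"] that unfolding C W by blast
    show "coord_plane G f {1, 2} = generate G {e 1, e 2}" using e(2) W by simp
  qed
  show ?thesis
    by (intro exI[of _ V] conjI allI impI N ea WV index W4 K) (elim conjE, assumption)+
qed

section \<open>The action on the cosets\<close>

lemma (in group) coset_action_transitive:
  assumes W: "subgroup W G"
  shows "transitive_action G (rcosets W) (coset_action G W)"
proof -
  let ?\<Omega> = "rcosets W" and ?\<phi> = "coset_action G W"
  have WG: "W \<subseteq> carrier G" by (rule subgroup.subset[OF W])
  have E: "\<exists>x\<in>carrier G. X = W #> x" if "X \<in> ?\<Omega>" for X using that by (auto simp: RCOSETS_def)
  have I: "W #> x \<in> ?\<Omega>" if "x \<in> carrier G" for x using that by (auto simp: RCOSETS_def)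
  have act: "?\<phi> g (W #> x) = W #> (x \<otimes> inv g)" if "g \<in> carrier G" "x \<in> carrier G" for g x
    using that WG I by (simp add: coset_action_def coset_mult_assoc)
  have closed: "?\<phi> g X \<in> ?\<Omega>" if g: "g \<in> carrier G" and X: "X \<in> ?\<Omega>" for g X
  proof -
    obtain x where "x \<in> carrier G" "X = W #> x" using E[OF X] by blast
    then show ?thesis using act[OF g] I g by simp
  qed
  have inverse: "?\<phi> g (?\<phi> (inv g) X) = X" if g: "g \<in> carrier G" and X: "X \<in> ?\<Omega>" for g X
  proof -
    obtain x where x: "x \<in> carrier G" "X = W #> x" using E[OF X] by blast
    then show ?thesis using act[of "inv g" x] act[of g "x \<otimes> g"] g by (simp add: m_assoc)
  qed
  have Bij: "?\<phi> g \<in> Bij ?\<Omega>" if g: "g \<in> carrier G" for g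
  proof -
    have "bij_betw (?\<phi> g) ?\<Omega> ?\<Omega>"
    proof (rule bij_betw_byWitness[of _ "?\<phi> (inv g)"])
      show "\<forall>a\<in>?\<Omega>. ?\<phi> (inv g) (?\<phi> g a) = a" using inverse[of "inv g"] g by simp
      show "\<forall>a'\<in>?\<Omega>. ?\<phi> g (?\<phi> (inv g) a') = a'" using inverse[OF g] by simp
    qed (use closed g in auto)
    then show ?thesis by (simp add: Bij_def coset_action_def)
  qed
  have "?\<phi> \<in> hom G (BijGroup ?\<Omega>)"
  proof (rule homI)
    fix g assume "g \<in> carrier G"
    then show "?\<phi> g \<in> carrier (BijGroup ?\<Omega>)" using Bij by (simp add: BijGroup_def)
  next
    fix g h assume g: "g \<in> carrier G" and h: "h \<in> carrier G"
    have "?\<phi> (g \<otimes> h) = compose ?\<Omega> (?\<phi> g) (?\<phi> h)"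
    proof
      fix X
      show "?\<phi> (g \<otimes> h) X = compose ?\<Omega> (?\<phi> g) (?\<phi> h) X"
      proof (cases "X \<in> ?\<Omega>")
        case True
        obtain x where x: "x \<in> carrier G" "X = W #> x" using E[OF True] by blast
        show ?thesis
          using act[of "g \<otimes> h" x] act[OF h x(1)] act[of g "x \<otimes> inv h"] g h x True
          by (simp add: compose_def inv_mult_group m_assoc)
      next
        case False
        then show ?thesis by (simp add: coset_action_def compose_def)
      qed
    qed
    then show "?\<phi> (g \<otimes> h) = ?\<phi> g \<otimes>\<^bsub>BijGroup ?\<Omega>\<^esub> ?\<phi> h"
      using Bij g h by (simp add: BijGroup_def)
  qed
  then have ga: "group_action G ?\<Omega> ?\<phi>"
    by (intro group_action.intro group_hom.intro is_group group_BijGroup group_hom_axioms.intro)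
  show ?thesis
  proof (intro transitive_action.intro ga transitive_action_axioms.intro)
    fix X Y assume "X \<in> ?\<Omega>" "Y \<in> ?\<Omega>"
    then obtain x y where xy: "x \<in> carrier G" "X = W #> x" "y \<in> carrier G" "Y = W #> y" using E by blast
    have "?\<phi> (inv y \<otimes> x) X = Y"
      using act[of "inv y \<otimes> x" x] xy by (simp add: inv_mult_group)
    then show "\<exists>g\<in>carrier G. ?\<phi> g X = Y" using xy by blast
  qed
qed

text \<open>
  \<open>W\<close> itself is a point, with stabilizer \<open>W\<close>; the others follow by transitivity.
\<close>

lemma (in group) coset_stabilizers:
  assumes W: "subgroup W G"
  shows "stabilizer G (coset_action G W) ` (rcosets W) = (\<lambda>g. conj_set g W) ` carrier G"
proof -
  interpret A: transitive_action G "rcosets W" "coset_action G W" by (rule coset_action_transitive[OF W])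
  have WO: "W \<in> rcosets W" by (rule subgroup.subgroup_in_rcosets[OF W is_group])
  have "stabilizer G (coset_action G W) W = W"
  proof
    show "W \<subseteq> stabilizer G (coset_action G W) W"
    proof
      fix w assume w: "w \<in> W"
      then have "W #> inv w = W"
        using subgroup.m_inv_closed[OF W] subgroup.mem_carrier[OF W] by (intro coset_join2 W) auto
      then show "w \<in> stabilizer G (coset_action G W) W"
        using w WO subgroup.mem_carrier[OF W] by (simp add: stabilizer_def coset_action_def)
    qed
    show "stabilizer G (coset_action G W) W \<subseteq> W"
    proof
      fix g assume "g \<in> stabilizer G (coset_action G W) W"
      then have g: "g \<in> carrier G" "W #> inv g = W" using WO by (auto simp: stabilizer_def coset_action_def)
      then have "inv g \<in> W" by (intro coset_join1[OF _ _ W]) auto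
      then show "g \<in> W" using subgroup.m_inv_closed[OF W] g(1) by fastforce
    qed
  qed
  then have st: "stabilizer G (coset_action G W) (coset_action G W g W) = conj_set g W" if "g \<in> carrier G" for g
    using A.stabilizer_conj[OF that WO] by simp
  show ?thesis
  proof
    show "stabilizer G (coset_action G W) ` (rcosets W) \<subseteq> (\<lambda>g. conj_set g W) ` carrier G"
    proof (rule image_subsetI)
      fix X assume "X \<in> rcosets W"
      then obtain g where "g \<in> carrier G" "coset_action G W g W = X" using A.unique_orbit[OF WO] by blast
      then show "stabilizer G (coset_action G W) X \<in> (\<lambda>g. conj_set g W) ` carrier G" using st by blast
    qed
    show "(\<lambda>g. conj_set g W) ` carrier G \<subseteq> stabilizer G (coset_action G W) ` (rcosets W)"
    proof (rule image_subsetI)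
      fix g assume g: "g \<in> carrier G"
      have "coset_action G W g W \<in> rcosets W" by (rule A.act_closed[OF g WO])
      then show "conj_set g W \<in> stabilizer G (coset_action G W) ` (rcosets W)" using st[OF g] by blast
    qed
  qed
qed

lemma induced_group_transitive:
  assumes tr: "transitive_action G \<Omega> \<phi>" and fin: "finite \<Omega>"
  shows "finite_transitive_permutation_group (induced_permutation_group G \<Omega> \<phi>) \<Omega> (\<lambda>p. p)"
proof -
  interpret transitive_action G \<Omega> \<phi> by (rule tr)
  let ?P = "induced_permutation_group G \<Omega> \<phi>"
  interpret Bi: group "BijGroup \<Omega>" by (rule group_BijGroup)
  have sg: "subgroup (\<phi> ` carrier G) (BijGroup \<Omega>)"
    by (rule group_hom.img_is_subgroup[OF group_hom])
  have gP: "group ?P" unfolding induced_permutation_group_def by (rule Bi.subgroup_imp_group[OF sg])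
  have "(\<lambda>p. p) \<in> hom ?P (BijGroup \<Omega>)"
    using subgroup.mem_carrier[OF sg] by (auto simp: hom_def induced_permutation_group_def)
  then have ga: "group_action ?P \<Omega> (\<lambda>p. p)"
    by (intro group_action.intro group_hom.intro gP group_BijGroup group_hom_axioms.intro)
  moreover have "\<exists>p\<in>carrier ?P. p x = y" if "x \<in> \<Omega>" "y \<in> \<Omega>" for x y
    using unique_orbit[OF that] by (auto simp: induced_permutation_group_def)
  ultimately show ?thesis
    using fin by (simp add: finite_transitive_permutation_group_def faithful_action_def
        faithful_action_axioms_def transitive_action_def transitive_action_axioms_def)
qed

text \<open>
  The orbits are the same, because the stabilizer in the induced group is the image of the
  stabilizer in \<open>G\<close>.
\<close>

lemma induced_group_ratio:
  "I_ratio (induced_permutation_group G \<Omega> \<phi>) \<Omega> (\<lambda>p. p) \<alpha> = I_ratio G \<Omega> \<phi> \<alpha>"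
proof -
  let ?P = "induced_permutation_group G \<Omega> \<phi>"
  have st: "stabilizer ?P (\<lambda>p. p) \<alpha> = \<phi> ` stabilizer G \<phi> \<alpha>"
    by (auto simp: stabilizer_def induced_permutation_group_def)
  have "orbit (?P\<lparr>carrier := stabilizer ?P (\<lambda>p. p) \<alpha>\<rparr>) (\<lambda>p. p) x = orbit (G\<lparr>carrier := stabilizer G \<phi> \<alpha>\<rparr>) \<phi> x" for x
    unfolding st by (auto simp: orbit_def)
  then show ?thesis unfolding I_ratio_def orbits_def by (simp only:)
qed

text \<open>
  Only the complement of \<open>S\<close> is excluded.
\<close>

lemma card_meeting_pairs:
  assumes S: "S \<in> pairs"
  shows "card {T \<in> pairs. S \<inter> T \<noteq> {}} = 5"
proof -
  let ?S' = "{1..4} - S"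
  have S': "S \<subseteq> {1..4}" "card S = 2" "finite S" using S finite_subset[of S "{1..4}"] by (auto simp: pairs_def)
  have c: "card ?S' = 2" using S' by (simp add: card_Diff_subset)
  then have "?S' \<in> pairs" by (auto simp: pairs_def)
  have "S \<inter> T \<noteq> {} \<longleftrightarrow> T \<notin> {?S'}" if T: "T \<in> pairs" for T
  proof -
    have "T = ?S'" if "S \<inter> T = {}"
    proof (rule card_subset_eq)
      show "T \<subseteq> ?S'" using that T unfolding pairs_def by blast
      show "card T = card ?S'" using c T unfolding pairs_def by simp
    qed simp
    moreover have "S \<inter> ?S' = {}" by blast
    ultimately show ?thesis by (metis singleton_iff)
  qed
  then have "{T \<in> pairs. S \<inter> T \<noteq> {}} = pairs - {?S'}" by blast
  then show ?thesis using \<open>?S' \<in> pairs\<close> finite_pairs by (simp add: card_pairs)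
qed

proposition ratio_5_6_of_structure:
  fixes G (structure)
  assumes "group G" and finG: "finite (carrier G)" and N: "V \<lhd> G"
    and ea: "elementary_abelian_2_group (G\<lparr>carrier := V\<rparr>)"
    and gen: "V = generate G {e 1, e 2, e 3, e 4}" and card: "card V = 16"
    and M: "K_conjugate_to_matrices G V e H1 \<or> K_conjugate_to_matrices G V e H2"
    and W: "W = generate G {e 1, e 2}"
  defines "\<Omega> \<equiv> rcosets W"
  defines "P \<equiv> induced_permutation_group G \<Omega> (coset_action G W)"
  shows "finite_transitive_permutation_group P \<Omega> (\<lambda>p. p)"
    and "card \<Omega> = 4 * subgroup_index G (carrier G) V"
    and "\<alpha> \<in> \<Omega> \<Longrightarrow> I_ratio P \<Omega> (\<lambda>p. p) \<alpha> = 5 / 6"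
proof -
  interpret group G by fact
  have VG: "subgroup V G" using N by (rule normal_imp_subgroup)
  interpret B: binary_space G V using elementary_abelian_iff[OF \<open>group G\<close> VG] ea by simp
  have eV: "range e \<subseteq> V"
  proof (rule image_subsetI)
    fix j
    have "\<forall>j. e j \<in> V" unfolding forall_4 gen by (simp add: generate.incl)
    then show "e j \<in> V" by blast
  qed
  have e: "F2_basis G V e"
  proof (rule B.spanning_basis[OF eV _ card])
    have "{e 1, e 2, e 3, e 4} \<subseteq> range (F2_comb G e)" using B.basis_in_range[OF eV] by simp
    then have "generate G {e 1, e 2, e 3, e 4} \<subseteq> range (F2_comb G e)"
      by (rule generate_subgroup_incl[OF _ B.comb_range_binary[OF eV]])
    then show "V \<subseteq> range (F2_comb G e)" using gen by simp
  qed
  obtain f where f: "F2_basis G V (f \<circ> nat_index)" and Wf: "W = coord_plane G f {1, 2}"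
    and C: "(\<lambda>g. conj_set g W) ` carrier G = coord_plane G f ` pairs"
    using B.octahedron_of_K_conjugate[OF N e M] unfolding W by blast
  have P12: "{1, 2} \<in> pairs" by (simp add: pairs_eq)
  have Ws: "subgroup W G" unfolding W by (rule generate_is_subgroup) (use eV B.V_car in auto)
  have W4: "card W = 4" unfolding Wf by (rule B.coord_plane_card[OF f P12])
  have tr: "transitive_action G \<Omega> (coset_action G W)"
    unfolding \<Omega>_def by (rule coset_action_transitive[OF Ws])
  have fin: "finite \<Omega>"
    unfolding \<Omega>_def using finite_subset[OF rcosets_subset_PowG[OF Ws]] finG by simp
  show "finite_transitive_permutation_group P \<Omega> (\<lambda>p. p)"
    unfolding P_def by (rule induced_group_transitive[OF tr fin])
  have "card \<Omega> * 4 = order G" unfolding \<Omega>_def W4[symmetric] by (rule lagrange[OF Ws])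
  moreover have "subgroup_index G (carrier G) V * 16 = order G"
    using subgroup_index_card[OF \<open>group G\<close> subgroup_self VG subgroup.subset[OF VG]] card by (simp add: order_def)
  ultimately show "card \<Omega> = 4 * subgroup_index G (carrier G) V" by linarith
  assume \<alpha>: "\<alpha> \<in> \<Omega>"
  let ?s = "stabilizer G (coset_action G W)"
  have sC: "?s ` \<Omega> = coord_plane G f ` pairs" unfolding \<Omega>_def coset_stabilizers[OF Ws] by (rule C)
  have "?s \<alpha> \<in> coord_plane G f ` pairs" unfolding sC[symmetric] using \<alpha> by (rule imageI)
  then obtain S where S: "S \<in> pairs" "?s \<alpha> = coord_plane G f S" by blast
  have "finite (?s \<alpha>)" by (rule finite_subset[OF _ finG]) (auto simp: stabilizer_def)
  have inj: "inj_on (coord_plane G f) pairs"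
    by (rule inj_onI) (rule B.coord_plane_inj[OF f])
  from I_ratio_eq[OF tr fin \<alpha> \<open>finite (?s \<alpha>)\<close>]
  have "I_ratio P \<Omega> (\<lambda>p. p) \<alpha>
      = real (card {X \<in> coord_plane G f ` pairs. near (coord_plane G f S) X}) / real (card (coord_plane G f ` pairs))"
    unfolding P_def induced_group_ratio sC S(2) .
  also have "{X \<in> coord_plane G f ` pairs. near (coord_plane G f S) X} = coord_plane G f ` {T \<in> pairs. near (coord_plane G f S) (coord_plane G f T)}"
    by (rule Compr_image_eq)
  also have "{T \<in> pairs. near (coord_plane G f S) (coord_plane G f T)} = {T \<in> pairs. S \<inter> T \<noteq> {}}"
    by (rule Collect_cong, rule conj_cong[OF refl]) (rule B.near_coord_plane[OF f S(1)])
  also have "card (coord_plane G f ` {T \<in> pairs. S \<inter> T \<noteq> {}}) = 5"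
  proof -
    have "inj_on (coord_plane G f) {T \<in> pairs. S \<inter> T \<noteq> {}}"
      by (rule inj_on_subset[OF inj]) blast
    then show ?thesis by (simp add: card_image card_meeting_pairs[OF S(1)])
  qed
  also have "card (coord_plane G f ` pairs) = 6"
    by (simp add: card_image[OF inj] card_pairs)
  finally show "I_ratio P \<Omega> (\<lambda>p. p) \<alpha> = 5 / 6" by simp
qed

theorem theorem1p2:
  shows
    "(\<forall>(G :: 'a monoid) (\<Omega> :: 'b set) \<phi> \<alpha>.
        finite_transitive_permutation_group G \<Omega> \<phi> \<and> \<alpha> \<in> \<Omega> \<and> I_ratio G \<Omega> \<phi> \<alpha> = 5 / 6 \<longrightarrow>
        (\<exists>V. V \<lhd> G \<and> elementary_abelian_2_group (G\<lparr>carrier := V\<rparr>) \<and>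
             stabilizer G \<phi> \<alpha> \<subseteq> V \<and>
             subgroup_index G V (stabilizer G \<phi> \<alpha>) = 4 \<and> card (stabilizer G \<phi> \<alpha>) = 4 \<and>
             (\<forall>e. F2_basis G V e \<and> stabilizer G \<phi> \<alpha> = generate G {e 1, e 2} \<longrightarrow>
                  K_conjugate_to_matrices G V e H1 \<or> K_conjugate_to_matrices G V e H2)))
     \<and> (order (GL4\<lparr>carrier := H1\<rparr>) = 12 \<and> GL4\<lparr>carrier := H1\<rparr> \<cong> alt_group 4)
     \<and> (order (GL4\<lparr>carrier := H2\<rparr>) = 24 \<and> GL4\<lparr>carrier := H2\<rparr> \<cong> sym_group 4)
     \<and> (\<forall>(G :: 'c monoid) V e.
          group G \<and> finite (carrier G) \<and> V \<lhd> G \<and> elementary_abelian_2_group (G\<lparr>carrier := V\<rparr>) \<and>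
          V = generate G {e 1, e 2, e 3, e 4} \<and> card V = 16 \<and>
          (K_conjugate_to_matrices G V e H1 \<or> K_conjugate_to_matrices G V e H2) \<longrightarrow>
          (let W = generate G {e 1, e 2};
               \<Omega> = rcosets\<^bsub>G\<^esub> W;
               P = induced_permutation_group G \<Omega> (coset_action G W)
           in finite_transitive_permutation_group P \<Omega> (\<lambda>p. p) \<and>
              card \<Omega> = 4 * subgroup_index G (carrier G) V \<and>
              (\<forall>\<alpha> \<in> \<Omega>. I_ratio P \<Omega> (\<lambda>p. p) \<alpha> = 5 / 6)))"
proof (intro conjI allI impI)
  fix G :: "'a monoid" and \<Omega> :: "'b set" and \<phi> \<alpha>
  assume "finite_transitive_permutation_group G \<Omega> \<phi> \<and> \<alpha> \<in> \<Omega> \<and> I_ratio G \<Omega> \<phi> \<alpha> = 5 / 6"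
  then show "\<exists>V. V \<lhd> G \<and> elementary_abelian_2_group (G\<lparr>carrier := V\<rparr>) \<and>
       stabilizer G \<phi> \<alpha> \<subseteq> V \<and>
       subgroup_index G V (stabilizer G \<phi> \<alpha>) = 4 \<and> card (stabilizer G \<phi> \<alpha>) = 4 \<and>
       (\<forall>e. F2_basis G V e \<and> stabilizer G \<phi> \<alpha> = generate G {e 1, e 2} \<longrightarrow>
            K_conjugate_to_matrices G V e H1 \<or> K_conjugate_to_matrices G V e H2)"
    by (elim conjE) (rule structure_of_ratio_5_6)
next
  fix G :: "'c monoid" and V and e :: "4 \<Rightarrow> 'c"
  assume "group G \<and> finite (carrier G) \<and> V \<lhd> G \<and> elementary_abelian_2_group (G\<lparr>carrier := V\<rparr>) \<and>
      V = generate G {e 1, e 2, e 3, e 4} \<and> card V = 16 \<and>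
      (K_conjugate_to_matrices G V e H1 \<or> K_conjugate_to_matrices G V e H2)"
  then have h: "group G" "finite (carrier G)" "V \<lhd> G" "elementary_abelian_2_group (G\<lparr>carrier := V\<rparr>)"
      "V = generate G {e 1, e 2, e 3, e 4}" "card V = 16"
      "K_conjugate_to_matrices G V e H1 \<or> K_conjugate_to_matrices G V e H2" by blast+
  show "let W = generate G {e 1, e 2}; \<Omega> = rcosets\<^bsub>G\<^esub> W;
            P = induced_permutation_group G \<Omega> (coset_action G W)
        in finite_transitive_permutation_group P \<Omega> (\<lambda>p. p) \<and>
           card \<Omega> = 4 * subgroup_index G (carrier G) V \<and>
           (\<forall>\<alpha> \<in> \<Omega>. I_ratio P \<Omega> (\<lambda>p. p) \<alpha> = 5 / 6)"
    unfolding Let_def by (intro conjI ballI ratio_5_6_of_structure[OF h refl])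
qed (fact order_H1 iso_H1 order_H2 iso_H2)+

end
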